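(* Let $\Omega \subseteq \mathbb{R}^2$ be a bounded convex domain whose boundary $\partial\Omega$ is smooth and has nowhere vanishing Gaussian curvature. Then $$\|\mathcal{D}(\Omega,x,R)\|_{L^4} \lesssim R^{1/2}\log^{1/4}(R),$$ i.e. there is a constant $C>0$ (independent of $R$) such that for all sufficiently large $R$, $$\left(\int_{\mathbb{T}^2} |\mathcal{D}(\Omega,x,R)|^4\,dx\right)^{1/4} \le C R^{1/2} (\log R)^{1/4}.$$
   Context: $\mathbb{T}^2=[0,1]\times[0,1]$. For $x\in\mathbb{T}^2$ and $R\ge 1$, $R\Omega - x := \{y\in\mathbb{R}^2 : (y+x)/R\in\Omega\}$, $\chi_{E}$ denotes the indicator function of a set $E$, $|\Omega|$ is the area of $\Omega$, and the discrepancy function is $$\mathcal{D}(\Omega,x,R) = \sum_{k\in\mathbb{Z}^2}\chi_{R\Omega-x}(k)-R^2|\Omega|.$$ Its $L^p$ norm is taken in the variable $x$: $\|\mathcal{D}(\Omega,x,R)\|_{L^p} := \left(\int_{\mathbb{T}^2}|\mathcal{D}(\Omega,x,R)|^p dx\right)^{1/p}$. The notation $h(R)\lesssim g(R)$ means $h(R)\le C g(R)$ for all sufficiently large $R$ and some constant $C>0$. *)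

theory Defs
  imports "HOL-Analysis.Analysis"
begin

definition curve_deriv :: "(real \<Rightarrow> real^2) \<Rightarrow> real \<Rightarrow> real^2" where
  "curve_deriv \<gamma> = (\<lambda>t. vector_derivative \<gamma> (at t))"

(* For open I this is infinite differentiability on I: the derivatives at points of I do not
   depend on the values of \<gamma> outside I. *)
definition smooth_curve_on :: "real set \<Rightarrow> (real \<Rightarrow> real^2) \<Rightarrow> bool" where
  "smooth_curve_on I \<gamma> \<longleftrightarrow> (\<forall>n. \<forall>t\<in>I. (curve_deriv ^^ n) \<gamma> differentiable (at t))"

(* Signed curvature det(\<gamma>', \<gamma>'') / |\<gamma>'|^3, the one-dimensional Gaussian curvature. *)
definition curvature :: "(real \<Rightarrow> real^2) \<Rightarrow> real \<Rightarrow> real" where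
  "curvature \<gamma> t =
     (curve_deriv \<gamma> t $ 1 * curve_deriv (curve_deriv \<gamma>) t $ 2
      - curve_deriv \<gamma> t $ 2 * curve_deriv (curve_deriv \<gamma>) t $ 1) / norm (curve_deriv \<gamma> t) ^ 3"

definition local_parametrization ::
  "(real^2) set \<Rightarrow> real set \<Rightarrow> (real \<Rightarrow> real^2) \<Rightarrow> bool" where
  "local_parametrization S I \<gamma> \<longleftrightarrow>
     open I \<and> connected I \<and> smooth_curve_on I \<gamma> \<and> (\<forall>t\<in>I. curve_deriv \<gamma> t \<noteq> 0) \<and>
     openin (top_of_set S) (\<gamma> ` I) \<and> (\<exists>\<delta>. homeomorphism I (\<gamma> ` I) \<gamma> \<delta>)"

(* S is a smooth one-dimensional embedded submanifold of the plane. *)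
definition smooth_embedded_curve :: "(real^2) set \<Rightarrow> bool" where
  "smooth_embedded_curve S \<longleftrightarrow>
     (\<forall>p\<in>S. \<exists>I \<gamma>. local_parametrization S I \<gamma> \<and> p \<in> \<gamma> ` I)"

(* Reparametrization changes the curvature at a point of S at most by a sign, so it is
   immaterial whether all or only some local parametrizations at each point are tested. *)
definition nonvanishing_curvature :: "(real^2) set \<Rightarrow> bool" where
  "nonvanishing_curvature S \<longleftrightarrow>
     (\<forall>I \<gamma>. local_parametrization S I \<gamma> \<longrightarrow> (\<forall>t\<in>I. curvature \<gamma> t \<noteq> 0))"

definition integer_lattice :: "(real^2) set" where
  "integer_lattice = {k. \<forall>i. k $ i \<in> \<int>}"

definition dilate_shift :: "(real^2) set \<Rightarrow> real^2 \<Rightarrow> real \<Rightarrow> (real^2) set" where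
  "dilate_shift \<Omega> x R = {y. (1 / R) *\<^sub>R (y + x) \<in> \<Omega>}"

definition discrepancy :: "(real^2) set \<Rightarrow> real^2 \<Rightarrow> real \<Rightarrow> real" where
  "discrepancy \<Omega> x R =
     (\<Sum>\<^sub>\<infinity>k\<in>integer_lattice. indicator (dilate_shift \<Omega> x R) k) - R\<^sup>2 * measure lebesgue \<Omega>"

definition torus :: "(real^2) set" where
  "torus = cbox (\<chi> i. 0) (\<chi> i. 1)"

definition Lp_integrable :: "real \<Rightarrow> (real^2 \<Rightarrow> real) \<Rightarrow> bool" where
  "Lp_integrable p f \<longleftrightarrow> set_integrable lebesgue torus (\<lambda>x. \<bar>f x\<bar> powr p)"

(* The Bochner integral is 0 by convention for non-integrable functions, so this is the
   L^p norm only together with Lp_integrable p f. *)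
definition Lp_norm :: "real \<Rightarrow> (real^2 \<Rightarrow> real) \<Rightarrow> real" where
  "Lp_norm p f = (LINT x:torus|lebesgue. \<bar>f x\<bar> powr p) powr (1 / p)"

end

theory Submission
  imports Defs
begin

text \<open>
The fourth moment is computed on the Fourier side. For a lattice vector \<open>n \<noteq> 0\<close> the \<open>n\<close>-th
Fourier coefficient of the periodic function \<open>x \<mapsto> discrepancy \<Omega> x R\<close> is the Fourier transform of the
indicator function of the dilate of \<open>\<Omega>\<close> by \<open>R\<close>, taken at \<open>n\<close>; the mean vanishes because the area is
subtracted. Non-vanishing curvature makes these coefficients \<open>O(R powr (1/2) * \<bar>n\<bar> powr (-3/2))\<close>.
The fourth power of the \<open>L\<^sup>4\<close> norm is the square of the \<open>L\<^sup>2\<close> norm of the squared function, and squaring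
a function convolves its coefficients. In dimension two the convolution of \<open>\<bar>n\<bar> powr (-3/2)\<close> with
itself is \<open>O(1 / \<bar>m\<bar>)\<close>, so that Parseval's identity gives \<open>R\<^sup>2\<close> times the sum of \<open>1 / \<bar>m\<bar>\<^sup>2\<close>. This sum
diverges only logarithmically, and once the frequencies are cut off at a power of \<open>R\<close> it contributes
the factor \<open>ln R\<close>.

The decay of the coefficients comes from the lengths of chords. Curvature, compactness and convexity give
a constant \<open>M\<close> such that \<open>\<Omega>\<close> lies, at each of its supporting lines, inside a ball of radius \<open>M / 2\<close>
touching that line (\<open>positive_curvature_quadratically_supported\<close>). Hence the chord of \<open>\<Omega>\<close> parallel to
a supporting line at depth \<open>t\<close> has length \<open>O(sqrt t)\<close>. As a function of \<open>t\<close> the chord length is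
concave, and the Fourier transform of a concave function with this behaviour at the ends of its
support is estimated by a single second difference at half a period
(\<open>oscillatory_integral_second_difference_bound\<close>).

The cut-off is made with the Fejer kernel, whose convolution with the lattice count is a
trigonometric polynomial, so that all Fourier sums are finite. The count for the dilate by \<open>R\<close> lies
between the smoothed counts for the dilates by \<open>R - 1/R\<close> and \<open>R + 1/R\<close>, up to the small mass of
the kernel away from the lattice (\<open>smoothing_comparison\<close>). The change of the dilation factor alters
the area by \<open>O(1)\<close> only, and a kernel of degree \<open>R ^ 4\<close> makes the remaining error \<open>O(1)\<close> as well.
\<close>

section \<open>Curvature and quadratic support\<close>

text \<open>For a unit vector \<open>w\<close> the inequality says that \<open>A\<close> lies in the closed ball of radius \<open>M / 2\<close> which
touches the supporting line of \<open>A\<close> orthogonal to \<open>w\<close> at \<open>p\<close>, since \<open>\<bar>x - p\<bar>\<^sup>2 \<le> M * ((p - x) \<bullet> w)\<close>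
rearranges to \<open>\<bar>x - (p - (M / 2) w)\<bar> \<le> M / 2\<close>. The factor \<open>norm w\<close> makes the condition homogeneous in
\<open>w\<close>.\<close>
definition quadratically_supported :: "real \<Rightarrow> 'a::euclidean_space set \<Rightarrow> bool" where
  "quadratically_supported M A \<longleftrightarrow>
     (\<forall>p\<in>closure A. \<forall>w. (\<forall>x\<in>A. x \<bullet> w \<le> p \<bullet> w) \<longrightarrow>
        (\<forall>x\<in>A. (norm (x - p))\<^sup>2 * norm w \<le> M * ((p - x) \<bullet> w)))"

lemma quadratically_supported_isometry:
  fixes g :: "'a::euclidean_space \<Rightarrow> 'b::euclidean_space"
  assumes qs: "quadratically_supported M A" and lin: "linear g" and iso: "\<And>x y. g x \<bullet> g y = x \<bullet> y"
    and surj: "surj g"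
  shows "quadratically_supported M (g -` A)"
  unfolding quadratically_supported_def
proof (intro ballI allI impI)
  fix p w x assume p: "p \<in> closure (g -` A)" and w: "\<forall>x\<in>g -` A. x \<bullet> w \<le> p \<bullet> w" and x: "x \<in> g -` A"
  have "g p \<in> closure (g ` (g -` A))" using closure_linear_image_subset[OF lin] p by blast
  then have gp: "g p \<in> closure A" using closure_mono[of "g ` (g -` A)" A] by auto
  have "y \<bullet> g w \<le> g p \<bullet> g w" if "y \<in> A" for y
  proof -
    obtain x' where "y = g x'" using surj by blast
    then show ?thesis using w that by (auto simp: iso)
  qed
  then have "(norm (g x - g p))\<^sup>2 * norm (g w) \<le> M * ((g p - g x) \<bullet> g w)"
    using qs gp x unfolding quadratically_supported_def by blast
  moreover have "g x - g p = g (x - p)" "g p - g x = g (p - x)" using lin by (auto simp: linear_diff)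
  moreover have "norm (g y) = norm y" for y by (simp add: norm_eq_sqrt_inner iso)
  ultimately show "(norm (x - p))\<^sup>2 * norm w \<le> M * ((p - x) \<bullet> w)" by (simp add: iso)
qed

text \<open>The touching balls scale with the set, hence the constant \<open>R * M\<close>.\<close>
lemma quadratically_supported_affine:
  fixes A :: "'a::euclidean_space set"
  assumes qs: "quadratically_supported M A" and R: "R > 0"
  shows "quadratically_supported (R * M) ((\<lambda>x. R *\<^sub>R x + v) ` A)"
  unfolding quadratically_supported_def
proof (intro ballI allI impI)
  let ?f = "\<lambda>x. R *\<^sub>R x + v" and ?g = "\<lambda>y. (1 / R) *\<^sub>R (y - v)"
  fix p w y assume p: "p \<in> closure (?f ` A)" and w: "\<forall>x\<in>?f ` A. x \<bullet> w \<le> p \<bullet> w" and y: "y \<in> ?f ` A"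
  obtain x where x: "x \<in> A" "y = ?f x" using y by blast
  define q where "q = ?g p"
  have pq: "p = ?f q" using R by (simp add: q_def)
  have "?g ` closure (?f ` A) \<subseteq> closure (?g ` (?f ` A))"
    by (rule continuous_image_closure_subset[of UNIV]) (auto intro!: continuous_intros)
  moreover have "?g ` (?f ` A) = A" using R by (auto simp: image_image)
  ultimately have q: "q \<in> closure A" using p unfolding q_def by auto
  have "z \<bullet> w \<le> q \<bullet> w" if "z \<in> A" for z
  proof -
    have "?f z \<bullet> w \<le> p \<bullet> w" using w that by blast
    then show ?thesis using R by (simp add: pq inner_add_left)
  qed
  then have h: "(norm (x - q))\<^sup>2 * norm w \<le> M * ((q - x) \<bullet> w)"
    using qs q x unfolding quadratically_supported_def by blast
  have "y - p = R *\<^sub>R (x - q)" "p - y = R *\<^sub>R (q - x)" by (auto simp: x pq algebra_simps)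
  then have e: "(norm (y - p))\<^sup>2 * norm w = R\<^sup>2 * ((norm (x - q))\<^sup>2 * norm w)"
    "R * M * ((p - y) \<bullet> w) = R\<^sup>2 * (M * ((q - x) \<bullet> w))"
    using R by (simp_all add: power_mult_distrib power2_eq_square)
  show "(norm (y - p))\<^sup>2 * norm w \<le> R * M * ((p - y) \<bullet> w)"
    unfolding e using h by (rule mult_left_mono) simp
qed

lemma smooth_curve_on_vector_derivative:
  assumes "smooth_curve_on I \<gamma>" "t \<in> I"
  shows "(\<gamma> has_vector_derivative curve_deriv \<gamma> t) (at t)"
    and "(curve_deriv \<gamma> has_vector_derivative curve_deriv (curve_deriv \<gamma>) t) (at t)"
    and "isCont (curve_deriv \<gamma>) t"
    and "isCont (curve_deriv (curve_deriv \<gamma>)) t"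
proof -
  have d: "(curve_deriv ^^ n) \<gamma> differentiable (at t)" for n
    using assms unfolding smooth_curve_on_def by blast
  have d0: "\<gamma> differentiable (at t)" using d[of 0] by simp
  have d1: "curve_deriv \<gamma> differentiable (at t)" using d[of 1] by simp
  have d2: "curve_deriv (curve_deriv \<gamma>) differentiable (at t)"
    using d[of 2] by (simp add: numeral_2_eq_2)
  show "(\<gamma> has_vector_derivative curve_deriv \<gamma> t) (at t)"
    using d0 by (simp add: vector_derivative_works curve_deriv_def)
  show "(curve_deriv \<gamma> has_vector_derivative curve_deriv (curve_deriv \<gamma>) t) (at t)"
    using d1 by (simp add: vector_derivative_works curve_deriv_def)
  show "isCont (curve_deriv \<gamma>) t" "isCont (curve_deriv (curve_deriv \<gamma>)) t"
    using d1 d2 by (auto intro: differentiable_imp_continuous_within)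
qed

text \<open>In the plane a vector orthogonal to \<open>u\<close> is a multiple of \<open>u\<close> turned by a right angle, and the inner
product with the turned vector is the determinant. With \<open>u\<close> and \<open>v\<close> a first and a second derivative
this determinant is the numerator of the curvature.\<close>
lemma orthogonal_inner_eq_det:
  fixes u v w :: "real^2"
  assumes "u \<bullet> w = 0"
  shows "\<bar>v \<bullet> w\<bar> * norm u = norm w * \<bar>u$1 * v$2 - u$2 * v$1\<bar>"
proof -
  have uw: "u$1 * w$1 + u$2 * w$2 = 0"
    using assms by (simp add: inner_vec_def sum_2)
  have nu: "(norm x)\<^sup>2 = x$1^2 + x$2^2" for x :: "real^2"
    by (simp add: norm_vec_def L2_set_def sum_2)
  have "(v$1 * w$1 + v$2 * w$2)\<^sup>2 * (u$1^2 + u$2^2) = (w$1^2 + w$2^2) * (u$1 * v$2 - u$2 * v$1)\<^sup>2"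
    using uw by algebra
  then have "(\<bar>v \<bullet> w\<bar> * norm u)\<^sup>2 = (norm w * \<bar>u$1 * v$2 - u$2 * v$1\<bar>)\<^sup>2"
    by (simp add: power_mult_distrib nu inner_vec_def sum_2)
  then show ?thesis
    by (subst (asm) power2_eq_iff_nonneg) auto
qed

text \<open>A supporting functional \<open>w\<close> at \<open>\<gamma> t\<close> restricts to a function with a local maximum along the curve, so
\<open>w\<close> is normal to the curve there, and Taylor's formula leaves only the quadratic term. Its coefficient
\<open>\<gamma>'' r \<bullet> w\<close> is bounded away from \<open>0\<close> for \<open>r\<close> and \<open>t\<close> close to \<open>t0\<close>, because the determinant of \<open>\<gamma>' t\<close> and
\<open>\<gamma>'' r\<close> depends continuously on both points and is nonzero when both are \<open>t0\<close>.\<close>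
lemma chart_local_quadratic_support:
  fixes \<gamma> :: "real \<Rightarrow> real^2"
  assumes sm: "smooth_curve_on I \<gamma>" and oI: "open I" and t0: "t0 \<in> I"
    and cu: "curvature \<gamma> t0 \<noteq> 0"
  obtains d M where "d > 0" "M > 0" "ball t0 d \<subseteq> I"
    "\<And>t s w. t \<in> ball t0 d \<Longrightarrow> s \<in> ball t0 d \<Longrightarrow>
        (\<And>r. r \<in> ball t0 d \<Longrightarrow> \<gamma> r \<bullet> w \<le> \<gamma> t \<bullet> w) \<Longrightarrow>
        (norm (\<gamma> s - \<gamma> t))\<^sup>2 * norm w \<le> M * ((\<gamma> t - \<gamma> s) \<bullet> w)"
proof -
  define g1 where "g1 = curve_deriv \<gamma>"
  define g2 where "g2 = curve_deriv g1"
  note sc = smooth_curve_on_vector_derivative[OF sm, folded g1_def, folded g2_def]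
  define Dt where "Dt = (\<lambda>z. g1 (fst z) $ 1 * g2 (snd z) $ 2 - g1 (fst z) $ 2 * g2 (snd z) $ 1)"
  define c where "c = \<bar>Dt (t0,t0)\<bar> / 2"
  have cpos: "c > 0"
    using cu unfolding c_def Dt_def curvature_def g1_def[symmetric] g2_def[symmetric] by auto
  have ct1: "isCont (\<lambda>z. g1 (fst z)) (t0,t0)"
    by (rule isCont_o2[where f=fst]) (auto simp: sc(3)[OF t0])
  have ct2: "isCont (\<lambda>z. g2 (snd z)) (t0,t0)"
    by (rule isCont_o2[where f=snd]) (auto simp: sc(4)[OF t0])
  have cD: "isCont (\<lambda>z. \<bar>Dt z\<bar>) (t0,t0)"
    unfolding Dt_def by (intro continuous_intros ct1 ct2)
  define G where "G = norm (g1 t0) + 1"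
  have Gpos: "G > 0" unfolding G_def by (simp add: add_nonneg_pos)
  have "\<forall>\<^sub>F z in nhds (t0,t0). \<bar>Dt z\<bar> > c"
    using cpos c_def cD unfolding isCont_def
    by (intro order_tendstoD(1)[of "\<lambda>z. \<bar>Dt z\<bar>" "\<bar>Dt (t0,t0)\<bar>"])
       (auto simp: tendsto_nhds_iff)
  then obtain e1 where e1: "e1 > 0" "\<And>z. dist z (t0,t0) < e1 \<Longrightarrow> \<bar>Dt z\<bar> > c"
    unfolding eventually_nhds_metric by auto
  have "isCont (\<lambda>t. norm (g1 t)) t0"
    by (intro continuous_intros sc(3)[OF t0])
  then have "\<forall>\<^sub>F t in nhds t0. norm (g1 t) < G"
    unfolding isCont_def G_def
    by (intro order_tendstoD(2)[of "\<lambda>t. norm (g1 t)" "norm (g1 t0)"])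
       (auto simp: tendsto_nhds_iff)
  then obtain e2 where e2: "e2 > 0" "\<And>t. dist t t0 < e2 \<Longrightarrow> norm (g1 t) < G"
    unfolding eventually_nhds_metric by auto
  obtain e3 where e3: "e3 > 0" "ball t0 e3 \<subseteq> I"
    using oI t0 open_contains_ball by blast
  define d where "d = min (e1/2) (min e2 e3)"
  have d: "d > 0" "d \<le> e1/2" "d \<le> e2" "d \<le> e3" using e1(1) e2(1) e3(1) unfolding d_def by auto
  have dI: "ball t0 d \<subseteq> I" using e3 d by auto
  have D: "\<bar>g1 t $ 1 * g2 r $ 2 - g1 t $ 2 * g2 r $ 1\<bar> > c" if "t \<in> ball t0 d" "r \<in> ball t0 d" for t r
  proof -
    have "dist (t,r) (t0,t0) \<le> dist t t0 + dist r t0"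
      using sqrt_sum_squares_le_sum_abs[of "dist t t0" "dist r t0"] by (simp add: dist_prod_def)
    also have "\<dots> < e1" using that d by (auto simp: dist_commute)
    finally show ?thesis using e1(2)[of "(t,r)"] unfolding Dt_def by simp
  qed
  have Gb: "norm (g1 t) < G" if "t \<in> ball t0 d" for t
    using e2(2)[of t] that d by (auto simp: dist_commute)
  \<comment> \<open>\<open>c / G\<close> bounds the second derivative along the unit normal from below, and \<open>G\<^sup>2 (s - t)\<^sup>2\<close> bounds
    the squared chord from above.\<close>
  define M where "M = 2 * G ^ 3 / c"
  have Mpos: "M > 0" unfolding M_def using Gpos cpos by simp
  show thesis
  proof (rule that[OF d(1) Mpos dI])
    fix t s and w :: "real^2"
    assume t: "t \<in> ball t0 d" and s: "s \<in> ball t0 d"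
      and sup: "\<And>r. r \<in> ball t0 d \<Longrightarrow> \<gamma> r \<bullet> w \<le> \<gamma> t \<bullet> w"
    have seg: "r \<in> ball t0 d" if "r \<in> {min s t..max s t}" for r
      using s t that by (auto simp: dist_real_def min_def max_def split: if_splits)
    have df: "((\<lambda>r. \<gamma> r \<bullet> w) has_real_derivative g1 r \<bullet> w) (at r)" if "r \<in> ball t0 d" for r
      using bounded_linear.has_vector_derivative[OF bounded_linear_inner_left[of w] sc(1)[of r]] that dI
      by (auto simp: has_real_derivative_iff_has_vector_derivative)
    have df2: "((\<lambda>r. g1 r \<bullet> w) has_real_derivative g2 r \<bullet> w) (at r)" if "r \<in> ball t0 d" for r
      using bounded_linear.has_vector_derivative[OF bounded_linear_inner_left[of w] sc(2)[of r]] that dI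
      by (auto simp: has_real_derivative_iff_has_vector_derivative)
    obtain e where e: "e > 0" "ball t e \<subseteq> ball t0 d"
      using t open_ball open_contains_ball by blast
    have perp: "g1 t \<bullet> w = 0"
      using DERIV_local_max[OF df[OF t] e(1)] e(2) sup by (auto simp: dist_real_def subset_iff)
    show "(norm (\<gamma> s - \<gamma> t))\<^sup>2 * norm w \<le> M * ((\<gamma> t - \<gamma> s) \<bullet> w)"
    proof (cases "s = t")
      case False
      define F where "F = (\<lambda>m::nat. if m = 0 then (\<lambda>r. \<gamma> r \<bullet> w) else if m = 1 then (\<lambda>r. g1 r \<bullet> w) else (\<lambda>r. g2 r \<bullet> w))"
      have dfd: "\<forall>m r. m < 2 \<and> min s t \<le> r \<and> r \<le> max s t \<longrightarrow> DERIV (F m) r :> F (Suc m) r"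
      proof (intro allI impI)
        fix m :: nat and r assume a: "m < 2 \<and> min s t \<le> r \<and> r \<le> max s t"
        then have "m = 0 \<or> m = 1" by auto
        then show "DERIV (F m) r :> F (Suc m) r"
          using df[OF seg[of r]] df2[OF seg[of r]] a unfolding F_def
          by auto
      qed
      have "\<exists>r. (if s < t then s < r \<and> r < t else t < r \<and> r < s) \<and>
          F 0 s = (\<Sum>m<2. F m t / fact m * (s - t) ^ m) + F 2 r / fact 2 * (s - t)\<^sup>2"
        by (rule Taylor[OF _ refl dfd]) (use False in auto)
      then obtain r where r: "(if s < t then s < r \<and> r < t else t < r \<and> r < s)"
        and ry: "F 0 s = (\<Sum>m<2. F m t / fact m * (s - t) ^ m) + F 2 r / fact 2 * (s - t)\<^sup>2"
        by blast
      have rb: "r \<in> ball t0 d" using r by (intro seg) (auto split: if_splits)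
      have ex: "(\<gamma> t - \<gamma> s) \<bullet> w = - (g2 r \<bullet> w) / 2 * (s - t)\<^sup>2"
        using ry perp by (simp add: F_def numeral_2_eq_2 inner_diff_left)
      \<comment> \<open>Support fixes the sign of the quadratic coefficient, whatever the orientation of the curve.\<close>
      have pos: "(\<gamma> t - \<gamma> s) \<bullet> w \<ge> 0" using sup[OF s] by (simp add: inner_diff_left)
      then have ex': "(\<gamma> t - \<gamma> s) \<bullet> w = \<bar>g2 r \<bullet> w\<bar> / 2 * (s - t)\<^sup>2"
        using ex False by (auto simp: abs_if divide_simps mult_le_0_iff zero_le_mult_iff split: if_splits)
      have "norm w * c \<le> norm w * \<bar>g1 t $ 1 * g2 r $ 2 - g1 t $ 2 * g2 r $ 1\<bar>"
        using D[OF t rb] by (intro mult_left_mono) auto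
      also have "\<dots> = \<bar>g2 r \<bullet> w\<bar> * norm (g1 t)"
        using orthogonal_inner_eq_det[OF perp, of "g2 r"] by simp
      also have "\<dots> \<le> \<bar>g2 r \<bullet> w\<bar> * G" using Gb[OF t] by (intro mult_left_mono) auto
      finally have g2: "norm w * c \<le> \<bar>g2 r \<bullet> w\<bar> * G" .
      have "norm (\<gamma> s - \<gamma> t) \<le> G * norm (s - t)"
      proof (rule differentiable_bound[of "ball t0 d" \<gamma> "\<lambda>x h. h *\<^sub>R g1 x"])
        fix x assume x: "x \<in> ball t0 d"
        show "(\<gamma> has_derivative (\<lambda>h. h *\<^sub>R g1 x)) (at x within ball t0 d)"
          using sc(1)[OF subsetD[OF dI x]] unfolding has_vector_derivative_def
          by (rule has_derivative_at_withinI)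
        have "onorm (\<lambda>h. h *\<^sub>R g1 x) \<le> norm (g1 x)"
          by (rule onorm_le) (auto simp: mult.commute)
        then show "onorm (\<lambda>h. h *\<^sub>R g1 x) \<le> G" using Gb[OF x] by simp
      qed (use s t in auto)
      then have "(norm (\<gamma> s - \<gamma> t))\<^sup>2 \<le> (G * \<bar>s - t\<bar>)\<^sup>2" by (intro power_mono) auto
      then have "(norm (\<gamma> s - \<gamma> t))\<^sup>2 * norm w \<le> G\<^sup>2 * (s - t)\<^sup>2 * norm w"
        by (intro mult_right_mono) (auto simp: power_mult_distrib)
      also have "\<dots> \<le> G\<^sup>2 * (s - t)\<^sup>2 * (\<bar>g2 r \<bullet> w\<bar> * G / c)"
        using g2 cpos by (intro mult_left_mono) (auto simp: field_simps)
      also have "\<dots> = M * ((\<gamma> t - \<gamma> s) \<bullet> w)"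
        unfolding ex' M_def by (simp add: power2_eq_square power3_eq_cube)
      finally show ?thesis .
    qed simp
  qed
qed

text \<open>The local estimates become uniform by compactness: finitely many charts suffice, the largest of
their constants serves for all of them, and points closer than a Lebesgue number of this finite
cover lie in a common chart.\<close>
lemma frontier_uniform_quadratic_support:
  fixes S :: "(real^2) set"
  assumes S: "compact S" and emb: "smooth_embedded_curve S" and cur: "nonvanishing_curvature S"
  obtains e M where "e > 0" "M > 0"
    "\<And>p y w. p \<in> S \<Longrightarrow> y \<in> S \<Longrightarrow> norm (y - p) < e \<Longrightarrow> (\<And>x. x \<in> S \<Longrightarrow> x \<bullet> w \<le> p \<bullet> w) \<Longrightarrow>
        (norm (y - p))\<^sup>2 * norm w \<le> M * ((p - y) \<bullet> w)"
proof -
  define good where "good = (\<lambda>U M. open U \<and> M > 0 \<and> (\<forall>p\<in>S \<inter> U. \<forall>y\<in>S \<inter> U. \<forall>w.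
      (\<forall>x\<in>S. x \<bullet> w \<le> p \<bullet> w) \<longrightarrow> (norm (y - p))\<^sup>2 * norm w \<le> M * ((p - y) \<bullet> w)))"
  have loc: "\<exists>U M. q \<in> U \<and> good U M" if q: "q \<in> S" for q
  proof -
    obtain I \<gamma> where lp: "local_parametrization S I \<gamma>" and qI: "q \<in> \<gamma> ` I"
      using emb q unfolding smooth_embedded_curve_def by blast
    obtain t0 where t0: "t0 \<in> I" "q = \<gamma> t0" using qI by blast
    have oI: "open I" and sm: "smooth_curve_on I \<gamma>" and oin: "openin (top_of_set S) (\<gamma> ` I)"
      using lp unfolding local_parametrization_def by auto
    obtain \<delta> where hom: "homeomorphism I (\<gamma> ` I) \<gamma> \<delta>"
      using lp unfolding local_parametrization_def by auto
    have cu: "curvature \<gamma> t0 \<noteq> 0" using cur lp t0 unfolding nonvanishing_curvature_def by blast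
    obtain d M where d: "d > 0" "M > 0" "ball t0 d \<subseteq> I"
      and quad: "\<And>t s w. t \<in> ball t0 d \<Longrightarrow> s \<in> ball t0 d \<Longrightarrow>
        (\<And>r. r \<in> ball t0 d \<Longrightarrow> \<gamma> r \<bullet> w \<le> \<gamma> t \<bullet> w) \<Longrightarrow>
        (norm (\<gamma> s - \<gamma> t))\<^sup>2 * norm w \<le> M * ((\<gamma> t - \<gamma> s) \<bullet> w)"
      using chart_local_quadratic_support[OF sm oI t0(1) cu] by blast
    have "openin (top_of_set (\<gamma> ` I)) (\<gamma> ` ball t0 d)"
      by (rule homeomorphism_imp_open_map[OF hom]) (use d oI in \<open>auto simp: openin_open_eq\<close>)
    then have "openin (top_of_set S) (\<gamma> ` ball t0 d)"
      using oin openin_trans by blast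
    then obtain U where U: "open U" "\<gamma> ` ball t0 d = S \<inter> U"
      by (auto simp: openin_open)
    have "q \<in> U" using U t0 d by auto
    moreover have "good U M"
      unfolding good_def
    proof (intro conjI ballI allI impI)
      fix p y w assume p: "p \<in> S \<inter> U" and y: "y \<in> S \<inter> U" and w: "\<forall>x\<in>S. x \<bullet> w \<le> p \<bullet> w"
      obtain t where t: "t \<in> ball t0 d" "p = \<gamma> t" using p U by blast
      obtain s where s: "s \<in> ball t0 d" "y = \<gamma> s" using y U by blast
      have "\<gamma> r \<bullet> w \<le> \<gamma> t \<bullet> w" if "r \<in> ball t0 d" for r
        using w that U t by blast
      then show "(norm (y - p))\<^sup>2 * norm w \<le> M * ((p - y) \<bullet> w)"
        using quad[OF t(1) s(1), of w] t s by simp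
    qed (use U d in auto)
    ultimately show ?thesis by blast
  qed
  define \<G> where "\<G> = {U. \<exists>M. good U M}"
  have "\<forall>U\<in>\<G>. open U" unfolding \<G>_def good_def by auto
  moreover have cov: "S \<subseteq> \<Union>\<G>" using loc unfolding \<G>_def by blast
  ultimately obtain \<D> where D: "\<D> \<subseteq> \<G>" "finite \<D>" "S \<subseteq> \<Union>\<D>"
    using compactE[OF S] by metis
  have "\<forall>U\<in>\<D>. \<exists>M. good U M" using D(1) unfolding \<G>_def by blast
  then obtain Mf where Mf: "\<And>U. U \<in> \<D> \<Longrightarrow> good U (Mf U)" by metis
  define M where "M = Max (insert 1 (Mf ` \<D>))"
  have M1: "M \<ge> 1" unfolding M_def using D(2) by simp
  have MU: "Mf U \<le> M" if "U \<in> \<D>" for U unfolding M_def using D(2) that by simp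
  obtain e where e: "e > 0" "\<And>x. x \<in> S \<Longrightarrow> \<exists>G \<in> \<D>. ball x e \<subseteq> G"
    using Heine_Borel_lemma[OF S D(3)] D(1) unfolding \<G>_def good_def by blast
  show thesis
  proof (rule that[of e M])
    show "e > 0" "M > 0" using e M1 by auto
    fix p y w assume p: "p \<in> S" and y: "y \<in> S" and n: "norm (y - p) < e"
      and w: "\<And>x. x \<in> S \<Longrightarrow> x \<bullet> w \<le> p \<bullet> w"
    obtain U where U: "U \<in> \<D>" "ball p e \<subseteq> U" using e(2)[OF p] by blast
    have "p \<in> U" "y \<in> U" using U n e(1) by (auto simp: dist_norm norm_minus_commute subset_iff)
    then have "(norm (y - p))\<^sup>2 * norm w \<le> Mf U * ((p - y) \<bullet> w)"
      using Mf[OF U(1)] p y w unfolding good_def by blast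
    also have "\<dots> \<le> M * ((p - y) \<bullet> w)"
      using MU[OF U(1)] w[OF y] by (intro mult_right_mono) (auto simp: inner_diff_left)
    finally show "(norm (y - p))\<^sup>2 * norm w \<le> M * ((p - y) \<bullet> w)" .
  qed
qed

text \<open>The estimate for nearby boundary points extends to all of \<open>\<Omega>\<close> in two moves. An arbitrary point \<open>x\<close> is
pulled towards \<open>p\<close> along a segment, which multiplies its distance from \<open>p\<close> and its depth below the
supporting line by the same factor. The resulting nearby point \<open>z\<close> is pushed out along the normal to
a boundary point \<open>y\<close>; this lowers the depth by the distance moved, which pays for the change of
position.\<close>
lemma positive_curvature_quadratically_supported:
  fixes \<Omega> :: "(real^2) set"
  assumes op: "open \<Omega>" and ne: "\<Omega> \<noteq> {}" and bd: "bounded \<Omega>" and cv: "convex \<Omega>"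
    and emb: "smooth_embedded_curve (frontier \<Omega>)" and cur: "nonvanishing_curvature (frontier \<Omega>)"
  obtains M where "M > 0" "quadratically_supported M \<Omega>"
proof -
  have int: "interior \<Omega> = \<Omega>" using op by (simp add: interior_open)
  have "compact (frontier \<Omega>)" using bd by (rule compact_frontier_bounded)
  then obtain e M where e: "e > 0" "M > 0" and
    near: "\<And>p y w. p \<in> frontier \<Omega> \<Longrightarrow> y \<in> frontier \<Omega> \<Longrightarrow> norm (y - p) < e \<Longrightarrow>
        (\<And>x. x \<in> frontier \<Omega> \<Longrightarrow> x \<bullet> w \<le> p \<bullet> w) \<Longrightarrow>
        (norm (y - p))\<^sup>2 * norm w \<le> M * ((p - y) \<bullet> w)"
    using frontier_uniform_quadratic_support[OF _ emb cur] by blast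
  obtain D where D: "D > 0" "\<And>x y. x \<in> closure \<Omega> \<Longrightarrow> y \<in> closure \<Omega> \<Longrightarrow> norm (x - y) \<le> D"
  proof
    let ?D = "diameter (closure \<Omega>) + 1"
    show "norm (x - y) \<le> ?D" if "x \<in> closure \<Omega>" "y \<in> closure \<Omega>" for x y
      using diameter_bounded_bound[of "closure \<Omega>" x y] bounded_closure[OF bd] that by (auto simp: dist_norm)
    show "?D > 0" using diameter_ge_0[of "closure \<Omega>"] bounded_closure[OF bd] by simp
  qed
  \<comment> \<open>One contraction factor for all points: it brings every point of \<open>\<Omega>\<close> within \<open>e / 4\<close> of \<open>p\<close>.\<close>
  define \<tau> where "\<tau> = min 1 (e / (4 * D))"
  have l: "0 < \<tau>" "\<tau> \<le> 1" "\<tau> * D \<le> e / 4"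
  proof -
    show "0 < \<tau>" "\<tau> \<le> 1" using e D unfolding \<tau>_def by auto
    have "\<tau> * D \<le> e / (4 * D) * D" using D unfolding \<tau>_def by (intro mult_right_mono) auto
    then show "\<tau> * D \<le> e / 4" using D by simp
  qed
  define M' where "M' = (2 * M + e) / \<tau>"
  have "quadratically_supported M' \<Omega>"
    unfolding quadratically_supported_def
  proof (intro ballI allI impI)
    fix p w x assume p: "p \<in> closure \<Omega>" and w: "\<forall>x\<in>\<Omega>. x \<bullet> w \<le> p \<bullet> w" and x: "x \<in> \<Omega>"
    show "(norm (x - p))\<^sup>2 * norm w \<le> M' * ((p - x) \<bullet> w)"
    proof (cases "w = 0")
      case False
      have wc: "y \<bullet> w \<le> p \<bullet> w" if "y \<in> closure \<Omega>" for y
      proof -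
        have "closure \<Omega> \<subseteq> {y. y \<bullet> w \<le> p \<bullet> w}"
          by (rule closure_minimal) (use w in \<open>auto intro!: closed_Collect_le continuous_intros\<close>)
        then show ?thesis using that by blast
      qed
      have pf: "p \<in> frontier \<Omega>"
      proof (rule ccontr)
        assume "p \<notin> frontier \<Omega>"
        then have "p \<in> \<Omega>" using p int by (auto simp: frontier_def)
        then obtain r where r: "r > 0" "ball p r \<subseteq> \<Omega>" using op open_contains_ball by blast
        have "p + (r / (2 * norm w)) *\<^sub>R w \<in> ball p r" using False r by (simp add: dist_norm)
        then have "(p + (r / (2 * norm w)) *\<^sub>R w) \<bullet> w \<le> p \<bullet> w" using r w by blast
        then have "r / (2 * norm w) * (w \<bullet> w) \<le> 0" by (simp add: inner_add_left)
        moreover have "r / (2 * norm w) * (w \<bullet> w) > 0" using r False by simp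
        ultimately show False by simp
      qed
      define u where "u = w /\<^sub>R norm w"
      have u1: "norm u = 1" using False by (simp add: u_def)
      have uw: "a \<bullet> u = a \<bullet> w / norm w" for a by (simp add: u_def field_simps)
      have uc: "y \<bullet> u \<le> p \<bullet> u" if "y \<in> closure \<Omega>" for y
        using wc[OF that] by (simp add: uw divide_right_mono)
      define z where "z = p - \<tau> *\<^sub>R (p - x)"
      have z: "z \<in> interior \<Omega>" unfolding z_def
        by (rule mem_interior_closure_convex_shrink) (use cv p x int l in auto)
      have zp: "z - p = \<tau> *\<^sub>R (x - p)" by (simp add: z_def algebra_simps)
      have "norm (x - p) \<le> D" using D(2)[of x p] x p closure_subset by blast
      then have "\<tau> * norm (x - p) \<le> \<tau> * D" using l by (intro mult_left_mono) auto
      then have "\<tau> * norm (x - p) \<le> e / 4" using l(3) by (rule order_trans)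
      then have nz: "norm (z - p) \<le> e / 4" using l(1) by (simp add: zp)
      obtain t where t: "0 < t" "z + t *\<^sub>R u \<in> frontier \<Omega>"
        using ray_to_frontier[OF bd z, of u] u1 by (metis norm_zero zero_neq_one)
      define y where "y = z + t *\<^sub>R u"
      have yf: "y \<in> frontier \<Omega>" using t y_def by simp
      have pyu: "(p - y) \<bullet> u = (p - z) \<bullet> u - t"
        using u1 by (simp add: y_def inner_diff_left inner_add_left dot_square_norm)
      have py0: "(p - y) \<bullet> u \<ge> 0" using uc[of y] yf by (auto simp: inner_diff_left frontier_def)
      have "(p - z) \<bullet> u \<le> norm (p - z) * norm u" by (rule norm_cauchy_schwarz)
      then have te: "t \<le> e / 4" using pyu py0 nz u1 by (simp add: norm_minus_commute)
      have yz: "norm (y - z) = t" using u1 t by (simp add: y_def)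
      have yp: "norm (y - p) < e" using norm_triangle_ineq[of "y - z" "z - p"] nz te yz e by simp
      have "(norm (y - p))\<^sup>2 * norm u \<le> M * ((p - y) \<bullet> u)"
        by (rule near[OF pf yf yp]) (use uc in \<open>auto simp: frontier_def\<close>)
      then have n1: "(norm (y - p))\<^sup>2 \<le> M * ((p - z) \<bullet> u - t)" using u1 pyu by simp
      have "norm (z - p) \<le> norm (y - p) + t"
        using norm_triangle_ineq[of "z - y" "y - p"] yz by (simp add: norm_minus_commute)
      then have "(norm (z - p))\<^sup>2 \<le> (norm (y - p) + t)\<^sup>2" by (intro power_mono) auto
      also have "\<dots> \<le> 2 * (norm (y - p))\<^sup>2 + 2 * t\<^sup>2"
        using zero_le_power2[of "norm (y - p) - t"] by (simp add: power2_eq_square algebra_simps)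
      also have "\<dots> \<le> 2 * (M * ((p - z) \<bullet> u - t)) + e * t"
      proof (rule add_mono)
        show "2 * t\<^sup>2 \<le> e * t" using te t e by (simp add: power2_eq_square)
      qed (use n1 in simp)
      also have "\<dots> \<le> 2 * (M * ((p - z) \<bullet> u)) + e * ((p - z) \<bullet> u)"
        using e t pyu py0 by (intro add_mono mult_left_mono) auto
      finally have "(norm (z - p))\<^sup>2 \<le> (2 * M + e) * ((p - z) \<bullet> u)" by (simp add: algebra_simps)
      moreover have "(norm (z - p))\<^sup>2 = \<tau>\<^sup>2 * (norm (x - p))\<^sup>2" using l by (simp add: zp power_mult_distrib)
      moreover have "(p - z) \<bullet> u = \<tau> * ((p - x) \<bullet> u)" by (simp add: z_def)
      ultimately have "\<tau> * (\<tau> * (norm (x - p))\<^sup>2) \<le> \<tau> * ((2 * M + e) * ((p - x) \<bullet> u))"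
        by (simp add: power2_eq_square mult_ac)
      then have "\<tau> * (norm (x - p))\<^sup>2 \<le> (2 * M + e) * ((p - x) \<bullet> u)" using l by simp
      then have "(norm (x - p))\<^sup>2 \<le> M' * ((p - x) \<bullet> u)" using l by (simp add: M'_def field_simps)
      then show ?thesis using False by (simp add: uw field_simps)
    qed simp
  qed
  moreover have "M' > 0" unfolding M'_def using e l by simp
  ultimately show thesis using that by blast
qed

section \<open>Fourier decay from the lengths of parallel chords\<close>

text \<open>A shift by half a period \<open>\<eta>\<close> in either direction changes the sign of the oscillating factor, so four
times the integral equals the integral of the second difference \<open>2 L s - L (s - \<eta>) - L (s + \<eta>)\<close> against
it. By concavity the second difference is nonnegative away from the two ends of the support, and
its total integral vanishes. Its \<open>L\<^sup>1\<close> norm is therefore controlled by its negative part, which lives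
on two intervals of length \<open>2 * \<eta>\<close> where only values of \<open>L\<close> at depth at most \<open>2 * \<eta>\<close> enter.\<close>
lemma oscillatory_integral_second_difference_bound:
  fixes L :: "real \<Rightarrow> real" and \<alpha> \<eta> M a b :: real
  assumes L: "integrable lborel L" and L0: "\<And>s. L s \<ge> 0"
    and out: "\<And>s. s \<le> a \<or> b \<le> s \<Longrightarrow> L s = 0"
    and mid: "\<And>s. a < s - \<eta> \<Longrightarrow> s + \<eta> < b \<Longrightarrow> L (s - \<eta>) + L (s + \<eta>) \<le> 2 * L s"
    and top: "\<And>s. a < s \<Longrightarrow> s < b \<Longrightarrow> L s \<le> 2 * sqrt (M * (b - s))"
    and bot: "\<And>s. a < s \<Longrightarrow> s < b \<Longrightarrow> L s \<le> 2 * sqrt (M * (s - a))"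
    and M: "M \<ge> 0" and eta: "\<eta> > 0" and osc: "cis (\<alpha> * \<eta>) = -1"
  shows "norm (\<integral>s. L s *\<^sub>R cis (\<alpha> * s) \<partial>lborel) \<le> 4 * \<eta> * sqrt (2 * M * \<eta>)"
proof -
  define I where "I = (\<integral>s. L s *\<^sub>R cis (\<alpha> * s) \<partial>lborel)"
  define \<Delta> where "\<Delta> = (\<lambda>s. 2 * L s - L (s - \<eta>) - L (s + \<eta>))"
  define q where "q = 2 * sqrt (2 * M * \<eta>)"
  \<comment> \<open>A bound for the negative part of the second difference.\<close>
  define E where "E = (\<lambda>s. q * (indicator {a - \<eta>..a + \<eta>} s + indicator {b - \<eta>..b + \<eta>} s))"
  have q0: "q \<ge> 0" unfolding q_def using M eta by simp
  have shift: "integrable lborel (\<lambda>s. L (s + c))" for c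
    using lborel_integrable_real_affine[OF L, of 1 c] by (simp add: add.commute)
  note shift' = shift[of "-\<eta>", simplified]
  have shiftI: "(\<integral>s. f (s + c) \<partial>lborel) = (\<integral>s. f s \<partial>lborel)" for f :: "real \<Rightarrow> 'c::{banach,second_countable_topology}" and c
    using lborel_integral_real_affine[of 1 f c] by (simp add: add.commute)
  have Lc: "integrable lborel (\<lambda>s. L s *\<^sub>R cis (\<alpha> * (s + c)))" for c
  proof (rule Bochner_Integration.integrable_bound[OF L])
    have [measurable]: "L \<in> borel_measurable borel" using L by auto
    have [measurable]: "(\<lambda>s. cis (\<alpha> * (s + c))) \<in> borel_measurable borel"
      by (intro borel_measurable_continuous_onI continuous_intros)
    show "(\<lambda>s. L s *\<^sub>R cis (\<alpha> * (s + c))) \<in> borel_measurable lborel"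
      by simp
  qed simp
  have Lsc: "integrable lborel (\<lambda>s. L (s + c) *\<^sub>R cis (\<alpha> * s))" for c
    using lborel_integrable_real_affine[OF Lc[of "-c"], of 1 c] by (simp add: add.commute)
  have IL: "(\<integral>s. L (s + c) *\<^sub>R cis (\<alpha> * s) \<partial>lborel) = cis (- (\<alpha> * c)) * I" for c
  proof -
    have "(\<integral>s. L (s + c) *\<^sub>R cis (\<alpha> * s) \<partial>lborel) = (\<integral>s. L s *\<^sub>R cis (\<alpha> * (s - c)) \<partial>lborel)"
      using shiftI[of "\<lambda>s. L s *\<^sub>R cis (\<alpha> * (s - c))" c] by simp
    also have "\<dots> = (\<integral>s. cis (- (\<alpha> * c)) * (L s *\<^sub>R cis (\<alpha> * s)) \<partial>lborel)"
      by (intro Bochner_Integration.integral_cong) (auto simp: cis_mult algebra_simps)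
    finally show ?thesis unfolding I_def by (subst (asm) integral_mult_right_zero)
  qed
  have cm: "cis (- (\<alpha> * \<eta>)) = -1"
    using osc by (metis cis_cnj complex_cnj_minus complex_cnj_one)
  have "(\<integral>s. \<Delta> s *\<^sub>R cis (\<alpha> * s) \<partial>lborel) =
      (\<integral>s. 2 *\<^sub>R (L (s + 0) *\<^sub>R cis (\<alpha> * s)) - L (s + - \<eta>) *\<^sub>R cis (\<alpha> * s) - L (s + \<eta>) *\<^sub>R cis (\<alpha> * s) \<partial>lborel)"
    unfolding \<Delta>_def by (intro Bochner_Integration.integral_cong) (auto simp: algebra_simps)
  also have "\<dots> = 2 *\<^sub>R I - cis (\<alpha> * \<eta>) * I - cis (- (\<alpha> * \<eta>)) * I"
    using Lsc[of 0] Lsc[of "-\<eta>"] Lsc[of \<eta>] IL[of 0] IL[of "-\<eta>"] IL[of \<eta>] by (simp del: scaleR_scaleR)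
  also have "\<dots> = 4 * I" using osc cm by (simp add: scaleR_conv_of_real)
  finally have four: "(\<integral>s. \<Delta> s *\<^sub>R cis (\<alpha> * s) \<partial>lborel) = 4 * I" .
  have \<Delta>i: "integrable lborel \<Delta>"
    unfolding \<Delta>_def using L shift[of \<eta>] shift' by simp
  have \<Delta>0: "(\<integral>s. \<Delta> s \<partial>lborel) = 0"
    unfolding \<Delta>_def using L shift[of \<eta>] shift' shiftI[of L \<eta>] shiftI[of L "-\<eta>"] by simp
  have near: "L (s + \<eta>) \<le> q * indicator {a - \<eta>..a + \<eta>} s" if "s \<le> a + \<eta>" for s
  proof (cases "a < s + \<eta> \<and> s + \<eta> < b")
    case True
    have "L (s + \<eta>) \<le> 2 * sqrt (M * (s + \<eta> - a))" using bot True by blast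
    also have "\<dots> \<le> q" unfolding q_def using that M
      by (auto intro!: mult_left_mono real_sqrt_le_mono simp: mult.assoc mult.left_commute[of 2])
    finally show ?thesis using True that by (auto simp: indicator_def)
  next
    case False
    then show ?thesis using out[of "s + \<eta>"] q0 by auto
  qed
  have near2: "L (s - \<eta>) \<le> q * indicator {b - \<eta>..b + \<eta>} s" if "b - \<eta> \<le> s" for s
  proof (cases "a < s - \<eta> \<and> s - \<eta> < b")
    case True
    have "L (s - \<eta>) \<le> 2 * sqrt (M * (b - (s - \<eta>)))" using top True by blast
    also have "\<dots> \<le> q" unfolding q_def using that M
      by (auto intro!: mult_left_mono real_sqrt_le_mono simp: mult.assoc mult.left_commute[of 2])
    finally show ?thesis using True that by (auto simp: indicator_def)
  next
    case False
    then show ?thesis using out[of "s - \<eta>"] q0 by auto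
  qed
  have E0: "E s \<ge> 0" for s unfolding E_def using q0 by simp
  have low: "- E s \<le> \<Delta> s" for s
  proof -
    consider "a < s - \<eta> \<and> s + \<eta> < b" | "s \<le> a + \<eta>" | "b - \<eta> \<le> s" by linarith
    then show ?thesis
    proof cases
      case 1 then show ?thesis using mid[of s] E0[of s] unfolding \<Delta>_def by auto
    next
      case 2
      then have "L (s - \<eta>) = 0" using out[of "s - \<eta>"] by auto
      then show ?thesis using near[OF 2] L0[of s] q0 unfolding \<Delta>_def E_def
        by (auto simp: indicator_def)
    next
      case 3
      then have "L (s + \<eta>) = 0" using out[of "s + \<eta>"] by auto
      then show ?thesis using near2[OF 3] L0[of s] q0 unfolding \<Delta>_def E_def
        by (auto simp: indicator_def)
    qed
  qed
  have Ei: "integrable lborel E" unfolding E_def 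
    by (intro integrable_mult_right Bochner_Integration.integrable_add integrable_real_indicator)
      (auto simp: emeasure_lborel_Icc_eq)
  have EI: "(\<integral>s. E s \<partial>lborel) = q * (4 * \<eta>)" unfolding E_def using eta by simp
  have "4 * norm I = norm (\<integral>s. \<Delta> s *\<^sub>R cis (\<alpha> * s) \<partial>lborel)" unfolding four by (simp add: norm_mult)
  also have "\<dots> \<le> (\<integral>s. norm (\<Delta> s *\<^sub>R cis (\<alpha> * s)) \<partial>lborel)" by (rule integral_norm_bound)
  also have "\<dots> = (\<integral>s. \<bar>\<Delta> s\<bar> \<partial>lborel)" by simp
  also have "\<dots> \<le> (\<integral>s. \<Delta> s + 2 * E s \<partial>lborel)"
  proof (rule integral_mono)
    show "\<bar>\<Delta> s\<bar> \<le> \<Delta> s + 2 * E s" for s using low[of s] E0[of s] by (auto simp: abs_if)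
  qed (use \<Delta>i Ei in auto)
  also have "\<dots> = 8 * q * \<eta>" using \<Delta>i Ei \<Delta>0 EI by simp
  finally show ?thesis unfolding I_def q_def by (simp add: mult_ac)
qed

text \<open>This is the Brunn-Minkowski inequality in dimension one: by convexity the middle slice contains the
average of the two outer slices, and the length of a sum of two intervals is the sum of the
lengths.\<close>
lemma slice_length_midpoint_concave:
  fixes B :: "(real \<times> real) set"
  assumes cv: "convex B" and op: "open B" and bd: "bounded B"
    and ne: "\<exists>y. (s1, y) \<in> B" "\<exists>y. (s2, y) \<in> B"
  shows "measure lborel {y. (s1, y) \<in> B} + measure lborel {y. (s2, y) \<in> B}
      \<le> 2 * measure lborel {y. ((s1 + s2) / 2, y) \<in> B}"
proof -
  define S where "S = (\<lambda>s. {y. (s, y) \<in> B})"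
  define h where "h = (s1 + s2) / 2"
  obtain K where K: "\<And>z. z \<in> B \<Longrightarrow> norm z \<le> K" using bd bounded_iff by blast
  have K2: "\<bar>y\<bar> \<le> K" if "y \<in> S s" for s y
    using K[of "(s, y)"] that norm_snd_le[of y s] unfolding S_def by auto
  have oS: "open (S s)" for s
    unfolding S_def using op by (intro open_vimage[of B "\<lambda>y. (s, y)", unfolded vimage_def] continuous_intros)
  have fin: "emeasure lborel (S s) < \<infinity>" for s
  proof (rule emeasure_bounded_finite)
    show "bounded (S s)" using K2 by (auto simp: bounded_iff)
  qed
  have bel: "bdd_below (S s)" "bdd_above (S s)" for s
    using K2[of _ s] by (auto intro!: bdd_belowI[of _ "-K"] bdd_aboveI[of _ K]) (smt (verit))+
  have len: "measure lborel (S s) \<le> Sup (S s) - Inf (S s)" if "S s \<noteq> {}" for s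
  proof -
    have sub: "S s \<subseteq> {Inf (S s)..Sup (S s)}" using bel(1)[of s] bel(2)[of s] by (auto intro!: cInf_lower cSup_upper)
    have "Inf (S s) \<le> Sup (S s)" using sub that by force
    then show ?thesis using measure_mono_fmeasurable[OF sub, of lborel] oS[of s] by (simp add: fmeasurable_def)
  qed
  have ne': "S s1 \<noteq> {}" "S s2 \<noteq> {}" using ne unfolding S_def by auto
  have mid: "(u + v) / 2 \<in> S h" if "u \<in> S s1" "v \<in> S s2" for u v
  proof -
    have "(1/2) *\<^sub>R (s1, u) + (1/2) *\<^sub>R (s2, v) \<in> B"
      using that by (intro convexD[OF cv]) (auto simp: S_def)
    then show ?thesis by (simp add: S_def h_def add_divide_distrib)
  qed
  have cvS: "y \<in> S h" if "u \<in> S h" "v \<in> S h" "u \<le> y" "y \<le> v" for u v y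
  proof -
    have "convex (S h)"
    proof (rule convexI)
      fix x y u v :: real assume "x \<in> S h" "y \<in> S h" "0 \<le> u" "0 \<le> v" and uv: "u + v = 1"
      then have "u *\<^sub>R (h, x) + v *\<^sub>R (h, y) \<in> B" by (intro convexD[OF cv]) (auto simp: S_def)
      moreover have "u * h + v * h = h" using uv by (metis distrib_right mult_1)
      ultimately show "u *\<^sub>R x + v *\<^sub>R y \<in> S h" by (simp add: S_def)
    qed
    then have "is_interval (S h)" by (simp add: is_interval_convex_1)
    then show ?thesis using that unfolding is_interval_1 by blast
  qed
  let ?l = "(Inf (S s1) + Inf (S s2)) / 2" and ?r = "(Sup (S s1) + Sup (S s2)) / 2"
  have sub: "{?l<..<?r} \<subseteq> S h"
  proof
    fix y assume y: "y \<in> {?l<..<?r}"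
    define e where "e = y - ?l"
    have e: "e > 0" using y by (simp add: e_def)
    obtain u1 where u1: "u1 \<in> S s1" "u1 < Inf (S s1) + e" using cInf_lessD[OF ne'(1), of "Inf (S s1) + e"] e by auto
    obtain u2 where u2: "u2 \<in> S s2" "u2 < Inf (S s2) + e" using cInf_lessD[OF ne'(2), of "Inf (S s2) + e"] e by auto
    define f where "f = ?r - y"
    have f: "f > 0" using y by (simp add: f_def)
    obtain v1 where v1: "v1 \<in> S s1" "Sup (S s1) - f < v1" using less_cSupD[OF ne'(1), of "Sup (S s1) - f"] f by auto
    obtain v2 where v2: "v2 \<in> S s2" "Sup (S s2) - f < v2" using less_cSupD[OF ne'(2), of "Sup (S s2) - f"] f by auto
    have "(u1 + u2) / 2 \<le> y" using u1 u2 unfolding e_def by (simp add: field_simps)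
    moreover have "y \<le> (v1 + v2) / 2" using v1 v2 unfolding f_def by (simp add: field_simps)
    ultimately show "y \<in> S h" using cvS mid[OF u1(1) u2(1)] mid[OF v1(1) v2(1)] by blast
  qed
  have lr: "?l \<le> ?r"
  proof -
    obtain y1 y2 where "y1 \<in> S s1" "y2 \<in> S s2" using ne' by blast
    then have "Inf (S s1) \<le> y1" "y1 \<le> Sup (S s1)" "Inf (S s2) \<le> y2" "y2 \<le> Sup (S s2)"
      using bel[of s1] bel[of s2] by (auto intro!: cInf_lower cSup_upper)
    then show ?thesis by simp
  qed
  have "?r - ?l \<le> measure lborel (S h)"
    using measure_mono_fmeasurable[OF sub, of lborel] lr fin[of h] oS[of h] by (auto simp: fmeasurable_def)
  then have "measure lborel (S s1) + measure lborel (S s2) \<le> 2 * measure lborel (S h)"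
    using len[OF ne'(1)] len[OF ne'(2)] by (simp add: field_simps)
  then show ?thesis unfolding S_def h_def .
qed

text \<open>The shear \<open>(x, y) \<mapsto> (x + m y, y)\<close> preserves area and turns the phase into a function of the first
coordinate alone. Integrating out the second coordinate leaves the lengths of the chords of \<open>A\<close> on the
lines \<open>x + m y = s\<close>, measured by their projection to the second axis. Such a chord at distance
\<open>t\<close> in \<open>s\<close> from the end of the range of \<open>s\<close> lies within \<open>sqrt (M * t)\<close> of the supporting point, because
the normal \<open>(1, m)\<close> has norm at least \<open>1\<close>.\<close>
lemma fourier_decay_along_first_coordinate:
  fixes A :: "(real \<times> real) set" and \<alpha> m M \<eta> :: real
  assumes op: "open A" and bd: "bounded A" and cv: "convex A" and ne: "A \<noteq> {}"
    and qs: "quadratically_supported M A" and M: "M \<ge> 0"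
    and eta: "\<eta> > 0" and osc: "cis (\<alpha> * \<eta>) = -1"
  shows "norm (\<integral>z. indicator A z *\<^sub>R cis (\<alpha> * (fst z + m * snd z)) \<partial>lborel) \<le> 4 * \<eta> * sqrt (2 * M * \<eta>)"
proof -
  define w where "w = (1 :: real, m)"
  have w1: "norm w \<ge> 1" using norm_fst_le[of "1::real" m] by (simp add: w_def)
  have zw: "z \<bullet> w = fst z + m * snd z" for z by (cases z) (simp add: w_def)
  define B where "B = {z. (fst z - m * snd z, snd z) \<in> A}"
  have Bi: "B = (\<lambda>z. (fst z + m * snd z, snd z)) ` A"
    unfolding B_def by (force simp: image_iff)
  have lin: "linear (\<lambda>z. (fst z + m * snd z, snd z))"
    by (rule linearI) (auto simp: algebra_simps)
  have opB: "open B" unfolding B_def using op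
    by (intro open_vimage[of A, unfolded vimage_def] continuous_intros)
  have bdB: "bounded B" unfolding Bi using bd lin by (simp add: bounded_linear_image linear_conv_bounded_linear)
  have cvB: "convex B" unfolding Bi using cv lin by (rule convex_linear_image[rotated])
  obtain K where K: "\<And>z. z \<in> B \<Longrightarrow> norm z \<le> K" using bdB bounded_iff by blast
  have K1: "\<bar>fst z\<bar> \<le> K" if "z \<in> B" for z
    using K[OF that] norm_fst_le[of "fst z" "snd z"] by auto
  define L where "L = (\<lambda>s. measure lborel {y. (s, y) \<in> B})"
  define a where "a = Inf (fst ` B)"
  define b where "b = Sup (fst ` B)"
  have neB: "B \<noteq> {}" using ne Bi by simp
  have bd1: "bdd_below (fst ` B)" "bdd_above (fst ` B)"
    using K1 by (auto intro!: bdd_belowI[of _ "-K"] bdd_aboveI[of _ K]) (smt (verit) fst_conv)+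
  have ab: "a \<le> fst z" "fst z \<le> b" if "z \<in> B" for z
    unfolding a_def b_def using bd1 that by (auto intro: cInf_lower cSup_upper)
  have strict: "a < fst z" "fst z < b" if z: "z \<in> B" for z
  proof -
    obtain r where r: "r > 0" "ball z r \<subseteq> B" using opB z open_contains_ball by blast
    have "z + (r/2, 0) \<in> B" "z - (r/2, 0) \<in> B" using r by (auto intro!: subsetD[OF r(2)] simp: dist_norm norm_Pair)
    from ab(2)[OF this(1)] ab(1)[OF this(2)] r(1) show "a < fst z" "fst z < b" by auto
  qed
  have slice_ne: "\<exists>y. (s, y) \<in> B" if s: "a < s" "s < b" for s
  proof -
    obtain z1 where z1: "z1 \<in> B" "fst z1 < s"
      using cInf_lessD[of "fst ` B" s] s neB unfolding a_def by auto
    obtain z2 where z2: "z2 \<in> B" "s < fst z2"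
      using less_cSupD[of "fst ` B" s] s neB unfolding b_def by auto
    have "connected (fst ` B)"
      by (intro connected_continuous_image continuous_intros convex_connected cvB)
    then have "s \<in> fst ` B" using z1 z2 connectedD_interval[of "fst ` B" "fst z1" "fst z2" s] by auto
    then show ?thesis by force
  qed
  have out: "L s = 0" if "s \<le> a \<or> b \<le> s" for s
  proof -
    have "{y. (s, y) \<in> B} = {}" using strict[of "(s, _)"] that by fastforce
    then show ?thesis by (simp add: L_def)
  qed
  have mid: "L (s - \<eta>) + L (s + \<eta>) \<le> 2 * L s" if "a < s - \<eta>" "s + \<eta> < b" for s
    using slice_length_midpoint_concave[OF cvB opB bdB slice_ne[of "s - \<eta>"] slice_ne[of "s + \<eta>"]] that eta
    unfolding L_def by simp
  have attain: "\<exists>p\<in>closure A. \<forall>x\<in>A. x \<bullet> v \<le> p \<bullet> v" for v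
  proof -
    have "compact (closure A)" using bd by simp
    moreover have "closure A \<noteq> {}" using ne by simp
    moreover have "continuous_on (closure A) (\<lambda>x. x \<bullet> v)" by (intro continuous_intros)
    ultimately obtain p where "p \<in> closure A" "\<forall>x\<in>closure A. x \<bullet> v \<le> p \<bullet> v"
      using continuous_attains_sup by blast
    then show ?thesis using closure_subset by blast
  qed
  have slice_short: "L s \<le> 2 * sqrt (M * t)"
    if p: "p \<in> closure A" and v: "norm v \<ge> 1" and sup: "\<forall>x\<in>A. x \<bullet> v \<le> p \<bullet> v"
      and t: "\<And>y. (s, y) \<in> B \<Longrightarrow> (p - (s - m * y, y)) \<bullet> v \<le> t" and t0: "t \<ge> 0" for s t p v
  proof -
    have "{y. (s, y) \<in> B} \<subseteq> {snd p - sqrt (M * t)..snd p + sqrt (M * t)}"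
    proof
      fix y assume "y \<in> {y. (s, y) \<in> B}"
      then have yB: "(s, y) \<in> B" by simp
      then have zA: "(s - m * y, y) \<in> A" by (simp add: B_def)
      let ?z = "(s - m * y, y)"
      have "(norm (?z - p))\<^sup>2 * 1 \<le> (norm (?z - p))\<^sup>2 * norm v" using v by (intro mult_left_mono) auto
      also have "\<dots> \<le> M * ((p - ?z) \<bullet> v)"
        using qs p sup zA unfolding quadratically_supported_def by blast
      also have "\<dots> \<le> M * t" using t[OF yB] M by (intro mult_left_mono) auto
      finally have "norm (?z - p) \<le> sqrt (M * t)" by (simp add: real_le_rsqrt)
      moreover have "\<bar>y - snd p\<bar> \<le> norm (?z - p)" using norm_snd_le[of "snd (?z - p)" "fst (?z - p)"] by (cases p) simp
      ultimately show "y \<in> {snd p - sqrt (M * t)..snd p + sqrt (M * t)}" by auto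
    qed
    moreover have "open {y. (s, y) \<in> B}"
      using opB by (intro open_vimage[of B "\<lambda>y. (s, y)", unfolded vimage_def] continuous_intros)
    ultimately have "L s \<le> measure lborel {snd p - sqrt (M * t)..snd p + sqrt (M * t)}"
      unfolding L_def by (intro measure_mono_fmeasurable) (auto simp: fmeasurable_def emeasure_lborel_Icc_eq)
    then show ?thesis using t0 M by simp
  qed
  have BA: "(fst x + m * snd x, snd x) \<in> B" if "x \<in> A" for x using that by (simp add: B_def)
  have top: "L s \<le> 2 * sqrt (M * (b - s))" if s: "a < s" "s < b" for s
  proof -
    obtain p where p: "p \<in> closure A" "\<forall>x\<in>A. x \<bullet> w \<le> p \<bullet> w" using attain by blast
    have "p \<bullet> w \<le> b"
    proof -
      have "closure A \<subseteq> {x. x \<bullet> w \<le> b}"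
        using ab(2)[OF BA] by (intro closure_minimal) (auto simp: zw intro!: closed_Collect_le continuous_intros)
      then show ?thesis using p by blast
    qed
    then show ?thesis using s
      by (intro slice_short[OF p(1) w1 p(2)]) (auto simp: zw algebra_simps)
  qed
  have bot: "L s \<le> 2 * sqrt (M * (s - a))" if s: "a < s" "s < b" for s
  proof -
    obtain p where p: "p \<in> closure A" "\<forall>x\<in>A. x \<bullet> (-w) \<le> p \<bullet> (-w)" using attain by blast
    have "p \<bullet> w \<ge> a"
    proof -
      have "closure A \<subseteq> {x. a \<le> x \<bullet> w}"
        using ab(1)[OF BA] by (intro closure_minimal) (auto simp: zw intro!: closed_Collect_le continuous_intros)
      then show ?thesis using p by blast
    qed
    then show ?thesis using s w1
      by (intro slice_short[OF p(1) _ p(2)]) (auto simp: zw algebra_simps)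
  qed
  have finB: "emeasure lborel B < \<infinity>" and finA: "emeasure lborel A < \<infinity>"
    using emeasure_bounded_finite[OF bdB] emeasure_bounded_finite[OF bd] by auto
  have [measurable]: "A \<in> sets borel" "B \<in> sets borel" using op opB by auto
  have [measurable]: "(\<lambda>z::real \<times> real. cis (\<alpha> * (fst z + m * snd z))) \<in> borel_measurable borel"
    "(\<lambda>z::real \<times> real. cis (\<alpha> * fst z)) \<in> borel_measurable borel"
    by (intro borel_measurable_continuous_onI continuous_intros)+
  define F where "F = (\<lambda>z. indicator A z *\<^sub>R cis (\<alpha> * (fst z + m * snd z)))"
  define G where "G = (\<lambda>z. indicator B z *\<^sub>R cis (\<alpha> * fst z))"
  have Fi: "integrable lborel F" unfolding F_def
    by (rule integrableI_bounded_set_indicator[where B=1]) (use finA in auto)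
  have Gi: "integrable lborel G" unfolding G_def
    by (rule integrableI_bounded_set_indicator[where B=1]) (use finB in auto)
  have Fi': "integrable (lborel \<Otimes>\<^sub>M lborel) (\<lambda>(x,y). F (x,y))"
    and Gi': "integrable (lborel \<Otimes>\<^sub>M lborel) (\<lambda>(x,y). G (x,y))"
    using Fi Gi by (simp_all add: lborel_prod)
  have GL: "(\<integral>y. G (s, y) \<partial>lborel) = L s *\<^sub>R cis (\<alpha> * s)" for s
  proof -
    have [measurable]: "{y. (s, y) \<in> B} \<in> sets borel"
      using opB by (intro borel_open open_vimage[of B "\<lambda>y. (s, y)", unfolded vimage_def] continuous_intros)
    have f: "emeasure lborel {y. (s, y) \<in> B} < \<infinity>"
    proof (rule emeasure_bounded_finite)
      have "{y. (s, y) \<in> B} \<subseteq> snd ` B" by force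
      then show "bounded {y. (s, y) \<in> B}" by (rule bounded_subset[OF bounded_snd[OF bdB]])
    qed
    have "(\<integral>y. G (s, y) \<partial>lborel) = (\<integral>y. indicator {y. (s, y) \<in> B} y *\<^sub>R cis (\<alpha> * s) \<partial>lborel)"
      unfolding G_def by (intro Bochner_Integration.integral_cong) (auto simp: indicator_def)
    then show ?thesis using f by (simp add: L_def)
  qed
  have "integrable lborel (\<lambda>s. norm (\<integral>y. G (s, y) \<partial>lborel))"
    using lborel_pair.integrable_fst[OF Gi'] by (rule integrable_norm)
  then have Li: "integrable lborel L" unfolding GL by (simp add: L_def)
  have "(\<integral>z. F z \<partial>lborel) = (\<integral>y. \<integral>x. F (x, y) \<partial>lborel \<partial>lborel)"
    using lborel_pair.integral_snd[OF Fi'] by (simp add: lborel_prod)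
  also have "\<dots> = (\<integral>y. \<integral>s. G (s, y) \<partial>lborel \<partial>lborel)"
  proof (rule Bochner_Integration.integral_cong[OF refl])
    fix y
    have "F (x - m * y, y) = G (x, y)" for x by (auto simp: F_def G_def B_def indicator_def)
    then show "(\<integral>x. F (x, y) \<partial>lborel) = (\<integral>s. G (s, y) \<partial>lborel)"
      using lborel_integral_real_affine[of 1 "\<lambda>x. F (x, y)" "- (m * y)"] by simp
  qed
  also have "\<dots> = (\<integral>s. \<integral>y. G (s, y) \<partial>lborel \<partial>lborel)"
    using lborel_pair.integral_snd[OF Gi'] lborel_pair.integral_fst[OF Gi'] by simp
  also have "\<dots> = (\<integral>s. L s *\<^sub>R cis (\<alpha> * s) \<partial>lborel)" unfolding GL ..
  finally have "(\<integral>z. F z \<partial>lborel) = (\<integral>s. L s *\<^sub>R cis (\<alpha> * s) \<partial>lborel)" .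
  moreover have "norm (\<integral>s. L s *\<^sub>R cis (\<alpha> * s) \<partial>lborel) \<le> 4 * \<eta> * sqrt (2 * M * \<eta>)"
    by (rule oscillatory_integral_second_difference_bound[where L=L and a=a and b=b and M=M])
       (use Li out mid top bot M eta osc in \<open>auto simp: L_def\<close>)
  ultimately show ?thesis unfolding F_def by simp
qed

section \<open>Characters of the torus and lattice point counts\<close>

definition lattice_point :: "int \<times> int \<Rightarrow> real \<times> real" where
  "lattice_point k = (of_int (fst k), of_int (snd k))"

definition lattice_char :: "int \<times> int \<Rightarrow> real \<times> real \<Rightarrow> complex" where
  "lattice_char n x = cis (2 * pi * (of_int (fst n) * fst x + of_int (snd n) * snd x))"

text \<open>The half-open cell, whose lattice translates tile the plane without overlap.\<close>
definition unit_cell :: "(real \<times> real) set" where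
  "unit_cell = {0..<1} \<times> {0..<1}"

definition cell_measure :: "(real \<times> real) measure" where
  "cell_measure = restrict_space lborel unit_cell"

definition lattice_count :: "(real \<times> real) set \<Rightarrow> real \<times> real \<Rightarrow> real" where
  "lattice_count A x = real (card {k. lattice_point k + x \<in> A})"

lemma lattice_point_simps:
  "lattice_point (j + k) = lattice_point j + lattice_point k"
  "lattice_point (j - k) = lattice_point j - lattice_point k"
  by (auto simp: lattice_point_def)

lemma lattice_char_add: "lattice_char (n + m) x = lattice_char n x * lattice_char m x"
  by (simp add: lattice_char_def cis_mult algebra_simps)

lemma lattice_char_add_arg: "lattice_char n (x + y) = lattice_char n x * lattice_char n y"
  by (simp add: lattice_char_def cis_mult algebra_simps)

lemma lattice_char_lattice_point [simp]: "lattice_char n (lattice_point k) = 1"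
proof -
  have "lattice_char n (lattice_point k) = cis (2 * pi * of_int (fst n * fst k + snd n * snd k))"
    by (simp add: lattice_char_def lattice_point_def)
  also have "\<dots> = 1" by (rule cis_multiple_2pi) simp
  finally show ?thesis .
qed

lemma lattice_char_zero [simp]: "lattice_char 0 x = 1"
  by (simp add: lattice_char_def)

lemma norm_lattice_char [simp]: "norm (lattice_char n x) = 1"
  by (simp add: lattice_char_def)

lemma cnj_lattice_char: "cnj (lattice_char n x) = lattice_char (- n) x"
  by (simp add: lattice_char_def cis_cnj algebra_simps)

lemma lattice_char_minus_arg: "lattice_char n (- x) = lattice_char (- n) x"
  by (simp add: lattice_char_def algebra_simps)

lemma lattice_char_measurable [measurable]: "lattice_char n \<in> borel_measurable borel"
  unfolding lattice_char_def by (intro borel_measurable_continuous_onI continuous_intros)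

lemma unit_cell_measurable [measurable]: "unit_cell \<in> sets borel"
  unfolding unit_cell_def by (intro borel_Times) auto

lemma unit_cell_subset: "unit_cell \<subseteq> {0..1} \<times> {0..1}"
  by (auto simp: unit_cell_def)

lemma emeasure_unit_cell: "emeasure lborel unit_cell = 1"
proof -
  have "emeasure lborel ({0..<1} \<times> {0..<1} :: (real \<times> real) set) = emeasure lborel {0..<1::real} * emeasure lborel {0..<1::real}"
    unfolding lborel_prod[symmetric] by (rule lborel.emeasure_pair_measure_Times) auto
  then show ?thesis by (simp add: unit_cell_def)
qed

lemma space_cell_measure [simp]: "space cell_measure = unit_cell"
  by (simp add: cell_measure_def space_restrict_space)

lemma measurable_cell_measure [measurable (raw)]:
  "f \<in> borel_measurable borel \<Longrightarrow> f \<in> borel_measurable cell_measure"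
  unfolding cell_measure_def by (rule measurable_restrict_space1) simp

lemma emeasure_cell_measure: "emeasure cell_measure unit_cell = 1"
  by (simp add: cell_measure_def emeasure_restrict_space emeasure_unit_cell)

interpretation cell: finite_measure cell_measure
  by (rule finite_measureI) (simp add: emeasure_cell_measure)

lemma measure_cell_measure [simp]: "measure cell_measure unit_cell = 1"
  using emeasure_cell_measure by (simp add: measure_def)

lemma integral_cell_measure:
  fixes f :: "real \<times> real \<Rightarrow> 'b::{banach, second_countable_topology}"
  shows "(\<integral>x. f x \<partial>cell_measure) = (\<integral>x. indicator unit_cell x *\<^sub>R f x \<partial>lborel)"
  unfolding cell_measure_def by (subst integral_restrict_space) auto

lemma integrable_cell_bounded:
  fixes f :: "real \<times> real \<Rightarrow> 'b::{banach, second_countable_topology}"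
  assumes "f \<in> borel_measurable cell_measure" and "\<And>x. x \<in> unit_cell \<Longrightarrow> norm (f x) \<le> B"
  shows "integrable cell_measure f"
  using assms by (intro cell.integrable_const_bound[where B=B] AE_I2) auto

lemma integral_cis_period:
  fixes n :: int
  shows "(\<integral>t. indicator {0..<1} t *\<^sub>R cis (2 * pi * of_int n * t) \<partial>lborel) = (if n = 0 then 1 else 0)"
proof -
  define f where "f = (\<lambda>t. cis (2 * pi * of_int n * t))"
  have [measurable]: "f \<in> borel_measurable borel"
    unfolding f_def by (intro borel_measurable_continuous_onI continuous_intros)
  have "(\<integral>t. indicator {0..<1} t *\<^sub>R f t \<partial>lborel) = (\<integral>t. indicator {0..1} t *\<^sub>R f t \<partial>lborel)"
    by (rule integral_cong_AE) (use AE_lborel_singleton[of "1::real"] in \<open>auto simp: indicator_def\<close>)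
  also have "\<dots> = (if n = 0 then 1 else 0)"
  proof (cases "n = 0")
    case True then show ?thesis by (simp add: f_def)
  next
    case False
    define c where "c = 2 * pi * of_int n"
    have c: "c \<noteq> 0" using False by (simp add: c_def)
    have fc: "f t = cis (c * t)" for t by (simp add: f_def c_def)
    have d: "((\<lambda>t. cis (c * t) / (\<i> * of_real c)) has_vector_derivative f t) (at t within {0..1})" for t
    proof -
      have "((\<lambda>z. exp (\<i> * of_real c * z) / (\<i> * of_real c)) has_field_derivative exp (\<i> * of_real c * of_real t)) (at (of_real t))"
        using c by (auto intro!: derivative_eq_intros)
      from has_vector_derivative_real_field[OF this, of "{0..1}"] show ?thesis
        by (simp add: cis_conv_exp fc mult.assoc)
    qed
    have "(\<integral>t. indicator {0..1} t *\<^sub>R f t \<partial>lborel) = cis (c * 1) / (\<i> * of_real c) - cis (c * 0) / (\<i> * of_real c)"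
      by (rule integral_FTC_atLeastAtMost) (use d in \<open>auto simp: f_def intro!: continuous_intros\<close>)
    also have "cis (c * 1) = 1" unfolding c_def mult_1_right by (rule cis_multiple_2pi) simp
    finally show ?thesis using False by simp
  qed
  finally show ?thesis unfolding f_def .
qed

lemma integral_lattice_char:
  "(\<integral>x. lattice_char n x \<partial>cell_measure) = (if n = 0 then 1 else 0)"
proof -
  define f where "f = (\<lambda>(m::int) t. indicator {0..<1::real} t *\<^sub>R cis (2 * pi * of_int m * t))"
  define F where "F = (\<lambda>x. indicator unit_cell x *\<^sub>R lattice_char n x)"
  have F: "F (s, t) = f (fst n) s * f (snd n) t" for s t
  proof -
    have "lattice_char n (s, t) = cis (2 * pi * of_int (fst n) * s) * cis (2 * pi * of_int (snd n) * t)"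
      by (simp add: lattice_char_def cis_mult distrib_left mult.assoc)
    then show ?thesis by (auto simp: F_def f_def unit_cell_def indicator_def)
  qed
  have "integrable lborel F" unfolding F_def
    by (rule integrableI_bounded_set_indicator[where B=1]) (auto simp: emeasure_unit_cell)
  then have "integrable (lborel \<Otimes>\<^sub>M lborel) (\<lambda>(x,y). F (x,y))" by (simp add: lborel_prod)
  from lborel_pair.integral_fst[OF this]
  have "(\<integral>x. F x \<partial>lborel) = (\<integral>s. \<integral>t. F (s, t) \<partial>lborel \<partial>lborel)" by (simp add: lborel_prod)
  also have "\<dots> = (\<integral>s. f (fst n) s \<partial>lborel) * (\<integral>t. f (snd n) t \<partial>lborel)"
    unfolding F by simp
  also have "\<dots> = (if n = 0 then 1 else 0)"
    unfolding f_def integral_cis_period by (auto simp: prod_eq_iff)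
  finally show ?thesis unfolding integral_cell_measure F_def .
qed

lemma parseval_trigonometric_polynomial:
  assumes "finite Q"
  shows "(\<integral>x. (norm (\<Sum>n\<in>Q. a n * lattice_char n x))\<^sup>2 \<partial>cell_measure) = (\<Sum>n\<in>Q. (norm (a n))\<^sup>2)"
proof -
  have "complex_of_real (\<integral>x. (norm (\<Sum>n\<in>Q. a n * lattice_char n x))\<^sup>2 \<partial>cell_measure) =
      (\<integral>x. complex_of_real ((norm (\<Sum>n\<in>Q. a n * lattice_char n x))\<^sup>2) \<partial>cell_measure)"
    by (rule integral_complex_of_real[symmetric])
  also have "\<dots> = (\<integral>x. (\<Sum>n\<in>Q. \<Sum>m\<in>Q. a n * cnj (a m) * lattice_char (n - m) x) \<partial>cell_measure)"
  proof (intro Bochner_Integration.integral_cong refl)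
    fix x
    have "complex_of_real ((norm (\<Sum>n\<in>Q. a n * lattice_char n x))\<^sup>2) =
        (\<Sum>n\<in>Q. a n * lattice_char n x) * cnj (\<Sum>n\<in>Q. a n * lattice_char n x)"
      by (simp only: complex_norm_square)
    also have "\<dots> = (\<Sum>n\<in>Q. \<Sum>m\<in>Q. (a n * lattice_char n x) * (cnj (a m) * cnj (lattice_char m x)))"
      by (simp add: sum_product cnj_sum)
    also have "\<dots> = (\<Sum>n\<in>Q. \<Sum>m\<in>Q. a n * cnj (a m) * lattice_char (n - m) x)"
      using lattice_char_add[of _ "- _" x]
      by (intro sum.cong refl) (simp add: cnj_lattice_char mult_ac)
    finally show "complex_of_real ((norm (\<Sum>n\<in>Q. a n * lattice_char n x))\<^sup>2) = \<dots>" .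
  qed
  also have "\<dots> = (\<Sum>n\<in>Q. \<Sum>m\<in>Q. a n * cnj (a m) * (\<integral>x. lattice_char (n - m) x \<partial>cell_measure))"
    by (subst Bochner_Integration.integral_sum | intro Bochner_Integration.integrable_sum integrable_mult_right
        integrable_cell_bounded[where B=1] | simp)+
  also have "\<dots> = (\<Sum>n\<in>Q. \<Sum>m\<in>Q. if m = n then a n * cnj (a n) else 0)"
    unfolding integral_lattice_char by (intro sum.cong refl) auto
  also have "\<dots> = (\<Sum>n\<in>Q. a n * cnj (a n))" using assms by (simp add: sum.delta)
  also have "\<dots> = complex_of_real (\<Sum>n\<in>Q. (norm (a n))\<^sup>2)"
    by (simp add: complex_norm_square[symmetric])
  finally show ?thesis by (simp only: of_real_eq_iff)
qed

text \<open>The fourth power of the \<open>L\<^sup>4\<close> norm is the squared \<open>L\<^sup>2\<close> norm of the square, whose coefficients are the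
convolution of \<open>a\<close> with itself.\<close>
lemma trigonometric_polynomial_L4:
  assumes Q: "finite Q"
  shows "(\<integral>x. (norm (\<Sum>n\<in>Q. a n * lattice_char n x)) ^ 4 \<partial>cell_measure) =
     (\<Sum>m\<in>(\<lambda>(n, n'). n + n') ` (Q \<times> Q). (norm (\<Sum>(n, n')\<in>{z \<in> Q \<times> Q. fst z + snd z = m}. a n * a n'))\<^sup>2)"
proof -
  define b where "b = (\<lambda>m. \<Sum>(n, n')\<in>{z \<in> Q \<times> Q. fst z + snd z = m}. a n * a n')"
  define Q2 where "Q2 = (\<lambda>(n, n'). n + n') ` (Q \<times> Q)"
  have fin: "finite Q2" using Q by (simp add: Q2_def)
  have sq: "(norm (\<Sum>n\<in>Q. a n * lattice_char n x)) ^ 4 = (norm (\<Sum>m\<in>Q2. b m * lattice_char m x))\<^sup>2" for x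
  proof -
    have "(\<Sum>n\<in>Q. a n * lattice_char n x) * (\<Sum>n\<in>Q. a n * lattice_char n x)
        = (\<Sum>z\<in>Q \<times> Q. a (fst z) * a (snd z) * lattice_char (fst z + snd z) x)"
      by (simp add: sum_product sum.cartesian_product lattice_char_add case_prod_beta mult_ac)
    also have "\<dots> = (\<Sum>m\<in>Q2. \<Sum>z\<in>{z \<in> Q \<times> Q. fst z + snd z = m}. a (fst z) * a (snd z) * lattice_char (fst z + snd z) x)"
      using Q fin by (intro sum.group[symmetric]) (auto simp: Q2_def case_prod_beta)
    also have "\<dots> = (\<Sum>m\<in>Q2. b m * lattice_char m x)"
      unfolding b_def by (intro sum.cong refl) (auto simp: sum_distrib_right case_prod_beta intro!: sum.cong)
    finally have "(\<Sum>n\<in>Q. a n * lattice_char n x)\<^sup>2 = (\<Sum>m\<in>Q2. b m * lattice_char m x)"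
      by (simp add: power2_eq_square)
    from arg_cong[OF this, of "\<lambda>z. (norm z)\<^sup>2"] show ?thesis
      by (simp add: norm_power power_mult[symmetric])
  qed
  show ?thesis unfolding sq parseval_trigonometric_polynomial[OF fin] unfolding b_def Q2_def ..
qed

lemma finite_lattice_points:
  assumes "bounded A"
  shows "finite {k. lattice_point k + x \<in> A}"
proof -
  obtain K where K: "A \<subseteq> cball 0 K" using assms bounded_any_center[of A 0] by (auto simp: subset_iff)
  define m where "m = \<lceil>K + norm x\<rceil>"
  have "{k. lattice_point k + x \<in> A} \<subseteq> {-m..m} \<times> {-m..m}"
  proof
    fix k assume "k \<in> {k. lattice_point k + x \<in> A}"
    then have "norm (lattice_point k + x) \<le> K" using K by auto
    then have n: "norm (lattice_point k) \<le> K + norm x"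
      using norm_triangle_ineq4[of "lattice_point k + x" x] by simp
    have "\<bar>real_of_int (fst k)\<bar> \<le> norm (lattice_point k)" "\<bar>real_of_int (snd k)\<bar> \<le> norm (lattice_point k)"
      using norm_fst_le[of "real_of_int (fst k)" "real_of_int (snd k)"] norm_snd_le[of "real_of_int (snd k)" "real_of_int (fst k)"]
      by (auto simp: lattice_point_def)
    then have "\<bar>real_of_int (fst k)\<bar> \<le> m" "\<bar>real_of_int (snd k)\<bar> \<le> m" using n unfolding m_def by linarith+
    then show "k \<in> {-m..m} \<times> {-m..m}" by (cases k) (auto simp: abs_le_iff)
  qed
  then show ?thesis by (rule finite_subset) simp
qed

text \<open>The lattice point \<open>k\<close> counted at \<open>x\<close> corresponds to the lattice point \<open>k - j\<close> counted at \<open>x'\<close>; the vector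
\<open>j\<close> accounts for points \<open>x\<close> and \<open>x'\<close> that are close only modulo the lattice.\<close>
lemma lattice_count_translate:
  assumes "bounded A'" and "\<And>z. z \<in> A \<Longrightarrow> z + (x' - x - lattice_point j) \<in> A'"
  shows "lattice_count A x \<le> lattice_count A' x'"
proof -
  have "card {k. lattice_point k + x \<in> A} \<le> card {k. lattice_point k + x' \<in> A'}"
  proof (rule card_inj_on_le[where f="\<lambda>k. k - j"])
    show "(\<lambda>k. k - j) ` {k. lattice_point k + x \<in> A} \<subseteq> {k. lattice_point k + x' \<in> A'}"
    proof (rule image_subsetI)
      fix k assume "k \<in> {k. lattice_point k + x \<in> A}"
      then have "lattice_point k + x + (x' - x - lattice_point j) \<in> A'" using assms(2) by blast
      then show "k - j \<in> {k. lattice_point k + x' \<in> A'}"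
        by (simp add: lattice_point_simps algebra_simps)
    qed
  qed (use finite_lattice_points[OF assms(1)] in \<open>auto simp: inj_on_def\<close>)
  then show ?thesis by (simp add: lattice_count_def)
qed

lemma lattice_count_eq_sum:
  assumes A: "A \<subseteq> cball 0 K" and x: "x \<in> {0..1} \<times> {0..1}"
  shows "lattice_count A x = (\<Sum>k\<in>{- \<lceil>K\<rceil> - 1..\<lceil>K\<rceil>} \<times> {- \<lceil>K\<rceil> - 1..\<lceil>K\<rceil>}. indicator A (lattice_point k + x))"
proof -
  let ?F = "{- \<lceil>K\<rceil> - 1..\<lceil>K\<rceil>} \<times> {- \<lceil>K\<rceil> - 1..\<lceil>K\<rceil>}"
  have "{k. lattice_point k + x \<in> A} \<subseteq> ?F"
  proof
    fix k assume "k \<in> {k. lattice_point k + x \<in> A}"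
    then have n: "norm (lattice_point k + x) \<le> K" using A by auto
    have "\<bar>real_of_int (fst k) + fst x\<bar> \<le> norm (lattice_point k + x)" "\<bar>real_of_int (snd k) + snd x\<bar> \<le> norm (lattice_point k + x)"
      using norm_fst_le[of "real_of_int (fst k) + fst x" "real_of_int (snd k) + snd x"]
        norm_snd_le[of "real_of_int (snd k) + snd x" "real_of_int (fst k) + fst x"]
      by (auto simp: lattice_point_def plus_prod_def)
    moreover have "0 \<le> fst x" "fst x \<le> 1" "0 \<le> snd x" "snd x \<le> 1" using x by auto
    ultimately have "- \<lceil>K\<rceil> - 1 \<le> fst k" "fst k \<le> \<lceil>K\<rceil>" "- \<lceil>K\<rceil> - 1 \<le> snd k" "snd k \<le> \<lceil>K\<rceil>"
      using n by linarith+
    then show "k \<in> ?F" by (cases k) auto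
  qed
  then have "{k. lattice_point k + x \<in> A} = {k \<in> ?F. lattice_point k + x \<in> A}" by blast
  then have "lattice_count A x = (\<Sum>k\<in>{k \<in> ?F. lattice_point k + x \<in> A}. 1)"
    by (simp add: lattice_count_def)
  also have "\<dots> = (\<Sum>k\<in>?F. if lattice_point k + x \<in> A then 1 else 0)"
    by (rule sum.inter_filter) simp
  finally show ?thesis by (simp only: indicator_def of_bool_def)
qed

lemma lattice_count_measurable:
  assumes "bounded A" and [measurable]: "A \<in> sets borel"
  shows "lattice_count A \<in> borel_measurable cell_measure"
proof -
  obtain K where K: "A \<subseteq> cball 0 K" using assms bounded_any_center[of A 0] by (auto simp: subset_iff)
  have [measurable]: "(\<lambda>x. \<Sum>k\<in>{- \<lceil>K\<rceil> - 1..\<lceil>K\<rceil>} \<times> {- \<lceil>K\<rceil> - 1..\<lceil>K\<rceil>}. indicat_real A (lattice_point k + x)) \<in> borel_measurable borel"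
    by measurable
  show ?thesis
    by (subst measurable_cong[OF lattice_count_eq_sum[OF K]]) (auto simp: unit_cell_def)
qed

lemma lattice_count_bound:
  assumes A: "A \<subseteq> cball 0 K" and x: "x \<in> {0..1} \<times> {0..1}" and K: "K \<ge> 0"
  shows "lattice_count A x \<le> (2 * K + 4)\<^sup>2"
proof -
  have "lattice_count A x \<le> (\<Sum>k\<in>{- \<lceil>K\<rceil> - 1..\<lceil>K\<rceil>} \<times> {- \<lceil>K\<rceil> - 1..\<lceil>K\<rceil>}. 1)"
    unfolding lattice_count_eq_sum[OF A x] by (intro sum_mono) (simp add: indicator_def)
  also have "\<dots> = (2 * real_of_int \<lceil>K\<rceil> + 2)\<^sup>2" using K by (simp add: power2_eq_square card_cartesian_product add.commute)
  also have "\<dots> \<le> (2 * K + 4)\<^sup>2" using K by (intro power_mono) linarith+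
  finally show ?thesis .
qed

text \<open>Characters are invariant under lattice translations, so the sum over the lattice of integrals over
the cell unfolds to one integral over the plane.\<close>
lemma lattice_count_fourier_coefficient:
  assumes bd: "bounded A" and A[measurable]: "A \<in> sets borel"
  shows "(\<integral>x. lattice_count A x *\<^sub>R lattice_char n x \<partial>cell_measure) = (\<integral>z. indicator A z *\<^sub>R lattice_char n z \<partial>lborel)"
proof -
  obtain K where K: "A \<subseteq> cball 0 K" using bd bounded_any_center[of A 0] by (auto simp: subset_iff)
  let ?F = "{- \<lceil>K\<rceil> - 1..\<lceil>K\<rceil>} \<times> {- \<lceil>K\<rceil> - 1..\<lceil>K\<rceil>}"
  have finA: "emeasure lborel A < \<infinity>" using bd by (rule emeasure_bounded_finite)
  define G where "G = (\<lambda>k z. (indicator unit_cell (z - lattice_point k) * indicator A z :: real) *\<^sub>R lattice_char n z)"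
  have Gi: "integrable lborel (G k)" for k
  proof -
    have "integrable lborel (\<lambda>z. indicator A z *\<^sub>R (indicat_real unit_cell (z - lattice_point k) *\<^sub>R lattice_char n z))"
      by (rule integrableI_bounded_set_indicator[where B=1]) (use finA in \<open>auto simp: indicator_def\<close>)
    then show ?thesis by (simp add: G_def mult.commute)
  qed
  have shift: "integrable lborel (\<lambda>x. G k (lattice_point k + x))"
    "(\<integral>x. G k (lattice_point k + x) \<partial>lborel) = (\<integral>x. G k x \<partial>lborel)" for k
  proof -
    have m: "G k \<in> borel_measurable borel" unfolding G_def by measurable
    show "(\<integral>x. G k (lattice_point k + x) \<partial>lborel) = (\<integral>x. G k x \<partial>lborel)"
      using integral_distr[of "(+) (lattice_point k)" lborel borel "G k"] m by (simp add: lborel_distr_plus)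
    show "integrable lborel (\<lambda>x. G k (lattice_point k + x))"
      using integrable_distr_eq[of "(+) (lattice_point k)" lborel borel "G k"] m Gi[of k] by (simp add: lborel_distr_plus)
  qed
  have one: "(\<Sum>k\<in>?F. indicat_real unit_cell (z - lattice_point k)) = 1" if z: "z \<in> A" for z
  proof -
    define k0 where "k0 = (\<lfloor>fst z\<rfloor>, \<lfloor>snd z\<rfloor>)"
    have "\<bar>fst z\<bar> \<le> K" "\<bar>snd z\<bar> \<le> K"
      using subsetD[OF K z] norm_fst_le[of "fst z" "snd z"] norm_snd_le[of "snd z" "fst z"] by auto
    then have k0: "k0 \<in> ?F" unfolding k0_def by (auto; linarith)
    have "indicat_real unit_cell (z - lattice_point k) = (if k = k0 then 1 else 0)" for k
    proof -
      have "z - lattice_point k \<in> unit_cell \<longleftrightarrow> k = k0"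
        unfolding unit_cell_def k0_def lattice_point_def
        by (cases z; cases k) (auto simp: floor_unique le_floor_iff floor_less_iff; linarith)
      then show ?thesis by (simp add: indicator_def)
    qed
    then show ?thesis using k0 by (simp only: sum.delta) (simp add: sum.delta)
  qed
  have "(\<integral>x. lattice_count A x *\<^sub>R lattice_char n x \<partial>cell_measure) =
      (\<integral>x. (\<Sum>k\<in>?F. G k (lattice_point k + x)) \<partial>lborel)"
    unfolding integral_cell_measure
  proof (intro Bochner_Integration.integral_cong refl)
    fix x
    show "indicat_real unit_cell x *\<^sub>R lattice_count A x *\<^sub>R lattice_char n x = (\<Sum>k\<in>?F. G k (lattice_point k + x))"
    proof (cases "x \<in> unit_cell")
      case True
      then show ?thesis
        using lattice_count_eq_sum[OF K, of x]
        by (simp add: unit_cell_subset[THEN subsetD] G_def lattice_char_add_arg scaleR_sum_left)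
    qed (simp add: G_def)
  qed
  also have "\<dots> = (\<Sum>k\<in>?F. \<integral>x. G k x \<partial>lborel)"
    by (subst Bochner_Integration.integral_sum) (use shift in auto)
  also have "\<dots> = (\<integral>x. (\<Sum>k\<in>?F. G k x) \<partial>lborel)"
    by (subst Bochner_Integration.integral_sum) (use Gi in auto)
  also have "\<dots> = (\<integral>z. indicator A z *\<^sub>R lattice_char n z \<partial>lborel)"
  proof (intro Bochner_Integration.integral_cong refl)
    fix z
    have "(\<Sum>k\<in>?F. G k z) = ((\<Sum>k\<in>?F. indicat_real unit_cell (z - lattice_point k)) * indicator A z) *\<^sub>R lattice_char n z"
      unfolding G_def scaleR_sum_left[symmetric] sum_distrib_right[symmetric] ..
    also have "\<dots> = indicator A z *\<^sub>R lattice_char n z"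
      using one[of z] by (cases "z \<in> A") auto
    finally show "(\<Sum>k\<in>?F. G k z) = indicator A z *\<^sub>R lattice_char n z" .
  qed
  finally show ?thesis .
qed

section \<open>Fourier coefficients of lattice point counts\<close>

text \<open>The maximum norm, for which the lattice points on a sphere are easily counted.\<close>
definition lattice_norm :: "int \<times> int \<Rightarrow> nat" where
  "lattice_norm n = nat (max \<bar>fst n\<bar> \<bar>snd n\<bar>)"

text \<open>This is \<open>j powr (-3/2)\<close> for positive \<open>j\<close>, and \<open>0\<close> for \<open>j = 0\<close>.\<close>
definition decay :: "nat \<Rightarrow> real" where
  "decay j = 1 / (real j * sqrt (real j))"

lemma decay_nonneg: "decay j \<ge> 0"
  by (simp add: decay_def)

lemma lattice_norm_eq_0_iff: "lattice_norm n = 0 \<longleftrightarrow> n = 0"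
  by (cases n) (auto simp: lattice_norm_def zero_prod_def)

lemma lattice_norm_triangle: "lattice_norm (m + n) \<le> lattice_norm m + lattice_norm n"
  unfolding lattice_norm_def by (cases m; cases n) (auto simp: nat_le_iff max_def abs_if; linarith)

lemma lattice_norm_minus: "lattice_norm (- n) = lattice_norm n"
  by (simp add: lattice_norm_def)

lemma cis_half_period:
  fixes k :: int
  assumes "k \<noteq> 0"
  shows "cis (2 * pi * of_int k * (1 / (2 * of_int \<bar>k\<bar>))) = -1"
proof -
  have "2 * pi * of_int k * (1 / (2 * of_int \<bar>k\<bar>)) = pi \<or> 2 * pi * of_int k * (1 / (2 * of_int \<bar>k\<bar>)) = - pi"
    using assms by (cases "k > 0") (auto simp: field_simps)
  then show ?thesis by (auto simp: complex_eq_iff)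
qed

text \<open>Slicing along the coordinate in which \<open>n\<close> is larger makes half a period equal to
\<open>1 / (2 * lattice_norm n)\<close>. Exchanging the two coordinates reduces the second case to the first.\<close>
lemma convex_fourier_decay:
  fixes A :: "(real \<times> real) set"
  assumes op: "open A" and bd: "bounded A" and cv: "convex A" and ne: "A \<noteq> {}"
    and qs: "quadratically_supported M A" and M: "M \<ge> 0" and n: "n \<noteq> 0"
  shows "norm (\<integral>z. indicator A z *\<^sub>R lattice_char n z \<partial>lborel) \<le> 2 * sqrt M * decay (lattice_norm n)"
proof -
  have main: "norm (\<integral>z. indicator B z *\<^sub>R lattice_char k z \<partial>lborel) \<le> 2 * sqrt M * decay (nat \<bar>fst k\<bar>)"
    if opB: "open B" and bdB: "bounded B" and cvB: "convex B" and neB: "B \<noteq> {}"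
      and qsB: "quadratically_supported M B" and k: "fst k \<noteq> 0" for B k
  proof -
    define t where "t = real_of_int \<bar>fst k\<bar>"
    have t: "t > 0" using k by (simp add: t_def)
    have "lattice_char k z = cis (2 * pi * of_int (fst k) * (fst z + (of_int (snd k) / of_int (fst k)) * snd z))" for z
    proof -
      have "of_int (fst k) * (fst z + (of_int (snd k) / of_int (fst k)) * snd z) = of_int (fst k) * fst z + of_int (snd k) * snd z"
        using k by (simp add: distrib_left)
      then show ?thesis by (simp add: lattice_char_def mult.assoc)
    qed
    then have "norm (\<integral>z. indicator B z *\<^sub>R lattice_char k z \<partial>lborel) \<le> 4 * (1 / (2 * t)) * sqrt (2 * M * (1 / (2 * t)))"
      using fourier_decay_along_first_coordinate[OF opB bdB cvB neB qsB M, of "1 / (2 * t)" "2 * pi * of_int (fst k)" "of_int (snd k) / of_int (fst k)"]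
        cis_half_period[OF k] t by (simp add: t_def)
    also have "\<dots> = 2 * sqrt M * (1 / (t * sqrt t))" using t by (simp add: real_sqrt_divide field_simps)
    also have "\<dots> = 2 * sqrt M * decay (nat \<bar>fst k\<bar>)" by (simp add: decay_def t_def)
    finally show ?thesis .
  qed
  show ?thesis
  proof (cases "\<bar>snd n\<bar> \<le> \<bar>fst n\<bar>")
    case True
    then have "fst n \<noteq> 0" using n by (auto simp: prod_eq_iff)
    then show ?thesis using main[OF op bd cv ne qs] True by (simp add: lattice_norm_def max_def)
  next
    case False
    have lin: "linear (prod.swap :: real \<times> real \<Rightarrow> real \<times> real)" by (rule linearI) auto
    have bl: "bounded_linear (prod.swap :: real \<times> real \<Rightarrow> real \<times> real)" using lin by (simp add: linear_conv_bounded_linear)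
    let ?B = "prod.swap -` A"
    have im: "?B = prod.swap ` A" by (force simp: image_iff)
    have "open ?B" using op bl by (intro open_vimage linear_continuous_on) auto
    moreover have "bounded ?B" unfolding im using bd bl by (rule bounded_linear_image)
    moreover have "convex ?B" using lin cv by (rule convex_linear_vimage)
    moreover have "?B \<noteq> {}" using ne im by simp
    moreover have "quadratically_supported M ?B"
      by (rule quadratically_supported_isometry[OF qs lin]) (auto simp: inner_prod_def)
    ultimately have "norm (\<integral>z. indicator ?B z *\<^sub>R lattice_char (prod.swap n) z \<partial>lborel) \<le> 2 * sqrt M * decay (nat \<bar>fst (prod.swap n)\<bar>)"
      using False by (intro main) auto
    moreover have "(\<integral>z. indicator ?B z *\<^sub>R lattice_char (prod.swap n) z \<partial>lborel) = (\<integral>z. indicator A z *\<^sub>R lattice_char n z \<partial>lborel)"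
    proof -
      have [measurable]: "A \<in> sets borel" using op by simp
      define f where "f = (\<lambda>z. indicat_real A z *\<^sub>R lattice_char n z)"
      have "f \<in> borel_measurable borel" unfolding f_def by measurable
      then have "f \<in> borel_measurable (lborel \<Otimes>\<^sub>M lborel)" by (simp add: lborel_prod)
      from lborel_pair.integral_product_swap[OF this]
      have swap: "(\<integral>(x, y). f (y, x) \<partial>lborel) = (\<integral>z. f z \<partial>lborel)" by (simp add: lborel_prod)
      have eq: "(\<lambda>(x, y). f (y, x)) = (\<lambda>z. indicator ?B z *\<^sub>R lattice_char (prod.swap n) z)"
        by (auto simp: f_def indicator_def lattice_char_def add.commute)
      show ?thesis using swap unfolding eq unfolding f_def .
    qed
    moreover have "nat \<bar>fst (prod.swap n)\<bar> = lattice_norm n" using False by (simp add: lattice_norm_def max_def)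
    ultimately show ?thesis by simp
  qed
qed

section \<open>Convolution of decaying coefficients and fourth moments\<close>

lemma card_lattice_sphere:
  assumes j: "j \<ge> 1"
  shows "finite {n. lattice_norm n = j}" "card {n. lattice_norm n = j} \<le> 12 * j"
proof -
  let ?I = "{- int j..int j}"
  let ?S = "{int j, - int j} \<times> ?I \<union> ?I \<times> {int j, - int j}"
  have sub: "{n. lattice_norm n = j} \<subseteq> ?S"
  proof
    fix n assume "n \<in> {n. lattice_norm n = j}"
    then have "max \<bar>fst n\<bar> \<bar>snd n\<bar> = int j" by (auto simp: lattice_norm_def)
    then have "\<bar>fst n\<bar> \<le> int j" "\<bar>snd n\<bar> \<le> int j" "\<bar>fst n\<bar> = int j \<or> \<bar>snd n\<bar> = int j"
      by linarith+
    then have "fst n \<in> ?I" "snd n \<in> ?I" "fst n \<in> {int j, - int j} \<or> snd n \<in> {int j, - int j}"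
      by (simp_all, linarith+)
    then show "n \<in> ?S" by (cases n) simp
  qed
  show "finite {n. lattice_norm n = j}" by (rule finite_subset[OF sub]) simp
  have "card {n. lattice_norm n = j} \<le> card ?S" by (rule card_mono[OF _ sub]) simp
  also have "\<dots> \<le> card ({int j, - int j} \<times> ?I) + card (?I \<times> {int j, - int j})" by (rule card_Un_le)
  also have "\<dots> = 4 * (2 * j + 1)" using j by (simp add: card_cartesian_product)
  also have "\<dots> \<le> 12 * j" using j by simp
  finally show "card {n. lattice_norm n = j} \<le> 12 * j" .
qed

text \<open>The sphere of radius \<open>j\<close> contains at most \<open>12 * j\<close> lattice points, which reduces the sum of a radial
function over the plane to a weighted sum over radii.\<close>
lemma sum_radial_le:
  fixes f :: "nat \<Rightarrow> real"
  assumes Q: "finite Q" and Q1: "\<And>n. n \<in> Q \<Longrightarrow> n \<noteq> 0" and QK: "\<And>n. n \<in> Q \<Longrightarrow> lattice_norm n \<le> K"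
    and f: "\<And>j. f j \<ge> 0"
  shows "(\<Sum>n\<in>Q. f (lattice_norm n)) \<le> 12 * (\<Sum>j=1..K. real j * f j)"
proof -
  have "(\<Sum>n\<in>Q. f (lattice_norm n)) = (\<Sum>j\<in>{1..K}. \<Sum>n\<in>{n \<in> Q. lattice_norm n = j}. f (lattice_norm n))"
  proof (rule sum.group[symmetric])
    have "1 \<le> lattice_norm n" if "n \<in> Q" for n
      using Q1[OF that] lattice_norm_eq_0_iff[of n] by linarith
    then show "lattice_norm ` Q \<subseteq> {1..K}" using QK by auto
  qed (use Q in auto)
  also have "\<dots> \<le> (\<Sum>j\<in>{1..K}. 12 * (real j * f j))"
  proof (rule sum_mono)
    fix j assume j: "j \<in> {1..K}"
    have "card {n \<in> Q. lattice_norm n = j} \<le> card {n. lattice_norm n = j}"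
      by (rule card_mono) (use card_lattice_sphere j in auto)
    then have "card {n \<in> Q. lattice_norm n = j} \<le> 12 * j" using card_lattice_sphere(2)[of j] j by simp
    then have "real (card {n \<in> Q. lattice_norm n = j}) * f j \<le> real (12 * j) * f j"
      using f by (intro mult_right_mono) (auto simp del: of_nat_mult)
    then show "(\<Sum>n\<in>{n \<in> Q. lattice_norm n = j}. f (lattice_norm n)) \<le> 12 * (real j * f j)"
      by simp
  qed
  finally show ?thesis by (simp add: sum_distrib_left)
qed

lemma sum_inverse_sqrt_le: "(\<Sum>j=1..k. 1 / sqrt (real j)) \<le> 2 * sqrt (real k)"
proof (induction k)
  case (Suc k)
  define a where "a = sqrt (real k)"
  define b where "b = sqrt (real (Suc k))"
  have ab: "a \<ge> 0" "b > 0" "b\<^sup>2 = a\<^sup>2 + 1" by (auto simp: a_def b_def)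
  have "1 \<le> 2 * b * (b - a)" using zero_le_power2[of "b - a"] ab(3) by (simp add: power2_eq_square algebra_simps)
  then have "1 / b \<le> 2 * (b - a)" using ab by (simp add: field_simps)
  then show ?case using Suc by (simp add: a_def[symmetric] b_def[symmetric] del: of_nat_Suc)
qed simp

lemma sum_inverse_square_tail_le: "(\<Sum>j=Suc k..K. 1 / (real j)\<^sup>2) \<le> 2 / real (Suc k)"
proof (cases "Suc k \<le> K")
  case True
  then have "(\<Sum>j=Suc k..K. 1 / (real j)\<^sup>2) \<le> 2 / real (Suc k) - 1 / real K"
  proof (induction K rule: dec_induct)
    case base
    have "1 / (real (Suc k))\<^sup>2 \<le> 1 / real (Suc k)"
      by (simp add: power2_eq_square divide_simps)
    then show ?case by simp
  next
    case (step n)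
    have "1 / (real (Suc n))\<^sup>2 \<le> 1 / real n - 1 / real (Suc n)"
    proof -
      have n: "real n > 0" using step by simp
      have "1 / (real (Suc n))\<^sup>2 \<le> 1 / (real n * real (Suc n))"
        using n unfolding power2_eq_square by (intro divide_left_mono mult_right_mono mult_pos_pos) auto
      also have "\<dots> = 1 / real n - 1 / real (Suc n)" using n by (simp add: field_simps)
      finally show ?thesis .
    qed
    then show ?case using step by (simp add: sum.cl_ivl_Suc)
  qed
  then show ?thesis by (rule order_trans) simp
qed simp

text \<open>The radial form of the convolution estimate. The terms are \<open>j powr (-1/2)\<close> times a constant up to
\<open>j = r\<close> and \<open>1 / j\<^sup>2\<close> from there on, and each of the two parts is at most \<open>2 / r\<close>.\<close>
lemma sum_decay_truncated_le:
  assumes r: "r > 0"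
  shows "(\<Sum>j=1..K. real j * (decay j * (1 / (max (real j) r * sqrt (max (real j) r))))) \<le> 4 / r"
proof -
  define k where "k = nat \<lfloor>r\<rfloor>"
  have k: "real k \<le> r" "r < real (Suc k)" using r unfolding k_def by linarith+
  define t where "t = (\<lambda>j. real j * (decay j * (1 / (max (real j) r * sqrt (max (real j) r)))))"
  have t0: "t j \<ge> 0" for j unfolding t_def using r by (simp add: decay_nonneg max_def)
  have "(\<Sum>j=1..K. t j) \<le> (\<Sum>j\<in>{1..k} \<union> {Suc k..K}. t j)"
    by (rule sum_mono2) (auto simp: t0)
  also have "\<dots> = (\<Sum>j=1..k. t j) + (\<Sum>j=Suc k..K. t j)"
    by (rule sum.union_disjoint) auto
  also have "(\<Sum>j=1..k. t j) \<le> (\<Sum>j=1..k. 1 / sqrt (real j) * (1 / (r * sqrt r)))"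
  proof (rule sum_mono)
    fix j assume j: "j \<in> {1..k}"
    then have "real j \<le> r" using k by simp
    then show "t j \<le> 1 / sqrt (real j) * (1 / (r * sqrt r))" using j by (simp add: t_def decay_def max_def)
  qed
  also have "\<dots> = (\<Sum>j=1..k. 1 / sqrt (real j)) * (1 / (r * sqrt r))" by (rule sum_distrib_right[symmetric])
  also have "\<dots> \<le> 2 * sqrt r * (1 / (r * sqrt r))"
    using sum_inverse_sqrt_le[of k] k r by (intro mult_right_mono order_trans[OF sum_inverse_sqrt_le]) auto
  also have "\<dots> = 2 / r" using r by (simp add: field_simps)
  also have "(\<Sum>j=Suc k..K. t j) \<le> (\<Sum>j=Suc k..K. 1 / (real j)\<^sup>2)"
  proof (rule sum_mono)
    fix j assume j: "j \<in> {Suc k..K}"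
    then have "r \<le> real j" using k by auto
    then have "t j = 1 / (sqrt (real j) * sqrt (real j) * real j)" using j by (simp add: t_def decay_def max_def mult_ac)
    then show "t j \<le> 1 / (real j)\<^sup>2" by (simp add: power2_eq_square)
  qed
  also have "\<dots> \<le> 2 / r"
    using k r by (intro order_trans[OF sum_inverse_square_tail_le]) (auto simp: field_simps)
  finally show ?thesis unfolding t_def by simp
qed

text \<open>On this half of the lattice the second factor is dominated by a radial function of \<open>n\<close>, since the norm
of \<open>m - n\<close> is at least that of \<open>n\<close> and, by the triangle inequality, at least half that of \<open>m\<close>.\<close>
lemma lattice_convolution_half_le:
  assumes Q: "finite Q" and Qp: "\<And>n. n \<in> Q \<Longrightarrow> n \<noteq> 0 \<and> lattice_norm n \<le> lattice_norm (m - n)"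
  shows "(\<Sum>n\<in>Q. decay (lattice_norm n) * decay (lattice_norm (m - n))) \<le> 96 / max 1 (real (lattice_norm m))"
proof -
  \<comment> \<open>The maximum with \<open>1\<close> covers \<open>m = 0\<close>, where \<open>lattice_norm n \<ge> 1\<close> takes the role of the triangle inequality.\<close>
  define r where "r = max 1 (real (lattice_norm m)) / 2"
  have r: "r > 0" by (simp add: r_def)
  define g where "g = (\<lambda>j. decay j * (1 / (max (real j) r * sqrt (max (real j) r))))"
  obtain K where K: "\<And>n. n \<in> Q \<Longrightarrow> lattice_norm n \<le> K"
    using Q by (meson finite_imageI bdd_above_finite bdd_above.unfold imageI)
  have "(\<Sum>n\<in>Q. decay (lattice_norm n) * decay (lattice_norm (m - n))) \<le> (\<Sum>n\<in>Q. g (lattice_norm n))"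
  proof (rule sum_mono)
    fix n assume n: "n \<in> Q"
    have n1: "lattice_norm n \<ge> 1" using Qp[OF n] lattice_norm_eq_0_iff[of n] by linarith
    have le: "lattice_norm n \<le> lattice_norm (m - n)" using Qp[OF n] by simp
    have "lattice_norm m \<le> lattice_norm (m - n) + lattice_norm n" using lattice_norm_triangle[of "m - n" n] by simp
    then have x: "max (real (lattice_norm n)) r \<le> real (lattice_norm (m - n))" (is "?x \<le> ?y") using le n1 unfolding r_def by auto
    have x0: "?x > 0" using r by simp
    have y0: "?y > 0" using x x0 by linarith
    have "?x * sqrt ?x \<le> ?y * sqrt ?y" using x x0 by (intro mult_mono real_sqrt_le_mono) auto
    then have "decay (lattice_norm (m - n)) \<le> 1 / (?x * sqrt ?x)"
      unfolding decay_def using x0 y0 by (intro divide_left_mono mult_pos_pos real_sqrt_gt_zero) auto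
    then show "decay (lattice_norm n) * decay (lattice_norm (m - n)) \<le> g (lattice_norm n)"
      unfolding g_def by (intro mult_left_mono) (auto simp: decay_nonneg)
  qed
  also have "\<dots> \<le> 12 * (\<Sum>j=1..K. real j * g j)"
    by (rule sum_radial_le[OF Q]) (use Qp K r in \<open>auto simp: g_def decay_nonneg max_def\<close>)
  also have "\<dots> \<le> 12 * (4 / r)" unfolding g_def using sum_decay_truncated_le[OF r] by (intro mult_left_mono) auto
  also have "\<dots> = 96 / max 1 (real (lattice_norm m))" by (simp add: r_def)
  finally show ?thesis .
qed

text \<open>The reflection \<open>n \<mapsto> m - n\<close> exchanges the two factors, and with them the half covered by
\<open>lattice_convolution_half_le\<close> and its complement.\<close>
lemma lattice_convolution_le:
  assumes Q: "finite Q" and Qp: "\<And>n. n \<in> Q \<Longrightarrow> n \<noteq> 0 \<and> n \<noteq> m"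
  shows "(\<Sum>n\<in>Q. decay (lattice_norm n) * decay (lattice_norm (m - n))) \<le> 192 / max 1 (real (lattice_norm m))"
proof -
  let ?t = "\<lambda>n. decay (lattice_norm n) * decay (lattice_norm (m - n))"
  define Q1 where "Q1 = {n \<in> Q. lattice_norm n \<le> lattice_norm (m - n)}"
  define Q2 where "Q2 = {n \<in> Q. \<not> lattice_norm n \<le> lattice_norm (m - n)}"
  have "(\<Sum>n\<in>Q. ?t n) = (\<Sum>n\<in>Q1. ?t n) + (\<Sum>n\<in>Q2. ?t n)"
    unfolding Q1_def Q2_def using Q by (subst sum.union_disjoint[symmetric]) (auto intro!: sum.cong)
  moreover have "(\<Sum>n\<in>Q1. ?t n) \<le> 96 / max 1 (real (lattice_norm m))"
    by (rule lattice_convolution_half_le) (use Q Qp in \<open>auto simp: Q1_def\<close>)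
  moreover have "(\<Sum>n\<in>Q2. ?t n) = (\<Sum>n\<in>(\<lambda>n. m - n) ` Q2. ?t n)"
    by (subst sum.reindex) (auto simp: inj_on_def mult.commute)
  moreover have "(\<Sum>n\<in>(\<lambda>n. m - n) ` Q2. ?t n) \<le> 96 / max 1 (real (lattice_norm m))"
  proof (rule lattice_convolution_half_le)
    fix n assume "n \<in> (\<lambda>n. m - n) ` Q2"
    then obtain k where "k \<in> Q2" "n = m - k" by blast
    then show "n \<noteq> 0 \<and> lattice_norm n \<le> lattice_norm (m - n)" using Qp[of k] by (auto simp: Q2_def)
  qed (use Q in \<open>simp add: Q2_def\<close>)
  ultimately show ?thesis by simp
qed

lemma harmonic_sum_le: "K \<ge> 1 \<Longrightarrow> (\<Sum>j=1..K. 1 / real j) \<le> 1 + ln (real K)"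
proof (induction K rule: dec_induct)
  case (step n)
  have n: "real n > 0" using step by simp
  have "ln (real n / real (Suc n)) \<le> real n / real (Suc n) - 1" using n by (intro ln_le_minus_one) auto
  then have "1 / real (Suc n) \<le> ln (real (Suc n)) - ln (real n)" using n by (simp add: ln_div field_simps)
  then show ?case using step by (simp add: sum.cl_ivl_Suc)
qed simp

lemma sum_inverse_square_lattice_le:
  assumes Q: "finite Q" and QK: "\<And>n. n \<in> Q \<Longrightarrow> lattice_norm n \<le> K" and K: "K \<ge> 1"
  shows "(\<Sum>m\<in>Q. 1 / (max 1 (real (lattice_norm m)))\<^sup>2) \<le> 13 + 12 * ln (real K)"
proof -
  let ?f = "\<lambda>j. 1 / (max 1 (real j))\<^sup>2"
  have "(\<Sum>m\<in>Q. ?f (lattice_norm m)) \<le> (\<Sum>m\<in>insert 0 (Q - {0}). ?f (lattice_norm m))"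
    using Q by (intro sum_mono2) auto
  also have "\<dots> = ?f (lattice_norm 0) + (\<Sum>m\<in>Q - {0}. ?f (lattice_norm m))"
    by (subst sum.insert) (use Q in auto)
  also have "\<dots> \<le> 1 + 12 * (\<Sum>j=1..K. real j * ?f j)"
  proof (intro add_mono)
    show "(\<Sum>m\<in>Q - {0}. ?f (lattice_norm m)) \<le> 12 * (\<Sum>j=1..K. real j * ?f j)"
      by (rule sum_radial_le) (use Q QK in auto)
  qed (simp add: lattice_norm_def)
  also have "(\<Sum>j=1..K. real j * ?f j) = (\<Sum>j=1..K. 1 / real j)"
    by (intro sum.cong refl) (auto simp: power2_eq_square max_def)
  also have "1 + 12 * \<dots> \<le> 1 + 12 * (1 + ln (real K))"
    using harmonic_sum_le[OF K] by (intro add_mono mult_left_mono) auto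
  finally show ?thesis by simp
qed

text \<open>The coefficients of the squared polynomial are \<open>O(c\<^sup>2 / \<bar>m\<bar>)\<close>, and their squares are summable up to the
logarithm of the cut-off \<open>K\<close>.\<close>
lemma trigonometric_polynomial_L4_le:
  assumes Q: "finite Q" and QK: "\<And>n. n \<in> Q \<Longrightarrow> lattice_norm n \<le> K" and K: "K \<ge> 1"
    and a0: "a 0 = 0" and a: "\<And>n. n \<in> Q \<Longrightarrow> norm (a n) \<le> c * decay (lattice_norm n)"
  shows "(\<integral>x. (norm (\<Sum>n\<in>Q. a n * lattice_char n x)) ^ 4 \<partial>cell_measure)
      \<le> (192 * c\<^sup>2)\<^sup>2 * (13 + 12 * ln (real (2 * K)))"
proof -
  define Q2 where "Q2 = (\<lambda>(n, n'). n + n') ` (Q \<times> Q)"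
  define P where "P = (\<lambda>m. {z \<in> Q \<times> Q. fst z + snd z = m})"
  have Pf: "finite (P m)" for m using Q by (auto simp: P_def)
  have b: "norm (\<Sum>(n, n')\<in>P m. a n * a n') \<le> 192 * c\<^sup>2 * (1 / max 1 (real (lattice_norm m)))" for m
  proof -
    \<comment> \<open>Pairs with a zero component contribute nothing because \<open>a 0 = 0\<close>.\<close>
    define P' where "P' = {z \<in> P m. fst z \<noteq> 0 \<and> snd z \<noteq> 0}"
    have "(\<Sum>(n, n')\<in>P m. a n * a n') = (\<Sum>z\<in>P'. a (fst z) * a (snd z))"
      unfolding case_prod_beta using Pf[of m] a0 by (intro sum.mono_neutral_right) (auto simp: P'_def)
    also have "norm \<dots> \<le> (\<Sum>z\<in>P'. norm (a (fst z) * a (snd z)))" by (rule norm_sum)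
    also have "\<dots> \<le> (\<Sum>z\<in>P'. c\<^sup>2 * (decay (lattice_norm (fst z)) * decay (lattice_norm (m - fst z))))"
    proof (rule sum_mono)
      fix z assume z: "z \<in> P'"
      then have zs: "m - fst z = snd z" "fst z \<in> Q" "snd z \<in> Q" by (auto simp: P'_def P_def)
      have "norm (a (fst z)) * norm (a (snd z)) \<le> (c * decay (lattice_norm (fst z))) * (c * decay (lattice_norm (snd z)))"
        using a[OF zs(2)] a[OF zs(3)] by (intro mult_mono order_trans[OF norm_ge_zero a[OF zs(2)]]) auto
      then show "norm (a (fst z) * a (snd z)) \<le> c\<^sup>2 * (decay (lattice_norm (fst z)) * decay (lattice_norm (m - fst z)))"
        by (simp add: norm_mult zs power2_eq_square mult_ac)
    qed
    also have "\<dots> = c\<^sup>2 * (\<Sum>n\<in>fst ` P'. decay (lattice_norm n) * decay (lattice_norm (m - n)))"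
    proof -
      have "inj_on fst P'" by (auto simp: inj_on_def P'_def P_def)
      then show ?thesis by (simp add: sum.reindex sum_distrib_left)
    qed
    also have "\<dots> \<le> c\<^sup>2 * (192 / max 1 (real (lattice_norm m)))"
    proof (intro mult_left_mono lattice_convolution_le)
      show "finite (fst ` P')" using Pf[of m] by (simp add: P'_def)
      fix n assume "n \<in> fst ` P'"
      then obtain z where "n = fst z" "fst z + snd z = m" "fst z \<noteq> 0" "snd z \<noteq> 0"
        by (auto simp: P'_def P_def)
      then show "n \<noteq> 0 \<and> n \<noteq> m" by auto
    qed simp
    finally show ?thesis by (simp add: mult_ac)
  qed
  have "(\<integral>x. (norm (\<Sum>n\<in>Q. a n * lattice_char n x)) ^ 4 \<partial>cell_measure) = (\<Sum>m\<in>Q2. (norm (\<Sum>(n, n')\<in>P m. a n * a n'))\<^sup>2)"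
    unfolding P_def Q2_def by (rule trigonometric_polynomial_L4[OF Q])
  also have "\<dots> \<le> (\<Sum>m\<in>Q2. (192 * c\<^sup>2 * (1 / max 1 (real (lattice_norm m))))\<^sup>2)"
    using b by (intro sum_mono power_mono) auto
  also have "\<dots> = (192 * c\<^sup>2)\<^sup>2 * (\<Sum>m\<in>Q2. 1 / (max 1 (real (lattice_norm m)))\<^sup>2)"
    by (simp only: power_mult_distrib sum_distrib_left power_one_over)
  also have "\<dots> \<le> (192 * c\<^sup>2)\<^sup>2 * (13 + 12 * ln (real (2 * K)))"
  proof (intro mult_left_mono sum_inverse_square_lattice_le)
    fix m assume "m \<in> Q2"
    then obtain n n' where nn: "n \<in> Q" "n' \<in> Q" "m = n + n'" by (auto simp: Q2_def)
    then show "lattice_norm m \<le> 2 * K"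
      using lattice_norm_triangle[of n n'] QK[OF nn(1)] QK[OF nn(2)] by simp
  qed (use Q K in \<open>auto simp: Q2_def\<close>)
  finally show ?thesis .
qed

section \<open>Smoothing with the Fejer kernel\<close>

text \<open>Up to \<open>pi / 3\<close> the derivative of the sine is at least \<open>1 / 2\<close>; beyond, the sine is at least \<open>2 / 3\<close>.\<close>
lemma sin_ge_third: 
  assumes "0 \<le> y" "y \<le> pi / 2"
  shows "y / 3 \<le> sin y"
proof (cases "y \<le> pi / 3")
  case True
  show ?thesis
  proof (cases "y = 0")
    case False
    then have "0 < y" using assms by simp
    then obtain z where z: "0 < z" "z < y" "sin y - sin 0 = (y - 0) * cos z"
      using MVT2[of 0 y sin cos] by (auto intro: DERIV_sin)
    have "cos (pi / 3) \<le> cos z"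
      by (rule cos_monotone_0_pi_le) (use z True pi_gt_zero in linarith)+
    then have "1 / 2 \<le> cos z" by (simp add: cos_60)
    then have "y * (1 / 3) \<le> y * cos z" using assms by (intro mult_left_mono) auto
    then show ?thesis using z by simp
  qed simp
next
  case False
  have "sin (pi / 6) \<le> sin (pi / 3)"
    by (rule sin_monotone_2pi_le) (use pi_gt_zero in linarith)+
  have "sin (pi / 3) \<le> sin y"
    by (rule sin_monotone_2pi_le) (use False assms pi_gt_zero in linarith)+
  moreover have "sqrt 3 / 2 \<ge> 2 / 3"
  proof -
    have "4 / 3 \<le> sqrt 3" by (rule real_le_rsqrt) (simp add: power2_eq_square)
    then show ?thesis by simp
  qed
  ultimately have "2 / 3 \<le> sin y" by (simp add: sin_60)
  then show ?thesis using assms pi_less_4 by linarith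
qed

lemma norm_one_minus_cis_ge:
  assumes "\<And>k::int. \<epsilon> \<le> \<bar>t - of_int k\<bar>" and "\<epsilon> \<ge> 0"
  shows "2 * \<epsilon> \<le> norm (1 - cis (2 * pi * t))"
proof -
  \<comment> \<open>By periodicity only the distance to the nearest integer matters.\<close>
  define u where "u = t - of_int (round t)"
  have u: "\<bar>u\<bar> \<le> 1 / 2" "\<epsilon> \<le> \<bar>u\<bar>"
    using of_int_round_abs_le[of t] assms(1)[of "round t"] unfolding u_def by (auto simp: abs_minus_commute)
  have "cis (2 * pi * t) = cis (2 * pi * u) * cis (2 * pi * of_int (round t))"
    by (simp add: cis_mult u_def algebra_simps)
  also have "cis (2 * pi * of_int (round t)) = 1" by (rule cis_multiple_2pi) simp
  finally have c: "cis (2 * pi * t) = cis (2 * pi * u)" by simp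
  have "(norm (1 - cis (2 * pi * u)))\<^sup>2 = (1 - cos (2 * (pi * u)))\<^sup>2 + (sin (2 * (pi * u)))\<^sup>2"
    by (simp add: cmod_power2 mult.assoc)
  also have "\<dots> = (2 * \<bar>sin (pi * u)\<bar>)\<^sup>2"
    unfolding power_mult_distrib power2_abs sin_double cos_double
    using sin_cos_squared_add[of "pi * u"] by algebra
  finally have n: "norm (1 - cis (2 * pi * u)) = 2 * \<bar>sin (pi * u)\<bar>"
    by (subst (asm) power2_eq_iff_nonneg) auto
  have "\<bar>sin (pi * u)\<bar> = \<bar>sin (pi * \<bar>u\<bar>)\<bar>" by (simp add: abs_if)
  moreover have "pi * \<bar>u\<bar> / 3 \<le> sin (pi * \<bar>u\<bar>)"
    by (rule sin_ge_third) (use u in \<open>auto simp: field_simps\<close>)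
  moreover have "\<bar>u\<bar> \<le> pi * \<bar>u\<bar> / 3" using pi_gt3 mult_right_mono[of 3 pi "\<bar>u\<bar>"] by simp
  ultimately show ?thesis using u unfolding c n by linarith
qed

text \<open>For a box \<open>J\<close> this is the product of two Fejer kernels, and for the sides of the box it is one of the
factors. It has mean \<open>1\<close> for every nonempty finite \<open>J\<close>.\<close>
definition fejer :: "(int \<times> int) set \<Rightarrow> real \<times> real \<Rightarrow> real" where
  "fejer J x = (norm (\<Sum>j\<in>J. lattice_char j x))\<^sup>2 / real (card J)"

lemma fejer_nonneg: "fejer J x \<ge> 0"
  by (simp add: fejer_def)

lemma fejer_measurable [measurable]: "fejer J \<in> borel_measurable borel"
  unfolding fejer_def by measurable

lemma fejer_le: "fejer J x \<le> real (card J)"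
proof -
  have "norm (\<Sum>j\<in>J. lattice_char j x) \<le> real (card J)"
    using norm_sum[of "\<lambda>j. lattice_char j x" J] by simp
  then have "(norm (\<Sum>j\<in>J. lattice_char j x))\<^sup>2 \<le> (real (card J))\<^sup>2" by (intro power_mono) auto
  then show ?thesis by (cases "card J = 0") (auto simp: fejer_def power2_eq_square field_simps)
qed

lemma fejer_integrable: "integrable cell_measure (\<lambda>y. fejer J (y - x))"
  by (rule integrable_cell_bounded[where B="real (card J)"]) (auto simp: fejer_nonneg fejer_le)

lemma fejer_integral:
  assumes "finite J" "J \<noteq> {}"
  shows "(\<integral>y. fejer J (y - x) \<partial>cell_measure) = 1"
proof -
  have "(\<integral>y. (norm (\<Sum>j\<in>J. lattice_char j (- x) * lattice_char j y))\<^sup>2 \<partial>cell_measure) = real (card J)"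
    using assms by (subst parseval_trigonometric_polynomial) auto
  moreover have "lattice_char j (y - x) = lattice_char j (- x) * lattice_char j y" for j y
    using lattice_char_add_arg[of j "-x" y] by simp
  ultimately show ?thesis using assms by (simp add: fejer_def)
qed

lemma fejer_expand:
  assumes "finite J"
  shows "complex_of_real (fejer J (y - x)) =
    (\<Sum>(j, l)\<in>J \<times> J. lattice_char (j - l) y * lattice_char (l - j) x) / of_nat (card J)"
proof -
  have "complex_of_real ((norm (\<Sum>j\<in>J. lattice_char j (y - x)))\<^sup>2) =
      (\<Sum>j\<in>J. lattice_char j (y - x)) * cnj (\<Sum>l\<in>J. lattice_char l (y - x))"
    by (simp only: complex_norm_square)
  also have "\<dots> = (\<Sum>(j, l)\<in>J \<times> J. lattice_char j (y - x) * lattice_char (- l) (y - x))"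
    by (simp add: sum_product cnj_sum cnj_lattice_char sum.cartesian_product)
  also have "\<dots> = (\<Sum>(j, l)\<in>J \<times> J. lattice_char (j - l) y * lattice_char (l - j) x)"
  proof (intro sum.cong refl, clarify)
    fix a b c d :: int
    show "lattice_char (a, b) (y - x) * lattice_char (- (c, d)) (y - x)
        = lattice_char ((a, b) - (c, d)) y * lattice_char ((c, d) - (a, b)) x"
      using lattice_char_add[of "(a, b)" "- (c, d)"] lattice_char_add_arg[of "(a, b) - (c, d)" y "- x"]
        lattice_char_minus_arg[of "(a, b) - (c, d)" x] by simp
  qed
  finally show ?thesis by (simp add: fejer_def)
qed

lemma fejer_square_eq:
  "fejer (I \<times> I) x = fejer (I \<times> {0}) x * fejer ({0} \<times> I) x"
proof -
  have "(\<Sum>j\<in>I \<times> I. lattice_char j x) = (\<Sum>a\<in>I. \<Sum>b\<in>I. lattice_char (a, 0) x * lattice_char (0, b) x)"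
    by (simp add: sum.cartesian_product' lattice_char_add[symmetric])
  also have "\<dots> = (\<Sum>a\<in>I. lattice_char (a, 0) x) * (\<Sum>b\<in>I. lattice_char (0, b) x)"
    by (simp add: sum_product)
  also have "(\<Sum>a\<in>I. lattice_char (a, 0) x) = (\<Sum>j\<in>I \<times> {0}. lattice_char j x)"
    by (simp add: sum.cartesian_product')
  also have "(\<Sum>b\<in>I. lattice_char (0, b) x) = (\<Sum>j\<in>{0} \<times> I. lattice_char j x)"
    by (simp add: sum.cartesian_product')
  finally show ?thesis
    by (simp add: fejer_def norm_mult power_mult_distrib card_cartesian_product)
qed

lemma norm_geometric_cis_sum_le:
  assumes "\<And>k::int. \<epsilon> \<le> \<bar>t - of_int k\<bar>" and e: "\<epsilon> > 0"
  shows "norm (\<Sum>a\<in>{0..<int N}. cis (2 * pi * (of_int a * t))) \<le> 1 / \<epsilon>"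
proof -
  define w where "w = cis (2 * pi * t)"
  have d: "2 * \<epsilon> \<le> norm (1 - w)" unfolding w_def using assms by (intro norm_one_minus_cis_ge) auto
  have "(\<Sum>a\<in>{0..<int N}. cis (2 * pi * (of_int a * t))) = (\<Sum>a\<in>int ` {..<N}. cis (2 * pi * (of_int a * t)))"
    by (simp add: image_int_atLeastLessThan lessThan_atLeast0)
  also have "\<dots> = (\<Sum>a<N. w ^ a)"
  proof -
    have "cis (2 * pi * (real a * t)) = w ^ a" for a
      by (simp add: w_def Complex.DeMoivre mult.commute mult.left_commute)
    then show ?thesis by (simp add: sum.reindex)
  qed
  finally have S: "(\<Sum>a\<in>{0..<int N}. cis (2 * pi * (of_int a * t))) = (\<Sum>a<N. w ^ a)" .
  have "norm (1 - w) * norm (\<Sum>a<N. w ^ a) = norm (1 - w ^ N)"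
    by (simp add: one_diff_power_eq norm_mult)
  also have "\<dots> \<le> norm (1::complex) + norm (w ^ N)" by (rule norm_triangle_ineq4)
  also have "\<dots> = 2" by (simp add: norm_power w_def)
  finally have "2 * \<epsilon> * norm (\<Sum>a<N. w ^ a) \<le> 2"
    using mult_right_mono[OF d, of "norm (\<Sum>a<N. w ^ a)"] by simp
  then show ?thesis unfolding S using e by (simp add: field_simps)
qed

text \<open>In one variable the exponential sum is geometric, hence bounded away from the integers, while the
normalisation contributes \<open>1 / N\<close>.\<close>
lemma fejer_line_le:
  assumes N: "N \<ge> 1" and e: "\<epsilon> > 0"
  shows "(\<And>k::int. \<epsilon> \<le> \<bar>fst x - of_int k\<bar>) \<Longrightarrow> fejer ({0..<int N} \<times> {0}) x \<le> 1 / (real N * \<epsilon>\<^sup>2)"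
    and "(\<And>k::int. \<epsilon> \<le> \<bar>snd x - of_int k\<bar>) \<Longrightarrow> fejer ({0} \<times> {0..<int N}) x \<le> 1 / (real N * \<epsilon>\<^sup>2)"
proof -
  have sq: "s\<^sup>2 / real N \<le> 1 / (real N * \<epsilon>\<^sup>2)" if "0 \<le> s" "s \<le> 1 / \<epsilon>" for s
  proof -
    have "s\<^sup>2 \<le> (1 / \<epsilon>)\<^sup>2" using that by (intro power_mono) auto
    then have "s\<^sup>2 / real N \<le> (1 / \<epsilon>)\<^sup>2 / real N" by (intro divide_right_mono) auto
    then show ?thesis by (simp add: power_one_over field_simps)
  qed
  show "fejer ({0..<int N} \<times> {0}) x \<le> 1 / (real N * \<epsilon>\<^sup>2)" if "\<And>k::int. \<epsilon> \<le> \<bar>fst x - of_int k\<bar>"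
    using sq[OF _ norm_geometric_cis_sum_le[OF that e, of N]]
    by (simp add: fejer_def sum.cartesian_product' lattice_char_def card_cartesian_product)
  show "fejer ({0} \<times> {0..<int N}) x \<le> 1 / (real N * \<epsilon>\<^sup>2)" if "\<And>k::int. \<epsilon> \<le> \<bar>snd x - of_int k\<bar>"
    using sq[OF _ norm_geometric_cis_sum_le[OF that e, of N]]
    by (simp add: fejer_def sum.cartesian_product' lattice_char_def card_cartesian_product)
qed

abbreviation frequency_box :: "nat \<Rightarrow> (int \<times> int) set" where
  "frequency_box N \<equiv> {0..<int N} \<times> {0..<int N}"

text \<open>Off the \<open>\<epsilon>\<close>-neighbourhood of the lattice one coordinate has distance at least \<open>\<epsilon>\<close> from the integers, so
one of the two factors of the kernel is \<open>O(1 / (N * \<epsilon>\<^sup>2))\<close>. Keeping the other factor in the bound, instead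
of estimating it too, leaves a function of mean \<open>1\<close>.\<close>
lemma fejer_concentration:
  fixes \<delta> B \<epsilon> :: real
  assumes N: "N \<ge> 1" and e: "\<epsilon> > 0" and B: "B \<ge> 0" and le: "\<delta> \<le> B"
    and good: "\<And>j. \<bar>fst (x - lattice_point j)\<bar> \<le> \<epsilon> \<Longrightarrow> \<bar>snd (x - lattice_point j)\<bar> \<le> \<epsilon> \<Longrightarrow> \<delta> \<le> 0"
  shows "fejer (frequency_box N) x * \<delta> \<le>
    B / (real N * \<epsilon>\<^sup>2) * (fejer ({0..<int N} \<times> {0}) x + fejer ({0} \<times> {0..<int N}) x)"
proof -
  let ?f = "fejer ({0..<int N} \<times> {0}) x" and ?g = "fejer ({0} \<times> {0..<int N}) x"
  define \<kappa> where "\<kappa> = 1 / (real N * \<epsilon>\<^sup>2)"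
  have \<kappa>: "\<kappa> \<ge> 0" by (simp add: \<kappa>_def)
  have fg: "?f \<ge> 0" "?g \<ge> 0" by (auto simp: fejer_nonneg)
  have r: "B * (\<kappa> * (?f + ?g)) \<ge> 0" using B \<kappa> fg by simp
  have "?f * ?g * \<delta> \<le> B * (\<kappa> * (?f + ?g))"
  proof (cases "\<delta> \<le> 0")
    case True
    then have "?f * ?g * \<delta> \<le> 0" using fg by (simp add: mult_nonneg_nonpos)
    then show ?thesis using r by simp
  next
    case False
    have "(\<forall>k::int. \<epsilon> \<le> \<bar>fst x - of_int k\<bar>) \<or> (\<forall>k::int. \<epsilon> \<le> \<bar>snd x - of_int k\<bar>)"
    proof (rule ccontr)
      assume "\<not> ?thesis"
      then obtain k l :: int where "\<bar>fst x - of_int k\<bar> < \<epsilon>" "\<bar>snd x - of_int l\<bar> < \<epsilon>" by (auto simp: not_le)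
      then show False using good[of "(k, l)"] False by (simp add: lattice_point_def)
    qed
    then have "?f * ?g \<le> \<kappa> * (?f + ?g)"
    proof
      assume "\<forall>k::int. \<epsilon> \<le> \<bar>fst x - of_int k\<bar>"
      then have "?f \<le> \<kappa>" unfolding \<kappa>_def by (intro fejer_line_le N e) auto
      then have "?f * ?g \<le> \<kappa> * ?g" using fg by (intro mult_right_mono)
      also have "\<dots> \<le> \<kappa> * (?f + ?g)" using \<kappa> fg by (intro mult_left_mono) auto
      finally show ?thesis .
    next
      assume "\<forall>k::int. \<epsilon> \<le> \<bar>snd x - of_int k\<bar>"
      then have "?g \<le> \<kappa>" unfolding \<kappa>_def by (intro fejer_line_le N e) auto
      then have "?f * ?g \<le> ?f * \<kappa>" using fg by (intro mult_left_mono)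
      also have "\<dots> = \<kappa> * ?f" by simp
      also have "\<dots> \<le> \<kappa> * (?f + ?g)" using \<kappa> fg by (intro mult_left_mono) auto
      finally show ?thesis .
    qed
    then have "\<delta> * (?f * ?g) \<le> B * (\<kappa> * (?f + ?g))" using False le fg by (intro mult_mono[OF le]) auto
    then show ?thesis by (simp add: mult.commute)
  qed
  then show ?thesis unfolding fejer_square_eq \<kappa>_def by (simp add: mult.assoc)
qed

lemma lattice_count_fejer_integrable:
  assumes bd: "bounded A" and A: "A \<in> sets borel"
  shows "integrable cell_measure (\<lambda>y. fejer J (y - x) * lattice_count A y)"
proof -
  obtain K where K: "A \<subseteq> cball 0 K" using bd bounded_any_center[of A 0] by (auto simp: subset_iff)
  have K': "A \<subseteq> cball 0 (max 0 K)" using K by auto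
  show ?thesis
  proof (rule integrable_cell_bounded[where B="real (card J) * (2 * max 0 K + 4)\<^sup>2"])
    have "lattice_count A \<in> borel_measurable cell_measure" using bd A by (rule lattice_count_measurable)
    then show "(\<lambda>y. fejer J (y - x) * lattice_count A y) \<in> borel_measurable cell_measure"
      by (intro borel_measurable_times measurable_cell_measure[of "\<lambda>y. fejer J (y - x)"]) auto
    fix y assume "y \<in> unit_cell"
    then have "lattice_count A y \<le> (2 * max 0 K + 4)\<^sup>2"
      using unit_cell_subset by (intro lattice_count_bound[OF K']) auto
    moreover have "lattice_count A y \<ge> 0" by (simp add: lattice_count_def)
    ultimately have "fejer J (y - x) * lattice_count A y \<le> real (card J) * (2 * max 0 K + 4)\<^sup>2"
      by (intro mult_mono fejer_le) (auto simp: fejer_nonneg)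
    then show "norm (fejer J (y - x) * lattice_count A y) \<le> real (card J) * (2 * max 0 K + 4)\<^sup>2"
      using \<open>lattice_count A y \<ge> 0\<close> by (simp add: fejer_nonneg abs_mult)
  qed
qed

text \<open>If \<open>y\<close> is within \<open>\<epsilon>\<close> of \<open>x\<close> modulo the lattice, the count for \<open>A\<close> at one of the two points is at most the
count for \<open>A'\<close> at the other one. Averaging over \<open>y\<close> against the kernel gives both inequalities; for the
remaining \<open>y\<close> the trivial bound \<open>B\<close> is multiplied by the small mass of the kernel there.\<close>
lemma smoothing_comparison:
  fixes B \<epsilon> :: real
  assumes bd: "bounded A" "bounded A'" and ms: "A \<in> sets borel" "A' \<in> sets borel"
    and nb: "\<And>z v. z \<in> A \<Longrightarrow> \<bar>fst v\<bar> \<le> \<epsilon> \<Longrightarrow> \<bar>snd v\<bar> \<le> \<epsilon> \<Longrightarrow> z + v \<in> A'"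
    and e: "\<epsilon> > 0" and N: "N \<ge> 1" and B: "\<And>y. y \<in> unit_cell \<Longrightarrow> lattice_count A y \<le> B"
    and x: "x \<in> unit_cell"
  shows "lattice_count A x \<le> (\<integral>y. fejer (frequency_box N) (y - x) * lattice_count A' y \<partial>cell_measure) + 2 * B / (real N * \<epsilon>\<^sup>2)"
    and "(\<integral>y. fejer (frequency_box N) (y - x) * lattice_count A y \<partial>cell_measure) - 2 * B / (real N * \<epsilon>\<^sup>2) \<le> lattice_count A' x"
proof -
  let ?K = "fejer (frequency_box N)" and ?f = "fejer ({0..<int N} \<times> {0})" and ?g = "fejer ({0} \<times> {0..<int N})"
  have c0: "lattice_count S y \<ge> 0" for S y by (simp add: lattice_count_def)
  have B0: "B \<ge> 0" using B[OF x] c0[of A x] by linarith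
  have ne: "frequency_box N \<noteq> {}" "{0..<int N} \<times> {0} \<noteq> ({} :: (int \<times> int) set)" "{0} \<times> {0..<int N} \<noteq> ({} :: (int \<times> int) set)"
    using N by auto
  define H where "H = (\<lambda>y. B / (real N * \<epsilon>\<^sup>2) * (?f (y - x) + ?g (y - x)))"
  have Hi: "integrable cell_measure H" unfolding H_def
    by (intro integrable_mult_right Bochner_Integration.integrable_add fejer_integrable)
  have HI: "(\<integral>y. H y \<partial>cell_measure) = 2 * B / (real N * \<epsilon>\<^sup>2)"
    unfolding H_def using ne by (simp add: fejer_integrable fejer_integral)
  have Kc: "integrable cell_measure (\<lambda>y. ?K (y - x) * c)" "(\<integral>y. ?K (y - x) * c \<partial>cell_measure) = c" for c
    using ne fejer_integrable[of "frequency_box N" x] by (simp_all add: fejer_integral)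
  have A: "integrable cell_measure (\<lambda>y. ?K (y - x) * lattice_count A y)"
    and A': "integrable cell_measure (\<lambda>y. ?K (y - x) * lattice_count A' y)"
    using bd ms by (auto intro: lattice_count_fejer_integrable)
  have "lattice_count A x - (\<integral>y. ?K (y - x) * lattice_count A' y \<partial>cell_measure)
      = (\<integral>y. ?K (y - x) * (lattice_count A x - lattice_count A' y) \<partial>cell_measure)"
    using Kc[of "lattice_count A x"] A' by (simp add: right_diff_distrib)
  also have "\<dots> \<le> (\<integral>y. H y \<partial>cell_measure)"
  proof (rule integral_mono)
    show "integrable cell_measure (\<lambda>y. ?K (y - x) * (lattice_count A x - lattice_count A' y))"
      using Kc[of "lattice_count A x"] A' by (simp add: right_diff_distrib)
    fix y assume "y \<in> space cell_measure"
    show "?K (y - x) * (lattice_count A x - lattice_count A' y) \<le> H y"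
      unfolding H_def
    proof (rule fejer_concentration[OF N e B0])
      show "lattice_count A x - lattice_count A' y \<le> B" using B[OF x] c0[of A' y] by linarith
      fix j assume "\<bar>fst (y - x - lattice_point j)\<bar> \<le> \<epsilon>" "\<bar>snd (y - x - lattice_point j)\<bar> \<le> \<epsilon>"
      then have "lattice_count A x \<le> lattice_count A' y"
        by (intro lattice_count_translate[OF bd(2)] nb)
      then show "lattice_count A x - lattice_count A' y \<le> 0" by simp
    qed
  qed (rule Hi)
  finally show "lattice_count A x \<le> (\<integral>y. ?K (y - x) * lattice_count A' y \<partial>cell_measure) + 2 * B / (real N * \<epsilon>\<^sup>2)"
    unfolding HI by simp
  have "(\<integral>y. ?K (y - x) * lattice_count A y \<partial>cell_measure) - lattice_count A' x
      = (\<integral>y. ?K (y - x) * (lattice_count A y - lattice_count A' x) \<partial>cell_measure)"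
    using Kc[of "lattice_count A' x"] A by (simp add: right_diff_distrib)
  also have "\<dots> \<le> (\<integral>y. H y \<partial>cell_measure)"
  proof (rule integral_mono)
    show "integrable cell_measure (\<lambda>y. ?K (y - x) * (lattice_count A y - lattice_count A' x))"
      using Kc[of "lattice_count A' x"] A by (simp add: right_diff_distrib)
    fix y assume y: "y \<in> space cell_measure"
    show "?K (y - x) * (lattice_count A y - lattice_count A' x) \<le> H y"
      unfolding H_def
    proof (rule fejer_concentration[OF N e B0])
      show "lattice_count A y - lattice_count A' x \<le> B" using B[of y] y c0[of A' x] by simp
      fix j assume j: "\<bar>fst (y - x - lattice_point j)\<bar> \<le> \<epsilon>" "\<bar>snd (y - x - lattice_point j)\<bar> \<le> \<epsilon>"
      have "x - y - lattice_point (- j) = - (y - x - lattice_point j)"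
        using lattice_point_simps(2)[of 0 j] by (simp add: lattice_point_def zero_prod_def)
      then have "\<bar>fst (x - y - lattice_point (- j))\<bar> \<le> \<epsilon>" "\<bar>snd (x - y - lattice_point (- j))\<bar> \<le> \<epsilon>"
        using j by (simp_all only: fst_uminus snd_uminus abs_minus_cancel)
      then have "lattice_count A y \<le> lattice_count A' x"
        by (intro lattice_count_translate[OF bd(2)] nb)
      then show "lattice_count A y - lattice_count A' x \<le> 0" by simp
    qed
  qed (rule Hi)
  finally show "(\<integral>y. ?K (y - x) * lattice_count A y \<partial>cell_measure) - 2 * B / (real N * \<epsilon>\<^sup>2) \<le> lattice_count A' x"
    unfolding HI by simp
qed

text \<open>Convolution with the kernel multiplies each Fourier coefficient of the count by a weight between \<open>0\<close>
and \<open>1\<close> and removes those outside the box of size \<open>N\<close>. The coefficient at \<open>0\<close> is cancelled by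
the area.\<close>
lemma smoothed_discrepancy_L4:
  fixes A :: "(real \<times> real) set"
  assumes op: "open A" and bd: "bounded A" and cv: "convex A" and ne: "A \<noteq> {}"
    and qs: "quadratically_supported M A" and M: "M \<ge> 0" and N: "N \<ge> 1"
  defines "P \<equiv> \<lambda>x. (\<integral>y. fejer (frequency_box N) (y - x) * lattice_count A y \<partial>cell_measure) - measure lborel A"
  shows "integrable cell_measure (\<lambda>x. P x ^ 4)"
    and "(\<integral>x. P x ^ 4 \<partial>cell_measure) \<le> (768 * M)\<^sup>2 * (13 + 12 * ln (real (2 * N)))"
proof -
  let ?J = "frequency_box N"
  have Ab: "A \<in> sets borel" using op by simp
  have finJ: "finite ?J" by simp
  define D where "D = (\<lambda>n. (\<integral>y. (lattice_count A y - measure lborel A) *\<^sub>R lattice_char n y \<partial>cell_measure))"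
  obtain K where K: "A \<subseteq> cball 0 K" using bd bounded_any_center[of A 0] by (auto simp: subset_iff)
  have K': "A \<subseteq> cball 0 (max 0 K)" using K by auto
  have lm [measurable]: "lattice_count A \<in> borel_measurable cell_measure" using bd Ab by (rule lattice_count_measurable)
  have lmc [measurable]: "lattice_char n \<in> borel_measurable cell_measure" for n
    by (rule measurable_cell_measure) simp
  have cb: "\<bar>lattice_count A y\<bar> \<le> (2 * max 0 K + 4)\<^sup>2" if "y \<in> unit_cell" for y
    using lattice_count_bound[OF K', of y] unit_cell_subset that by (auto simp: lattice_count_def)
  have int1: "integrable cell_measure (\<lambda>y. lattice_count A y *\<^sub>R lattice_char n y)" for n
    by (rule integrable_cell_bounded[where B="(2 * max 0 K + 4)\<^sup>2"]) (use cb in auto)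
  have int2: "integrable cell_measure (\<lambda>y. c *\<^sub>R lattice_char n y)" for n and c :: real
    by (rule integrable_cell_bounded[where B="\<bar>c\<bar>"]) auto
  have Deq: "D n = (\<integral>z. indicator A z *\<^sub>R lattice_char n z \<partial>lborel) - (if n = 0 then of_real (measure lborel A) else 0)" for n
    unfolding D_def scaleR_left_diff_distrib
    using int1 int2 lattice_count_fourier_coefficient[OF bd Ab, of n] integral_lattice_char[of n]
    by (simp add: scaleR_conv_of_real)
  have finA: "emeasure lborel A < \<infinity>" using bd by (rule emeasure_bounded_finite)
  have D0: "D 0 = 0"
    unfolding Deq using Ab finA by (simp add: scaleR_conv_of_real)
  have Dn: "norm (D n) \<le> 2 * sqrt M * decay (lattice_norm n)" for n
  proof (cases "n = 0")
    case False
    then show ?thesis unfolding Deq using convex_fourier_decay[OF op bd cv ne qs M False] by simp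
  qed (simp add: D0 M decay_nonneg)
  define Q where "Q = (\<lambda>(j, l). l - j) ` (?J \<times> ?J)"
  \<comment> \<open>The weight of the frequency \<open>n\<close>: the fraction of the box that stays in the box when shifted by \<open>n\<close>.\<close>
  define wt where "wt = (\<lambda>n. real (card {z \<in> ?J \<times> ?J. snd z - fst z = n}) / real (card ?J))"
  define a where "a = (\<lambda>n. of_real (wt n) * D (- n))"
  have cJ: "card ?J > 0" using N by (simp add: card_gt_0_iff)
  have Px: "complex_of_real (P x) = (\<Sum>n\<in>Q. a n * lattice_char n x)" for x
  proof -
    have "P x = (\<integral>y. fejer ?J (y - x) * lattice_count A y \<partial>cell_measure) - (\<integral>y. fejer ?J (y - x) * measure lborel A \<partial>cell_measure)"
      using fejer_integral[OF finJ, of x] fejer_integrable[of ?J x] cJ by (auto simp: P_def card_gt_0_iff)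
    also have "\<dots> = (\<integral>y. fejer ?J (y - x) * (lattice_count A y - measure lborel A) \<partial>cell_measure)"
      using fejer_integrable[of ?J x] lattice_count_fejer_integrable[OF bd Ab, of ?J x]
      by (simp add: right_diff_distrib)
    finally have "complex_of_real (P x) = (\<integral>y. complex_of_real (fejer ?J (y - x) * (lattice_count A y - measure lborel A)) \<partial>cell_measure)"
      by (simp only: integral_complex_of_real)
    also have "\<dots> = (\<integral>y. (\<Sum>z\<in>?J \<times> ?J. lattice_char (snd z - fst z) x / of_nat (card ?J) *
          ((lattice_count A y - measure lborel A) *\<^sub>R lattice_char (fst z - snd z) y)) \<partial>cell_measure)"
      unfolding of_real_mult fejer_expand[OF finJ]
      by (intro Bochner_Integration.integral_cong refl)
         (simp add: sum_divide_distrib sum_distrib_left sum_distrib_right case_prod_beta scaleR_conv_of_real mult_ac del: of_real_diff)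
    also have "\<dots> = (\<Sum>z\<in>?J \<times> ?J. lattice_char (snd z - fst z) x / of_nat (card ?J) * D (fst z - snd z))"
    proof -
      have "integrable cell_measure (\<lambda>y. (lattice_count A y - measure lborel A) *\<^sub>R lattice_char n y)" for n
        unfolding scaleR_left_diff_distrib using int1 int2 by (intro Bochner_Integration.integrable_diff)
      then show ?thesis unfolding D_def
        by (subst Bochner_Integration.integral_sum) (simp_all only: integrable_mult_right integral_mult_right_zero)
    qed
    also have "\<dots> = (\<Sum>n\<in>Q. \<Sum>z\<in>{z \<in> ?J \<times> ?J. snd z - fst z = n}. lattice_char (snd z - fst z) x / of_nat (card ?J) * D (fst z - snd z))"
      by (rule sum.group[symmetric]) (auto simp: Q_def case_prod_beta)
    also have "\<dots> = (\<Sum>n\<in>Q. a n * lattice_char n x)"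
    proof (rule sum.cong[OF refl])
      fix n
      have "(\<Sum>z\<in>{z \<in> ?J \<times> ?J. snd z - fst z = n}. lattice_char (snd z - fst z) x / of_nat (card ?J) * D (fst z - snd z)) =
          (\<Sum>z\<in>{z \<in> ?J \<times> ?J. snd z - fst z = n}. lattice_char n x / of_nat (card ?J) * D (- n))"
      proof (rule sum.cong[OF refl])
        fix z assume "z \<in> {z \<in> ?J \<times> ?J. snd z - fst z = n}"
        then have "snd z - fst z = n" by simp
        moreover from this have "fst z - snd z = - n" by (metis minus_diff_eq)
        ultimately show "lattice_char (snd z - fst z) x / of_nat (card ?J) * D (fst z - snd z) = lattice_char n x / of_nat (card ?J) * D (- n)"
          by simp
      qed
      also have "\<dots> = a n * lattice_char n x" by (simp add: a_def wt_def)
      finally show "(\<Sum>z\<in>{z \<in> ?J \<times> ?J. snd z - fst z = n}. lattice_char (snd z - fst z) x / of_nat (card ?J) * D (fst z - snd z)) = a n * lattice_char n x" .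
    qed
    finally show ?thesis .
  qed
  have w1: "wt n \<le> 1" "wt n \<ge> 0" for n
  proof -
    have "card {z \<in> ?J \<times> ?J. snd z - fst z = n} \<le> card ?J"
      by (rule card_inj_on_le[where f=fst]) (auto simp: inj_on_def algebra_simps)
    then show "wt n \<le> 1" using cJ unfolding wt_def
      by (intro divide_le_eq_1_pos[THEN iffD2]) (simp_all only: of_nat_le_iff of_nat_0_less_iff)
    show "wt n \<ge> 0" by (simp add: wt_def)
  qed
  have an: "norm (a n) \<le> 2 * sqrt M * decay (lattice_norm n)" for n
  proof -
    have "norm (a n) = wt n * norm (D (- n))" using w1 by (simp add: a_def norm_mult)
    also have "\<dots> \<le> 1 * norm (D (- n))" using w1 by (intro mult_right_mono) auto
    also have "\<dots> \<le> 2 * sqrt M * decay (lattice_norm n)" using Dn[of "- n"] by (simp add: lattice_norm_minus)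
    finally show ?thesis .
  qed
  have P4: "P x ^ 4 = (norm (\<Sum>n\<in>Q. a n * lattice_char n x)) ^ 4" for x
    unfolding Px[symmetric] by simp
  have finQ: "finite Q" by (simp add: Q_def)
  have "(\<integral>x. P x ^ 4 \<partial>cell_measure) \<le> (192 * (2 * sqrt M)\<^sup>2)\<^sup>2 * (13 + 12 * ln (real (2 * N)))"
    unfolding P4
  proof (rule trigonometric_polynomial_L4_le[OF finQ _ N])
    show "a 0 = 0" by (simp add: a_def D0)
    fix n assume "n \<in> Q"
    then show "lattice_norm n \<le> N" by (auto simp: Q_def lattice_norm_def)
  qed (rule an)
  then show "(\<integral>x. P x ^ 4 \<partial>cell_measure) \<le> (768 * M)\<^sup>2 * (13 + 12 * ln (real (2 * N)))"
    using M by (simp add: power_mult_distrib)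
  show "integrable cell_measure (\<lambda>x. P x ^ 4)"
    unfolding P4
  proof (rule integrable_cell_bounded[where B="(\<Sum>n\<in>Q. norm (a n)) ^ 4"])
    fix x
    have "norm (\<Sum>n\<in>Q. a n * lattice_char n x) \<le> (\<Sum>n\<in>Q. norm (a n))"
      using norm_sum[of "\<lambda>n. a n * lattice_char n x" Q] by (simp add: norm_mult)
    then show "norm ((norm (\<Sum>n\<in>Q. a n * lattice_char n x)) ^ 4) \<le> (\<Sum>n\<in>Q. norm (a n)) ^ 4"
      by (simp add: power_mono)
  qed measurable
qed

section \<open>The fourth moment of the discrepancy\<close>

text \<open>Dividing by \<open>S + \<delta>\<close> exhibits the point as a convex combination of \<open>z\<close> and of \<open>c + v / \<delta>\<close>, which lies in
the ball around \<open>c\<close>.\<close>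
lemma convex_dilate_thickening:
  fixes W :: "'a::real_normed_vector set"
  assumes cv: "convex W" and ball: "ball c \<rho> \<subseteq> W" and S: "S > 0" and d: "\<delta> > 0"
    and z: "z \<in> W" and v: "norm v < \<rho> * \<delta>"
  shows "S *\<^sub>R z + \<delta> *\<^sub>R c + v \<in> (\<lambda>x. (S + \<delta>) *\<^sub>R x) ` W"
proof -
  define y where "y = c + (1 / \<delta>) *\<^sub>R v"
  have "norm ((1 / \<delta>) *\<^sub>R v) < \<rho>" using v d by (simp add: field_simps)
  then have y: "y \<in> W" using ball by (auto simp: y_def dist_norm subset_iff)
  have "(S / (S + \<delta>)) *\<^sub>R z + (\<delta> / (S + \<delta>)) *\<^sub>R y \<in> W"
    using S d by (intro convexD[OF cv z y]) (auto simp: add_divide_distrib[symmetric])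
  moreover have "S *\<^sub>R z + \<delta> *\<^sub>R c + v = (S + \<delta>) *\<^sub>R ((S / (S + \<delta>)) *\<^sub>R z + (\<delta> / (S + \<delta>)) *\<^sub>R y)"
    using S d by (simp add: y_def scaleR_add_right add.assoc)
  ultimately show ?thesis by blast
qed

lemma three_term_sum_fourth_power_le:
  fixes a b c :: real
  shows "(a + b + c) ^ 4 \<le> 64 * (a ^ 4 + b ^ 4 + c ^ 4)"
proof -
  have two: "(x + y) ^ 4 \<le> 8 * (x ^ 4 + y ^ 4)" for x y :: real
  proof -
    have sq: "(x + y)\<^sup>2 \<le> 2 * (x\<^sup>2 + y\<^sup>2)" for x y :: real
      using zero_le_power2[of "x - y"] by (simp add: power2_eq_square algebra_simps)
    have "((x + y)\<^sup>2)\<^sup>2 \<le> (2 * (x\<^sup>2 + y\<^sup>2))\<^sup>2" by (rule power_mono[OF sq]) simp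
    also have "\<dots> = 4 * (x\<^sup>2 + y\<^sup>2)\<^sup>2" by (simp only: power_mult_distrib) simp
    also have "\<dots> \<le> 4 * (2 * ((x\<^sup>2)\<^sup>2 + (y\<^sup>2)\<^sup>2))" using sq[of "x\<^sup>2" "y\<^sup>2"] by simp
    finally show ?thesis by simp
  qed
  have "(a + b + c) ^ 4 \<le> 8 * ((a + b) ^ 4 + c ^ 4)" by (rule two)
  also have "\<dots> \<le> 8 * (8 * (a ^ 4 + b ^ 4) + 8 * c ^ 4)"
    using two[of a b] zero_le_power_eq[of c 4] by (intro mult_left_mono add_mono) auto
  finally show ?thesis by (simp add: algebra_simps)
qed

text \<open>The set is compared with the dilates by \<open>R + 1/R\<close> and \<open>R - 1/R\<close>, translated so that the
interior point \<open>c\<close> is the centre of the dilation. Their areas differ from the area of the dilate by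
\<open>R\<close> by \<open>O(1)\<close>, and they leave room for a neighbourhood of radius \<open>\<epsilon>\<close> comparable to \<open>1 / R\<close>. Since the
counts are \<open>O(R\<^sup>2)\<close>, a kernel of degree \<open>N\<close> about \<open>R ^ 4\<close> brings the smoothing error down to \<open>O(1)\<close>, and
\<open>ln N\<close> is still \<open>O(ln R)\<close>.\<close>
lemma planar_discrepancy_fourth_moment:
  fixes W :: "(real \<times> real) set"
  assumes op: "open W" and bd: "bounded W" and cv: "convex W" and ne: "W \<noteq> {}"
    and qs: "quadratically_supported M W" and M: "M \<ge> 0"
  shows "\<exists>C>0. \<forall>R\<ge>3.
    (\<integral>x. (lattice_count ((\<lambda>z. R *\<^sub>R z) ` W) x - R\<^sup>2 * measure lborel W) ^ 4 \<partial>cell_measure) \<le> C * R\<^sup>2 * ln R"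
proof -
  obtain c where c: "c \<in> W" using ne by blast
  obtain \<rho> where \<rho>: "\<rho> > 0" "ball c \<rho> \<subseteq> W" using op c open_contains_ball by blast
  obtain K0 where "W \<subseteq> cball 0 K0" using bd bounded_any_center[of W 0] by (auto simp: subset_iff)
  then obtain K where K: "K \<ge> 1" "\<And>z. z \<in> W \<Longrightarrow> norm z \<le> K"
    by (metis (no_types) max.cobounded1 max.cobounded2 mem_cball_0 order_trans subset_iff)
  define \<mu> where "\<mu> = measure lborel W"
  have \<mu>: "\<mu> \<ge> 0" by (simp add: \<mu>_def)
  define dil where "dil = (\<lambda>s v. (\<lambda>z. s *\<^sub>R z + v) ` W)"
  have dil: "open (dil s v)" "bounded (dil s v)" "convex (dil s v)" "dil s v \<noteq> {}"
    "quadratically_supported (s * M) (dil s v)" "measure lborel (dil s v) = s\<^sup>2 * \<mu>" "dil s v \<in> sets borel"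
    if s: "s > 0" for s v
  proof -
    have e: "dil s v = (\<lambda>z. v + s *\<^sub>R z) ` W" by (simp add: dil_def add.commute)
    show o: "open (dil s v)" unfolding e using op s by (intro open_affinity) auto
    show "bounded (dil s v)"
      using bounded_translation[OF bounded_scaling[OF bd, of s], of v] by (simp add: e image_image)
    show "convex (dil s v)" unfolding e by (rule convex_affinity[OF cv])
    show "dil s v \<noteq> {}" using ne by (simp add: dil_def)
    show "quadratically_supported (s * M) (dil s v)"
      unfolding dil_def by (rule quadratically_supported_affine[OF qs s])
    show b: "dil s v \<in> sets borel" using o by simp
    have "measure lebesgue (dil s v) = \<bar>s\<bar> ^ DIM(real \<times> real) * measure lebesgue W"
      unfolding dil_def by (rule measure_lebesgue_affine)
    then show "measure lborel (dil s v) = s\<^sup>2 * \<mu>" using b op s by (simp add: \<mu>_def power2_eq_square)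
  qed
  define E where "E = 3 * \<mu> + 3200 * K\<^sup>2 / \<rho>\<^sup>2"
  have E: "E \<ge> 0" using \<mu> by (simp add: E_def)
  define C where "C = 64 * (2 * (1536 * M)\<^sup>2 * 85 + E ^ 4) + 1"
  have "(\<integral>x. (lattice_count ((\<lambda>z. R *\<^sub>R z) ` W) x - R\<^sup>2 * \<mu>) ^ 4 \<partial>cell_measure) \<le> C * R\<^sup>2 * ln R"
    if R: "R \<ge> 3" for R
  proof -
    define \<delta> where "\<delta> = 1 / R"
    \<comment> \<open>A square of half side \<open>\<epsilon>\<close> fits into the ball of radius \<open>\<rho> * \<delta>\<close>.\<close>
    define \<epsilon> where "\<epsilon> = \<rho> / (4 * R)"
    define N where "N = nat \<lceil>R ^ 4\<rceil>"
    define A where "A = dil R 0"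
    define A1 where "A1 = dil (R + \<delta>) (- (\<delta> *\<^sub>R c))"
    define A2 where "A2 = dil (R - \<delta>) (\<delta> *\<^sub>R c)"
    have \<delta>: "\<delta> > 0" "\<delta> \<le> 1" "R * \<delta> = 1" using R by (auto simp: \<delta>_def)
    have Rd: "R + \<delta> > 0" "R - \<delta> > 0" "R > 0" using R \<delta> by auto
    have \<epsilon>: "\<epsilon> > 0" using \<rho> R by (simp add: \<epsilon>_def)
    have lnR: "ln R \<ge> 1"
    proof -
      have "exp 1 \<le> R" using R exp_le by linarith
      then show ?thesis using Rd(3) by (subst ln_ge_iff) auto
    qed
    have R4: "R ^ 4 \<ge> 1" using R by (intro one_le_power) auto
    have NR: "R ^ 4 \<le> real N" "real N \<le> R ^ 4 + 1" unfolding N_def using R4 by linarith+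
    have N1: "N \<ge> 1" using NR R4 by linarith
    have near: "norm v < \<rho> * \<delta>" if "\<bar>fst v\<bar> \<le> \<epsilon>" "\<bar>snd v\<bar> \<le> \<epsilon>" for v :: "real \<times> real"
    proof -
      have "norm v \<le> \<bar>fst v\<bar> + \<bar>snd v\<bar>"
        using norm_Pair_le[of "fst v" "snd v"] by simp
      also have "\<dots> \<le> \<rho> / R / 2" using that by (simp add: \<epsilon>_def)
      also have "\<dots> < \<rho> * \<delta>" using \<rho> R by (simp add: \<delta>_def field_simps)
      finally show ?thesis .
    qed
    have nbA: "z + v \<in> A1" if z: "z \<in> A" and v: "\<bar>fst v\<bar> \<le> \<epsilon>" "\<bar>snd v\<bar> \<le> \<epsilon>" for z v
    proof -
      obtain y where y: "y \<in> W" "z = R *\<^sub>R y" using z by (auto simp: A_def dil_def)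
      have "R *\<^sub>R y + \<delta> *\<^sub>R c + v \<in> (\<lambda>x. (R + \<delta>) *\<^sub>R x) ` W"
        by (rule convex_dilate_thickening[OF cv \<rho>(2) Rd(3) \<delta>(1) y(1) near[OF v]])
      then obtain x where "x \<in> W" "R *\<^sub>R y + \<delta> *\<^sub>R c + v = (R + \<delta>) *\<^sub>R x" by blast
      moreover from this have "z + v = (R + \<delta>) *\<^sub>R x + - (\<delta> *\<^sub>R c)"
        unfolding y by (metis (no_types, opaque_lifting) add.assoc add.commute add_diff_cancel_left' diff_conv_add_uminus)
      ultimately show ?thesis unfolding A1_def dil_def by blast
    qed
    have nbA2: "z + v \<in> A" if z: "z \<in> A2" and v: "\<bar>fst v\<bar> \<le> \<epsilon>" "\<bar>snd v\<bar> \<le> \<epsilon>" for z v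
    proof -
      obtain y where y: "y \<in> W" "z = (R - \<delta>) *\<^sub>R y + \<delta> *\<^sub>R c" using z by (auto simp: A2_def dil_def)
      have "(R - \<delta>) *\<^sub>R y + \<delta> *\<^sub>R c + v \<in> (\<lambda>x. (R - \<delta> + \<delta>) *\<^sub>R x) ` W"
        by (rule convex_dilate_thickening[OF cv \<rho>(2) Rd(2) \<delta>(1) y(1) near[OF v]])
      then show ?thesis unfolding A_def dil_def y by simp
    qed
    have A: "open A" "bounded A" "convex A" "A \<noteq> {}" "quadratically_supported (R * M) A" "measure lborel A = R\<^sup>2 * \<mu>" "A \<in> sets borel"
      unfolding A_def using dil[OF Rd(3)] by auto
    have A1: "open A1" "bounded A1" "convex A1" "A1 \<noteq> {}" "quadratically_supported ((R + \<delta>) * M) A1" "measure lborel A1 = (R + \<delta>)\<^sup>2 * \<mu>" "A1 \<in> sets borel"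
      unfolding A1_def using dil[OF Rd(1)] by auto
    have A2: "open A2" "bounded A2" "convex A2" "A2 \<noteq> {}" "quadratically_supported ((R - \<delta>) * M) A2" "measure lborel A2 = (R - \<delta>)\<^sup>2 * \<mu>" "A2 \<in> sets borel"
      unfolding A2_def using dil[OF Rd(2)] by auto
    define B where "B = 100 * K\<^sup>2 * R\<^sup>2"
    have cb: "lattice_count S y \<le> B" if S: "S \<subseteq> cball 0 (R * K + K)" and y: "y \<in> unit_cell" for S y
    proof -
      have RK: "R * K \<ge> 3" "K \<le> R * K" using R K mult_mono[of 3 R 1 K] mult_right_mono[of 1 R K] by auto
      have "lattice_count S y \<le> (2 * (R * K + K) + 4)\<^sup>2"
        using unit_cell_subset y RK K by (intro lattice_count_bound[OF S]) auto
      also have "\<dots> \<le> (10 * (R * K))\<^sup>2"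
      proof (rule power_mono)
        show "2 * (R * K + K) + 4 \<le> 10 * (R * K)" using RK by argo
        show "0 \<le> 2 * (R * K + K) + 4" using RK K(1) by argo
      qed
      also have "\<dots> = B" by (simp add: B_def power_mult_distrib mult_ac)
      finally show ?thesis .
    qed
    have AK: "A \<subseteq> cball 0 (R * K + K)"
    proof
      fix z assume "z \<in> A"
      then obtain y where y: "y \<in> W" "z = R *\<^sub>R y" by (auto simp: A_def dil_def)
      have "R * norm y \<le> R * K" using K(2)[OF y(1)] R by (intro mult_left_mono) auto
      then have "R * norm y \<le> R * K + K" using K(1) by linarith
      then show "z \<in> cball 0 (R * K + K)" using R by (simp add: y)
    qed
    have A2K: "A2 \<subseteq> cball 0 (R * K + K)"
    proof
      fix z assume "z \<in> A2"
      then obtain y where y: "y \<in> W" "z = (R - \<delta>) *\<^sub>R y + \<delta> *\<^sub>R c" by (auto simp: A2_def dil_def)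
      have "norm z \<le> (R - \<delta>) * norm y + \<delta> * norm c"
        using norm_triangle_ineq[of "(R - \<delta>) *\<^sub>R y" "\<delta> *\<^sub>R c"] Rd \<delta> by (simp add: y)
      also have "\<dots> \<le> R * K + 1 * K" using K(2)[OF y(1)] K(2)[OF c] Rd \<delta> R K(1) by (intro add_mono mult_mono) auto
      finally show "z \<in> cball 0 (R * K + K)" by simp
    qed
    have err: "2 * B / (real N * \<epsilon>\<^sup>2) \<le> 3200 * K\<^sup>2 / \<rho>\<^sup>2"
    proof -
      have "2 * B / (real N * \<epsilon>\<^sup>2) \<le> 2 * B / (R ^ 4 * \<epsilon>\<^sup>2)"
        using NR N1 R \<epsilon> by (intro divide_left_mono mult_right_mono mult_pos_pos) (auto simp: B_def)
      also have "\<dots> = 3200 * K\<^sup>2 / \<rho>\<^sup>2"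
        using R \<rho> by (simp add: B_def \<epsilon>_def power2_eq_square power4_eq_xxxx field_simps)
      finally show ?thesis .
    qed
    let ?F = "\<lambda>x y. fejer (frequency_box N) (y - x)"
    define P where "P = (\<lambda>S x. (\<integral>y. ?F x y * lattice_count S y \<partial>cell_measure) - measure lborel S)"
    have ar1: "measure lborel A1 - R\<^sup>2 * \<mu> \<le> 3 * \<mu>"
    proof -
      have "(R + \<delta>)\<^sup>2 - R\<^sup>2 = 2 * (R * \<delta>) + \<delta>\<^sup>2" by (simp add: power2_eq_square algebra_simps)
      also have "\<dots> \<le> 3" using \<delta> power_le_one[of \<delta> 2] by simp
      finally have "((R + \<delta>)\<^sup>2 - R\<^sup>2) * \<mu> \<le> 3 * \<mu>" using \<mu> by (rule mult_right_mono)
      then show ?thesis unfolding A1(6) by (simp add: left_diff_distrib)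
    qed
    have ar2: "R\<^sup>2 * \<mu> - measure lborel A2 \<le> 3 * \<mu>"
    proof -
      have "R\<^sup>2 - (R - \<delta>)\<^sup>2 = 2 * (R * \<delta>) - \<delta>\<^sup>2" by (simp add: power2_eq_square algebra_simps)
      also have "\<dots> \<le> 3" using \<delta>(3) zero_le_power2[of \<delta>] by argo
      finally have "(R\<^sup>2 - (R - \<delta>)\<^sup>2) * \<mu> \<le> 3 * \<mu>" using \<mu> by (rule mult_right_mono)
      then show ?thesis unfolding A2(6) by (simp add: left_diff_distrib)
    qed
    define D where "D = (\<lambda>x. lattice_count A x - R\<^sup>2 * \<mu>)"
    have Dle: "D x ^ 4 \<le> 64 * (P A1 x ^ 4 + P A2 x ^ 4 + E ^ 4)" if x: "x \<in> unit_cell" for x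
    proof -
      have "lattice_count A x \<le> (\<integral>y. ?F x y * lattice_count A1 y \<partial>cell_measure) + 2 * B / (real N * \<epsilon>\<^sup>2)"
        by (rule smoothing_comparison(1)[OF A(2) A1(2) A(7) A1(7) nbA \<epsilon> N1 cb[OF AK] x])
      then have up: "D x \<le> P A1 x + E" using err ar1 by (simp add: D_def P_def E_def)
      have "(\<integral>y. ?F x y * lattice_count A2 y \<partial>cell_measure) - 2 * B / (real N * \<epsilon>\<^sup>2) \<le> lattice_count A x"
        by (rule smoothing_comparison(2)[OF A2(2) A(2) A2(7) A(7) nbA2 \<epsilon> N1 cb[OF A2K] x])
      then have "P A2 x - E \<le> D x" using err ar2 by (simp add: D_def P_def E_def)
      with up have "\<bar>D x\<bar> \<le> \<bar>P A1 x\<bar> + \<bar>P A2 x\<bar> + E" by linarith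
      then have "\<bar>D x\<bar> ^ 4 \<le> (\<bar>P A1 x\<bar> + \<bar>P A2 x\<bar> + E) ^ 4" by (intro power_mono) auto
      also have "\<dots> \<le> 64 * (\<bar>P A1 x\<bar> ^ 4 + \<bar>P A2 x\<bar> ^ 4 + E ^ 4)" by (rule three_term_sum_fourth_power_le)
      finally show ?thesis by simp
    qed
    have P4: "integrable cell_measure (\<lambda>x. P S x ^ 4)" "(\<integral>x. P S x ^ 4 \<partial>cell_measure) \<le> (1536 * M * R)\<^sup>2 * (85 * ln R)"
      if S: "open S" "bounded S" "convex S" "S \<noteq> {}" and q: "quadratically_supported (s * M) S" and s: "0 < s" "s \<le> 2 * R" for S s
    proof -
      have sM: "s * M \<ge> 0" using s M by simp
      note L4 = smoothed_discrepancy_L4[OF S q sM N1]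
      show "integrable cell_measure (\<lambda>x. P S x ^ 4)" unfolding P_def by (rule L4(1))
      have "real (2 * N) \<le> 4 * R ^ 4" using NR R4 by simp
      also have "\<dots> \<le> R ^ 2 * R ^ 4" using R power_mono[of 3 R 2] by (intro mult_right_mono) auto
      also have "\<dots> = R ^ 6" by (simp add: power_add[symmetric])
      finally have "ln (real (2 * N)) \<le> ln (R ^ 6)" using N1 Rd by (subst ln_le_cancel_iff) auto
      also have "\<dots> = 6 * ln R" using Rd by (simp add: ln_realpow)
      finally have ln2: "13 + 12 * ln (real (2 * N)) \<le> 85 * ln R" using lnR by simp
      have "(768 * (s * M))\<^sup>2 \<le> (1536 * M * R)\<^sup>2"
        using s M mult_right_mono[OF s(2) M] by (intro power_mono) (auto simp: mult_ac)
      then have "(768 * (s * M))\<^sup>2 * (13 + 12 * ln (real (2 * N))) \<le> (1536 * M * R)\<^sup>2 * (85 * ln R)"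
        using ln2 N1 by (intro mult_mono) auto
      with L4(2) show "(\<integral>x. P S x ^ 4 \<partial>cell_measure) \<le> (1536 * M * R)\<^sup>2 * (85 * ln R)"
        unfolding P_def by (rule order_trans)
    qed
    have i1: "integrable cell_measure (\<lambda>x. P A1 x ^ 4)" "(\<integral>x. P A1 x ^ 4 \<partial>cell_measure) \<le> (1536 * M * R)\<^sup>2 * (85 * ln R)"
      using P4[OF A1(1-5)] Rd \<delta> R by auto
    have i2: "integrable cell_measure (\<lambda>x. P A2 x ^ 4)" "(\<integral>x. P A2 x ^ 4 \<partial>cell_measure) \<le> (1536 * M * R)\<^sup>2 * (85 * ln R)"
      using P4[OF A2(1-5)] Rd \<delta> R by auto
    have "(\<integral>x. D x ^ 4 \<partial>cell_measure) \<le> (\<integral>x. 64 * (P A1 x ^ 4 + P A2 x ^ 4 + E ^ 4) \<partial>cell_measure)"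
    proof (rule integral_mono_AE')
      show "integrable cell_measure (\<lambda>x. 64 * (P A1 x ^ 4 + P A2 x ^ 4 + E ^ 4))"
        using i1(1) i2(1) by simp
      show "AE x in cell_measure. D x ^ 4 \<le> 64 * (P A1 x ^ 4 + P A2 x ^ 4 + E ^ 4)"
        using Dle by (intro AE_I2) simp
      show "AE x in cell_measure. 0 \<le> 64 * (P A1 x ^ 4 + P A2 x ^ 4 + E ^ 4)"
        by (intro AE_I2 mult_nonneg_nonneg add_nonneg_nonneg) auto
    qed
    also have "\<dots> = 64 * ((\<integral>x. P A1 x ^ 4 \<partial>cell_measure) + (\<integral>x. P A2 x ^ 4 \<partial>cell_measure) + E ^ 4)"
      using i1(1) i2(1) by simp
    also have "\<dots> \<le> 64 * ((1536 * M * R)\<^sup>2 * (85 * ln R) + (1536 * M * R)\<^sup>2 * (85 * ln R) + E ^ 4 * (R\<^sup>2 * ln R))"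
    proof (intro mult_left_mono add_mono i1 i2)
      have "1 * 1 \<le> R\<^sup>2 * ln R" using lnR R by (intro mult_mono one_le_power) auto
      then show "E ^ 4 \<le> E ^ 4 * (R\<^sup>2 * ln R)" using E mult_left_mono[of 1 "R\<^sup>2 * ln R" "E ^ 4"] by simp
    qed simp
    also have "\<dots> = (C - 1) * (R\<^sup>2 * ln R)" by (simp add: C_def power_mult_distrib algebra_simps)
    also have "\<dots> \<le> C * (R\<^sup>2 * ln R)" using lnR by (intro mult_right_mono) auto
    finally show ?thesis unfolding D_def A_def dil_def by (simp add: mult.assoc)
  qed
  moreover have "C > 0" using E by (simp add: C_def add_nonneg_pos)
  ultimately show ?thesis unfolding \<mu>_def by blast
qed

section \<open>Transfer to the Cartesian plane\<close>

text \<open>The isometric identification of pairs with Cartesian vectors, under which Lebesgue measure on the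
plane becomes a product measure.\<close>
definition plane_vector :: "real \<times> real \<Rightarrow> real^2" where
  "plane_vector z = (\<chi> i. if i = 1 then fst z else snd z)"

lemma plane_vector_nth [simp]: "plane_vector z $ 1 = fst z" "plane_vector z $ 2 = snd z"
  by (simp_all add: plane_vector_def)

lemma plane_vector_coordinates [simp]: "plane_vector (x $ 1, x $ 2) = x"
  by (simp add: vec_eq_iff forall_2)

lemma linear_plane_vector: "linear plane_vector"
  by (rule linearI) (simp_all add: vec_eq_iff forall_2)

lemma plane_vector_inner: "plane_vector x \<bullet> plane_vector y = x \<bullet> y"
  by (simp add: inner_vec_def sum_2 inner_prod_def)

lemma surj_plane_vector: "surj plane_vector"
  by (rule surjI[of _ "\<lambda>x. (x $ 1, x $ 2)"]) simp

lemma continuous_plane_vector: "continuous_on UNIV plane_vector"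
  using linear_plane_vector by (simp add: linear_continuous_on linear_conv_bounded_linear)

lemma bounded_plane_vector_vimage:
  assumes "bounded \<Omega>"
  shows "bounded (plane_vector -` \<Omega>)"
proof -
  have "bounded ((\<lambda>x. (x $ 1, x $ 2)) ` \<Omega>)"
    by (rule bounded_linear_image[OF assms]) (intro bounded_linear_Pair bounded_linear_vec_nth)
  moreover have "(\<lambda>x. (x $ 1, x $ 2)) ` \<Omega> = plane_vector -` \<Omega>" by (force simp: image_iff)
  ultimately show ?thesis by simp
qed

lemma measurable_plane_vector [measurable]: "plane_vector \<in> borel_measurable borel"
  by (rule borel_measurable_continuous_onI[OF continuous_plane_vector])

lemma lborel_plane_vector: "distr lborel borel plane_vector = lborel"
proof (rule lborel_eqI[symmetric])
  fix l u :: "real^2" assume le: "\<And>b. b \<in> Basis \<Longrightarrow> l \<bullet> b \<le> u \<bullet> b"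
  have lu: "l $ i \<le> u $ i" for i
    using le[of "axis i 1"] by (simp add: inner_axis axis_in_Basis_iff)
  have pre: "plane_vector -` box l u = {l $ 1<..<u $ 1} \<times> {l $ 2<..<u $ 2}"
    by (auto simp: mem_box_cart forall_2)
  have "emeasure (distr lborel borel plane_vector) (box l u) = emeasure lborel (plane_vector -` box l u)"
    by (subst emeasure_distr) auto
  also have "\<dots> = emeasure lborel {l $ 1<..<u $ 1} * emeasure lborel {l $ 2<..<u $ 2}"
    unfolding pre lborel_prod[symmetric] by (rule lborel.emeasure_pair_measure_Times) auto
  also have "\<dots> = ennreal ((u $ 1 - l $ 1) * (u $ 2 - l $ 2))"
    using lu by (simp add: ennreal_mult)
  also have "(u $ 1 - l $ 1) * (u $ 2 - l $ 2) = (\<Prod>b\<in>Basis. (u - l) \<bullet> b)"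
  proof -
    have "(Basis :: (real^2) set) = (\<lambda>i. axis i 1) ` UNIV" by (auto simp: Basis_vec_def)
    then have "(\<Prod>b\<in>Basis. (u - l) \<bullet> b) = (\<Prod>b\<in>(\<lambda>i. axis i 1) ` UNIV. (u - l) \<bullet> b)" by simp
    also have "\<dots> = (\<Prod>i\<in>UNIV. (u - l) \<bullet> axis i 1)"
      by (subst prod.reindex) (auto simp: inj_on_def axis_eq_axis)
    finally have "(\<Prod>b\<in>Basis. (u - l) \<bullet> b) = (\<Prod>i\<in>UNIV. (u - l) \<bullet> axis i 1)" .
    then show ?thesis by (simp add: UNIV_2 inner_axis)
  qed
  finally show "emeasure (distr lborel borel plane_vector) (box l u) = ennreal (\<Prod>b\<in>Basis. (u - l) \<bullet> b)" .
qed simp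

lemma discrepancy_eq_lattice_count:
  fixes \<Omega> :: "(real^2) set"
  assumes op: "open \<Omega>" and bd: "bounded \<Omega>" and R: "R > 0"
  defines "W \<equiv> plane_vector -` \<Omega>"
  shows "discrepancy \<Omega> (plane_vector z) R = lattice_count ((\<lambda>z. R *\<^sub>R z) ` W) z - R\<^sup>2 * measure lborel W"
proof -
  define S where "S = {k. lattice_point k + z \<in> (\<lambda>z. R *\<^sub>R z) ` W}"
  note lin = linear_plane_vector
  have inj: "inj plane_vector"
    by (rule injI) (metis plane_vector_nth prod_eqI)
  have bW: "bounded W" unfolding W_def by (rule bounded_plane_vector_vimage[OF bd])
  have finS: "finite S" unfolding S_def by (rule finite_lattice_points[OF bounded_scaling[OF bW]])
  have mem: "plane_vector (lattice_point k) \<in> dilate_shift \<Omega> (plane_vector z) R \<longleftrightarrow> k \<in> S" for k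
  proof -
    have "(1 / R) *\<^sub>R (plane_vector (lattice_point k) + plane_vector z) = plane_vector ((1 / R) *\<^sub>R (lattice_point k + z))"
      using lin by (simp add: linear_add linear_scale)
    then have "plane_vector (lattice_point k) \<in> dilate_shift \<Omega> (plane_vector z) R \<longleftrightarrow> (1 / R) *\<^sub>R (lattice_point k + z) \<in> W"
      by (simp add: dilate_shift_def W_def)
    also have "\<dots> \<longleftrightarrow> lattice_point k + z \<in> (\<lambda>z. R *\<^sub>R z) ` W"
      using R by (force simp: image_iff)
    finally show ?thesis by (simp add: S_def)
  qed
  have lat: "integer_lattice = plane_vector ` range lattice_point"
  proof (intro equalityI subsetI)
    fix x assume "x \<in> integer_lattice"
    then obtain a b where "x $ 1 = of_int a" "x $ 2 = of_int b"
      unfolding integer_lattice_def by (auto elim!: Ints_cases simp: forall_2)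
    then have "x = plane_vector (lattice_point (a, b))"
      by (simp add: vec_eq_iff forall_2 lattice_point_def)
    then show "x \<in> plane_vector ` range lattice_point" by blast
  qed (auto simp: integer_lattice_def forall_2 lattice_point_def)
  have injl: "inj lattice_point" by (auto simp: inj_def lattice_point_def prod_eq_iff)
  have "(\<Sum>\<^sub>\<infinity>k\<in>integer_lattice. indicator (dilate_shift \<Omega> (plane_vector z) R) k :: real)
      = (\<Sum>\<^sub>\<infinity>k\<in>(\<lambda>k. plane_vector (lattice_point k)) ` S. 1)"
  proof (rule infsum_cong_neutral)
    fix x assume "x \<in> (\<lambda>k. plane_vector (lattice_point k)) ` S - integer_lattice"
    then show "(1::real) = 0" using lat by auto
  next
    fix x assume x: "x \<in> integer_lattice - (\<lambda>k. plane_vector (lattice_point k)) ` S"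
    then obtain k where "x = plane_vector (lattice_point k)" using lat by blast
    then show "indicator (dilate_shift \<Omega> (plane_vector z) R) x = (0::real)"
      using x mem[of k] by (auto simp: indicator_def)
  next
    fix x assume "x \<in> integer_lattice \<inter> (\<lambda>k. plane_vector (lattice_point k)) ` S"
    then show "indicator (dilate_shift \<Omega> (plane_vector z) R) x = (1::real)"
      using mem by (auto simp: indicator_def)
  qed
  also have "\<dots> = real (card S)"
  proof -
    have "inj_on (\<lambda>k. plane_vector (lattice_point k)) S"
      by (rule inj_on_subset[OF inj_compose[OF inj injl, unfolded comp_def]]) simp
    then show ?thesis using finS by (simp add: card_image)
  qed
  finally have cnt: "(\<Sum>\<^sub>\<infinity>k\<in>integer_lattice. indicator (dilate_shift \<Omega> (plane_vector z) R) k) = lattice_count ((\<lambda>z. R *\<^sub>R z) ` W) z"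
    by (simp add: lattice_count_def S_def)
  have "measure lebesgue \<Omega> = measure lborel \<Omega>" using op by simp
  also have "\<dots> = measure (distr lborel borel plane_vector) \<Omega>" by (simp add: lborel_plane_vector)
  also have "\<dots> = measure lborel W" using op unfolding W_def by (subst measure_distr) auto
  finally show ?thesis by (simp add: discrepancy_def cnt)
qed

lemma AE_closed_cell_iff: "AE z in lborel. z \<in> {0..1} \<times> {0..1} \<longleftrightarrow> z \<in> unit_cell"
proof (rule AE_I)
  let ?S = "{0..1} \<times> {0..1} :: (real \<times> real) set"
  show "{z \<in> space lborel. \<not> (z \<in> ?S \<longleftrightarrow> z \<in> unit_cell)} \<subseteq> ?S - unit_cell"
    using unit_cell_subset by auto
  have S: "?S \<in> sets borel" by (intro borel_Times) auto
  have "emeasure lborel ?S = emeasure lborel {0..1::real} * emeasure lborel {0..1::real}"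
    unfolding lborel_prod[symmetric] by (rule lborel.emeasure_pair_measure_Times) auto
  then have "emeasure lborel ?S = 1" by simp
  then show "emeasure lborel (?S - unit_cell) = 0"
    using S unit_cell_subset by (subst emeasure_Diff) (auto simp: emeasure_unit_cell)
  show "?S - unit_cell \<in> sets lborel" using S by simp
qed

text \<open>On the torus the count is a fixed finite sum of indicator functions, which gives measurability. The
torus includes its right and upper edges and thus differs from the half-open cell by a null set.\<close>
lemma discrepancy_torus_integral:
  fixes \<Omega> :: "(real^2) set"
  assumes op: "open \<Omega>" and bd: "bounded \<Omega>" and R: "R > 0"
  defines "W \<equiv> plane_vector -` \<Omega>"
  shows "Lp_integrable 4 (\<lambda>x. discrepancy \<Omega> x R)"
    and "(LINT x:torus|lebesgue. \<bar>discrepancy \<Omega> x R\<bar> powr 4) =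
      (\<integral>z. (lattice_count ((\<lambda>z. R *\<^sub>R z) ` W) z - R\<^sup>2 * measure lborel W) ^ 4 \<partial>cell_measure)"
proof -
  let ?S = "{0..1} \<times> {0..1} :: (real \<times> real) set"
  define A where "A = (\<lambda>z. R *\<^sub>R z) ` W"
  define m where "m = R\<^sup>2 * measure lborel W"
  have bA: "bounded A"
    unfolding A_def W_def by (intro bounded_scaling bounded_plane_vector_vimage bd)
  have "open W" unfolding W_def by (rule open_vimage[OF op continuous_plane_vector])
  then have "open A" unfolding A_def using open_affinity[of W R 0] R by simp
  then have [measurable]: "A \<in> sets borel" by simp
  obtain K where K: "A \<subseteq> cball 0 K" using bA bounded_any_center[of A 0] by (auto simp: subset_iff)
  define c where "c = (\<lambda>z. \<Sum>k\<in>{- \<lceil>K\<rceil> - 1..\<lceil>K\<rceil>} \<times> {- \<lceil>K\<rceil> - 1..\<lceil>K\<rceil>}. indicat_real A (lattice_point k + z))"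
  have c: "lattice_count A z = c z" if "z \<in> ?S" for z
    unfolding c_def by (rule lattice_count_eq_sum[OF K that])
  have [measurable]: "c \<in> borel_measurable borel" unfolding c_def by measurable
  have [measurable]: "?S \<in> sets borel" by (intro borel_Times) auto
  define b where "b = real (card ({- \<lceil>K\<rceil> - 1..\<lceil>K\<rceil>} \<times> {- \<lceil>K\<rceil> - 1..\<lceil>K\<rceil>}))"
  have cb: "0 \<le> c z" "c z \<le> b" for z
  proof -
    show "0 \<le> c z" unfolding c_def by (intro sum_nonneg) auto
    have "c z \<le> (\<Sum>k\<in>{- \<lceil>K\<rceil> - 1..\<lceil>K\<rceil>} \<times> {- \<lceil>K\<rceil> - 1..\<lceil>K\<rceil>}. 1)"
      unfolding c_def by (intro sum_mono) (simp add: indicator_def)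
    then show "c z \<le> b" by (simp add: b_def)
  qed
  define H where "H = (\<lambda>z. indicator ?S z *\<^sub>R (c z - m) ^ 4)"
  have Hm: "H \<in> borel_measurable borel" unfolding H_def by measurable
  define F where "F = (\<lambda>x. indicator torus x *\<^sub>R (\<bar>discrepancy \<Omega> x R\<bar> powr 4))"
  have FH: "F (plane_vector z) = H z" for z
  proof -
    have "plane_vector z \<in> torus \<longleftrightarrow> z \<in> ?S"
      by (cases z) (auto simp: torus_def mem_box_cart forall_2)
    moreover have "\<bar>discrepancy \<Omega> (plane_vector z) R\<bar> powr 4 = (c z - m) ^ 4" if "z \<in> ?S"
      using discrepancy_eq_lattice_count[OF op bd R, of z] c[OF that]
      unfolding W_def[symmetric] A_def[symmetric] m_def[symmetric] by simp
    ultimately show ?thesis by (simp add: F_def H_def indicator_def)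
  qed
  have F_eq: "F x = H (x $ 1, x $ 2)" for x using FH[of "(x $ 1, x $ 2)"] by simp
  have Fm: "F \<in> borel_measurable borel"
    unfolding F_eq[abs_def]
    by (rule measurable_compose[OF _ Hm]) (intro borel_measurable_continuous_onI continuous_intros)
  have Hi: "integrable lborel H" unfolding H_def
  proof (rule integrableI_bounded_set_indicator[where B="(b + \<bar>m\<bar>) ^ 4"])
    have "bounded ?S" by (intro bounded_Times) auto
    then show "emeasure lborel ?S < \<infinity>" by (rule emeasure_bounded_finite)
    have "\<bar>c z - m\<bar> ^ 4 \<le> (b + \<bar>m\<bar>) ^ 4" for z using cb[of z] by (intro power_mono) auto
    then show "AE z in lborel. z \<in> ?S \<longrightarrow> norm ((c z - m) ^ 4) \<le> (b + \<bar>m\<bar>) ^ 4"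
      by (simp add: power_abs)
  qed measurable
  have Fi: "integrable lborel F"
    using Hi integrable_distr_eq[of plane_vector lborel borel F] Fm by (simp add: lborel_plane_vector FH)
  then have "integrable lebesgue F" using Fm by (simp add: integrable_completion)
  then show "Lp_integrable 4 (\<lambda>x. discrepancy \<Omega> x R)"
    unfolding Lp_integrable_def set_integrable_def F_def .
  have "(LINT x:torus|lebesgue. \<bar>discrepancy \<Omega> x R\<bar> powr 4) = (\<integral>x. F x \<partial>lebesgue)"
    by (simp add: set_lebesgue_integral_def F_def)
  also have "\<dots> = (\<integral>x. F x \<partial>lborel)" using Fm by (simp add: integral_completion)
  also have "\<dots> = (\<integral>z. H z \<partial>lborel)"
    using integral_distr[of plane_vector lborel borel F] Fm by (simp add: lborel_plane_vector FH)
  also have "\<dots> = (\<integral>z. indicator unit_cell z *\<^sub>R (c z - m) ^ 4 \<partial>lborel)"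
  proof (rule integral_cong_AE)
    show "AE z in lborel. H z = indicator unit_cell z *\<^sub>R (c z - m) ^ 4"
      using AE_closed_cell_iff by eventually_elim (simp add: H_def indicator_def)
  qed (use Hm in auto)
  also have "\<dots> = (\<integral>z. (lattice_count A z - m) ^ 4 \<partial>cell_measure)"
    unfolding integral_cell_measure using c unit_cell_subset
    by (intro Bochner_Integration.integral_cong) (auto simp: indicator_def)
  finally show "(LINT x:torus|lebesgue. \<bar>discrepancy \<Omega> x R\<bar> powr 4) =
      (\<integral>z. (lattice_count ((\<lambda>z. R *\<^sub>R z) ` W) z - R\<^sup>2 * measure lborel W) ^ 4 \<partial>cell_measure)"
    unfolding A_def m_def .
qed

theorem theorem2p1:
  fixes \<Omega> :: "(real^2) set"
  assumes "open \<Omega>" and "\<Omega> \<noteq> {}" and "bounded \<Omega>" and "convex \<Omega>"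
    and "smooth_embedded_curve (frontier \<Omega>)"
    and "nonvanishing_curvature (frontier \<Omega>)"
  shows "\<exists>C>0. \<forall>\<^sub>F R in at_top.
           Lp_integrable 4 (\<lambda>x. discrepancy \<Omega> x R) \<and>
           Lp_norm 4 (\<lambda>x. discrepancy \<Omega> x R) \<le> C * R powr (1/2) * ln R powr (1/4)"
proof -
  define W where "W = plane_vector -` \<Omega>"
  obtain M where M: "M > 0" "quadratically_supported M \<Omega>"
    using positive_curvature_quadratically_supported[OF assms] by blast
  obtain x0 where "x0 \<in> \<Omega>" using assms(2) by blast
  then have "(x0 $ 1, x0 $ 2) \<in> W" by (simp add: W_def)
  then have Wne: "W \<noteq> {}" by blast
  have W: "open W" "convex W" "quadratically_supported M W"
    unfolding W_def
    using open_vimage[OF assms(1) continuous_plane_vector] convex_linear_vimage[OF linear_plane_vector assms(4)]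
      quadratically_supported_isometry[OF M(2) linear_plane_vector plane_vector_inner surj_plane_vector] by auto
  have bW: "bounded W" unfolding W_def by (rule bounded_plane_vector_vimage[OF assms(3)])
  obtain C where C: "C > 0" and moment: "\<And>R. R \<ge> 3 \<Longrightarrow>
      (\<integral>x. (lattice_count ((\<lambda>z. R *\<^sub>R z) ` W) x - R\<^sup>2 * measure lborel W) ^ 4 \<partial>cell_measure) \<le> C * R\<^sup>2 * ln R"
    using planar_discrepancy_fourth_moment[OF W(1) bW W(2) Wne W(3)] M(1) by auto
  have "Lp_integrable 4 (\<lambda>x. discrepancy \<Omega> x R) \<and>
      Lp_norm 4 (\<lambda>x. discrepancy \<Omega> x R) \<le> C powr (1/4) * R powr (1/2) * ln R powr (1/4)" if R: "R \<ge> 3" for R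
  proof
    have R0: "R > 0" using R by simp
    show "Lp_integrable 4 (\<lambda>x. discrepancy \<Omega> x R)"
      by (rule discrepancy_torus_integral(1)[OF assms(1,3) R0])
    let ?I = "LINT x:torus|lebesgue. \<bar>discrepancy \<Omega> x R\<bar> powr 4"
    have "?I \<le> C * R\<^sup>2 * ln R"
      unfolding discrepancy_torus_integral(2)[OF assms(1,3) R0] W_def[symmetric] by (rule moment[OF R])
    moreover have "0 \<le> ?I" unfolding set_lebesgue_integral_def by (intro integral_nonneg_AE AE_I2) simp
    ultimately have "?I powr (1/4) \<le> (C * R\<^sup>2 * ln R) powr (1/4)" by (intro powr_mono2) auto
    also have "\<dots> = C powr (1/4) * (R powr 2) powr (1/4) * ln R powr (1/4)"
      using C R by (simp add: powr_mult)
    also have "\<dots> = C powr (1/4) * R powr (1/2) * ln R powr (1/4)"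
      by (simp add: powr_powr del: powr_numeral)
    finally show "Lp_norm 4 (\<lambda>x. discrepancy \<Omega> x R) \<le> C powr (1/4) * R powr (1/2) * ln R powr (1/4)"
      by (simp add: Lp_norm_def)
  qed
  then have "\<forall>\<^sub>F R in at_top. Lp_integrable 4 (\<lambda>x. discrepancy \<Omega> x R) \<and>
      Lp_norm 4 (\<lambda>x. discrepancy \<Omega> x R) \<le> C powr (1/4) * R powr (1/2) * ln R powr (1/4)"
    unfolding eventually_at_top_linorder by blast
  then show ?thesis using C by (intro exI[of _ "C powr (1/4)"]) auto
qed

end
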